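(* Let $a,b,c\in\mathbb{R}$, $\alpha\in(0,2)$, $\varepsilon>0$, $q_m\ge0$, $m$ a positive integer, and set $\varepsilon_m=\varepsilon q_m$, $\lambda_m=c-[a^2(m\pi)^2+b(m\pi)^\alpha]$, $b_m=\lambda_m-\varepsilon_m^2/2$. Suppose $(u,x)\in\mathbf{D}$, and let $\hat U(s,x)$ be an Itô process driven by $$d\hat U(s,x)=\Big(\frac{3\varepsilon_m^2}{2}-b_m\Big)\hat U(s,x)\,ds+\varepsilon_m\hat U(s,x)\,dB(s),\qquad\hat U(0,x)=u,$$ where $B$ is a standard scalar Brownian motion. Then the solution $p(u,t,x)$ of the Fokker--Planck equation $$\frac{\partial}{\partial t}p=\frac{\varepsilon_m^2}{2}u^2\frac{\partial^2}{\partial u^2}p+\Big(\frac{3\varepsilon_m^2}{2}-b_m\Big)u\frac{\partial}{\partial u}p+\Big(\frac{\varepsilon_m^2}{2}-b_m\Big)p,\quad(u,x)\in\mathbf{D},$$ with initial value $$p(u,0,x)=\frac{1}{|u|\sqrt{2\pi\nu(0)}}\exp\Big\{-\frac{(\ln|u|-\mu(0,x))^2}{2\nu(0)}\Big\},\quad(u,x)\in\mathbf{D},$$ admits the probabilistic representation $$p(u,t,x)=\exp\Big\{\Big(\frac{\varepsilon_m^2}{2}-b_m\Big)t\Big\}\,\mathbb{E}\big[p(\hat U(t,x),0,x)\,\big|\,\hat U(0,x)=u\big],\quad t>0,\ (u,x)\in\mathbf{D}.$$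
   Context: Sets: for $k\in\{0,\ldots,\lfloor(m-1)/2\rfloor\}$, $\mathbf{D}_{1,m}^k=\{(u,x):u\in(0,\infty),\ x\in(\frac{2k}m,\frac{2k+1}m)\}$ and $\mathbf{D}_{2,m}^k=\{(u,x):u\in(-\infty,0),\ x\in(\frac{2k+1}m,\frac{2k+2}m)\cap(0,1)\}$; $\mathbf{D}=\bigcup_{k=0}^{\lfloor(m-1)/2\rfloor}[\mathbf{D}_{1,m}^k\cup\mathbf{D}_{2,m}^k]$. Initial data: $U_m(0)>0$ is a log-normal random variable, i.e. $\ln U_m(0)$ is normal with mean $\mathbb{E}[\ln U_m(0)]\in\mathbb{R}$ and variance $\mathrm{Var}[\ln U_m(0)]\in(0,\infty)$. With $\tilde e_m(x)=\sqrt2\sin(m\pi x)$, put $\mu(t,x)=\mathbb{E}[\ln U_m(0)]+b_mt+\ln|\tilde e_m(x)|$ and $\nu(t)=\mathrm{Var}[\ln U_m(0)]+\varepsilon_m^2t$. The solution $p$ of the Fokker--Planck equation referred to is the density of $U(t,x)=U_m(t)\tilde e_m(x)$, with $dU_m(t)=\lambda_mU_m(t)\,dt+\varepsilon_mU_m(t)\,dW_m(t)$ ($W_m$ a standard Brownian motion independent of $U_m(0)$), namely $p(u,t,x)=\frac{1}{|u|\sqrt{2\pi\nu(t)}}\exp\{-\frac{(\ln|u|-\mu(t,x))^2}{2\nu(t)}\}$ for $(u,x)\in\mathbf{D}$, $t\ge0$. *)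

theory Defs
  imports "HOL-Probability.Probability"
begin

section \<open>Filtrations, Brownian motion and the Ito integral\<close>

text \<open>
  Time is the half-line of nonnegative reals. Only the members \<open>F t\<close> with \<open>t \<ge> 0\<close> are ever
  used; a filtration indexed by \<open>t \<ge> 0\<close> extends to all reals by \<open>F t = F 0\<close> for \<open>t < 0\<close>.
  Neither completeness nor right-continuity is required.
\<close>

definition filtration_on :: "'w measure \<Rightarrow> (real \<Rightarrow> 'w measure) \<Rightarrow> bool" where
  "filtration_on M F \<longleftrightarrow> filtration (space M) F \<and> (\<forall>t. subalgebra M (F t))"

definition adapted :: "(real \<Rightarrow> 'w measure) \<Rightarrow> (real \<Rightarrow> 'w \<Rightarrow> real) \<Rightarrow> bool" where
  "adapted F X \<longleftrightarrow> (\<forall>t\<ge>0. X t \<in> borel_measurable (F t))"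

definition progressive :: "(real \<Rightarrow> 'w measure) \<Rightarrow> (real \<Rightarrow> 'w \<Rightarrow> real) \<Rightarrow> bool" where
  "progressive F H \<longleftrightarrow>
     (\<forall>t\<ge>0. (\<lambda>(s, \<omega>). H s \<omega>) \<in> borel_measurable (restrict_space borel {0..t} \<Otimes>\<^sub>M F t))"

definition continuous_paths :: "'w measure \<Rightarrow> (real \<Rightarrow> 'w \<Rightarrow> real) \<Rightarrow> bool" where
  "continuous_paths M X \<longleftrightarrow> (AE \<omega> in M. continuous_on {0..} (\<lambda>t. X t \<omega>))"

definition brownian_motion ::
  "'w measure \<Rightarrow> (real \<Rightarrow> 'w measure) \<Rightarrow> (real \<Rightarrow> 'w \<Rightarrow> real) \<Rightarrow> bool" where
  "brownian_motion M F B \<longleftrightarrow>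
     prob_space M \<and> filtration_on M F \<and> adapted F B \<and> continuous_paths M B \<and>
     (AE \<omega> in M. B 0 \<omega> = 0) \<and>
     (\<forall>s t. 0 \<le> s \<longrightarrow> s < t \<longrightarrow>
        distributed M lborel (\<lambda>\<omega>. B t \<omega> - B s \<omega>) (normal_density 0 (sqrt (t - s))) \<and>
        prob_space.indep_set M (sets (F s))
          {(\<lambda>\<omega>. B t \<omega> - B s \<omega>) -` A \<inter> space M | A. A \<in> sets borel})"

text \<open>
  A simple integrand is \<open>\<Sum>i<n. \<xi> i * indicator {\<tau> i <.. \<tau> (i+1)}\<close> with bounded, \<open>F (\<tau> i)\<close>-measurable
  coefficients; its integral over \<open>[0, t]\<close> is the usual sum of increments stopped at \<open>t\<close>.
\<close>

definition simple_integrand ::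
  "(real \<Rightarrow> 'w measure) \<Rightarrow> nat \<Rightarrow> (nat \<Rightarrow> real) \<Rightarrow> (nat \<Rightarrow> 'w \<Rightarrow> real) \<Rightarrow> bool" where
  "simple_integrand F n \<tau> \<xi> \<longleftrightarrow>
     0 \<le> \<tau> 0 \<and> (\<forall>i<n. \<tau> i \<le> \<tau> (Suc i)) \<and>
     (\<forall>i<n. \<xi> i \<in> borel_measurable (F (\<tau> i)) \<and> (\<exists>C. \<forall>\<omega>\<in>space (F (\<tau> i)). \<bar>\<xi> i \<omega>\<bar> \<le> C))"

definition simple_process :: "nat \<Rightarrow> (nat \<Rightarrow> real) \<Rightarrow> (nat \<Rightarrow> 'w \<Rightarrow> real) \<Rightarrow> real \<Rightarrow> 'w \<Rightarrow> real" where
  "simple_process n \<tau> \<xi> s \<omega> = (\<Sum>i<n. \<xi> i \<omega> * indicator {\<tau> i<..\<tau> (Suc i)} s)"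

definition simple_ito_integral ::
  "(real \<Rightarrow> 'w \<Rightarrow> real) \<Rightarrow> nat \<Rightarrow> (nat \<Rightarrow> real) \<Rightarrow> (nat \<Rightarrow> 'w \<Rightarrow> real) \<Rightarrow> real \<Rightarrow> 'w \<Rightarrow> real" where
  "simple_ito_integral B n \<tau> \<xi> t \<omega> =
     (\<Sum>i<n. \<xi> i \<omega> * (B (min (\<tau> (Suc i)) t) \<omega> - B (min (\<tau> i) t) \<omega>))"

text \<open>
  \<open>I\<close> is (a version of) the Ito integral of \<open>H\<close> with respect to \<open>B\<close> over \<open>[0, t]\<close>: both limits are limits
  in probability, so that all progressive \<open>H\<close> with almost surely square-integrable paths are
  covered. The first integral is taken in the extended nonnegative reals, hence is never a junk
  value.
\<close>

definition has_ito_integral ::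
  "'w measure \<Rightarrow> (real \<Rightarrow> 'w measure) \<Rightarrow> (real \<Rightarrow> 'w \<Rightarrow> real) \<Rightarrow>
   (real \<Rightarrow> 'w \<Rightarrow> real) \<Rightarrow> real \<Rightarrow> ('w \<Rightarrow> real) \<Rightarrow> bool" where
  "has_ito_integral M F B H t I \<longleftrightarrow>
     progressive F H \<and> (AE \<omega> in M. set_integrable lborel {0..t} (\<lambda>s. (H s \<omega>)\<^sup>2)) \<and>
     I \<in> borel_measurable M \<and>
     (\<exists>n \<tau> \<xi>. (\<forall>k. simple_integrand F (n k) (\<tau> k) (\<xi> k)) \<and>
        (\<forall>e>0. (\<lambda>k. measure M {\<omega>\<in>space M.
             (\<integral>\<^sup>+ s\<in>{0..t}. ennreal ((simple_process (n k) (\<tau> k) (\<xi> k) s \<omega> - H s \<omega>)\<^sup>2) \<partial>lborel)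
               > ennreal e}) \<longlonglongrightarrow> 0) \<and>
        (\<forall>e>0. (\<lambda>k. measure M {\<omega>\<in>space M.
             \<bar>simple_ito_integral B (n k) (\<tau> k) (\<xi> k) t \<omega> - I \<omega>\<bar> > e}) \<longlonglongrightarrow> 0))"

text \<open>\<open>X\<close> is an Ito process with \<open>dX(s) = f(s) ds + g(s) dB(s)\<close>.\<close>

definition ito_process ::
  "'w measure \<Rightarrow> (real \<Rightarrow> 'w measure) \<Rightarrow> (real \<Rightarrow> 'w \<Rightarrow> real) \<Rightarrow>
   (real \<Rightarrow> 'w \<Rightarrow> real) \<Rightarrow> (real \<Rightarrow> 'w \<Rightarrow> real) \<Rightarrow> (real \<Rightarrow> 'w \<Rightarrow> real) \<Rightarrow> bool" where
  "ito_process M F B X f g \<longleftrightarrow>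
     adapted F X \<and> continuous_paths M X \<and> progressive F f \<and> progressive F g \<and>
     (\<forall>t\<ge>0. (AE \<omega> in M. set_integrable lborel {0..t} (\<lambda>s. f s \<omega>)) \<and>
        (\<exists>I. has_ito_integral M F B g t I \<and>
             (AE \<omega> in M. X t \<omega> = X 0 \<omega> + (LBINT s:{0..t}. f s \<omega>) + I \<omega>)))"

section \<open>Domain, initial data and the Fokker--Planck equation\<close>

definition D1 :: "nat \<Rightarrow> nat \<Rightarrow> (real \<times> real) set" where
  "D1 m k = {(u, x). u \<in> {0<..} \<and> x \<in> {real (2*k) / real m <..< real (2*k+1) / real m}}"

definition D2 :: "nat \<Rightarrow> nat \<Rightarrow> (real \<times> real) set" where
  "D2 m k = {(u, x). u \<in> {..<0} \<and>
     x \<in> {real (2*k+1) / real m <..< real (2*k+2) / real m} \<inter> {0<..<1}}"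

definition D :: "nat \<Rightarrow> (real \<times> real) set" where
  "D m = (\<Union>k\<in>{0..(m - 1) div 2}. D1 m k \<union> D2 m k)"

definition log_normal :: "'v measure \<Rightarrow> ('v \<Rightarrow> real) \<Rightarrow> bool" where
  "log_normal N Y \<longleftrightarrow>
     prob_space N \<and> Y \<in> borel_measurable N \<and> (AE \<omega> in N. 0 < Y \<omega>) \<and>
     (\<exists>\<mu> \<sigma>. 0 < \<sigma> \<and> distributed N lborel (\<lambda>\<omega>. ln (Y \<omega>)) (normal_density \<mu> \<sigma>))"

definition e_tilde :: "nat \<Rightarrow> real \<Rightarrow> real" where
  "e_tilde m x = sqrt 2 * sin (real m * pi * x)"

definition mu :: "'v measure \<Rightarrow> ('v \<Rightarrow> real) \<Rightarrow> real \<Rightarrow> nat \<Rightarrow> real \<Rightarrow> real \<Rightarrow> real" where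
  "mu N U0 b_m m t x =
     prob_space.expectation N (\<lambda>\<omega>. ln (U0 \<omega>)) + b_m * t + ln \<bar>e_tilde m x\<bar>"

definition nu :: "'v measure \<Rightarrow> ('v \<Rightarrow> real) \<Rightarrow> real \<Rightarrow> real \<Rightarrow> real" where
  "nu N U0 eps_m t = prob_space.variance N (\<lambda>\<omega>. ln (U0 \<omega>)) + eps_m\<^sup>2 * t"

definition fp_density ::
  "'v measure \<Rightarrow> ('v \<Rightarrow> real) \<Rightarrow> real \<Rightarrow> real \<Rightarrow> nat \<Rightarrow> real \<Rightarrow> real \<Rightarrow> real \<Rightarrow> real" where
  "fp_density N U0 b_m eps_m m u t x =
     1 / (\<bar>u\<bar> * sqrt (2 * pi * nu N U0 eps_m t)) *
     exp (- ((ln \<bar>u\<bar> - mu N U0 b_m m t x)\<^sup>2 / (2 * nu N U0 eps_m t)))"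

text \<open>
  Classical solution on \<open>D m\<close> for \<open>t > 0\<close>, attaining the initial value \<open>p0\<close> at \<open>t = 0\<close> continuously.
\<close>

definition solves_fokker_planck ::
  "nat \<Rightarrow> real \<Rightarrow> real \<Rightarrow> (real \<Rightarrow> real \<Rightarrow> real \<Rightarrow> real) \<Rightarrow> (real \<Rightarrow> real \<Rightarrow> real) \<Rightarrow> bool" where
  "solves_fokker_planck m b_m eps_m p p0 \<longleftrightarrow>
     (\<exists>p_t p_u p_uu. \<forall>(u, x)\<in>D m. \<forall>t>0.
        ((\<lambda>s. p u s x) has_real_derivative p_t u t x) (at t) \<and>
        ((\<lambda>v. p v t x) has_real_derivative p_u u t x) (at u) \<and>
        ((\<lambda>v. p_u v t x) has_real_derivative p_uu u t x) (at u) \<and>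
        p_t u t x = eps_m\<^sup>2 / 2 * u\<^sup>2 * p_uu u t x
                    + (3 * eps_m\<^sup>2 / 2 - b_m) * u * p_u u t x
                    + (eps_m\<^sup>2 / 2 - b_m) * p u t x) \<and>
     (\<forall>(u, x)\<in>D m. p u 0 x = p0 u x \<and> ((\<lambda>t. p u t x) \<longlongrightarrow> p0 u x) (at_right 0))"

text \<open>
  Elementary conditional expectation given an event of positive probability:
  \<open>uniform_measure M A\<close> is the conditional probability measure of \<open>M\<close> given \<open>A\<close>.
\<close>

definition cond_expectation_event :: "'w measure \<Rightarrow> ('w \<Rightarrow> real) \<Rightarrow> 'w set \<Rightarrow> real" where
  "cond_expectation_event M Z A = (\<integral>\<omega>. Z \<omega> \<partial>uniform_measure M A)"

end

theory Submission
  imports Defs "HOL-Real_Asymp.Real_Asymp"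
begin

text \<open>
  The law of \<open>U_hat t\<close> is found by showing that a linear stochastic differential equation
  \<open>dX = \<alpha> X ds + \<epsilon> X dB\<close> with \<open>X 0 = u\<close> forces \<open>X\<close> to be the geometric Brownian motion
  \<open>u exp((\<alpha> - \<epsilon>\<^sup>2/2) t + \<epsilon> B t)\<close>. Both processes satisfy
  \<open>X t - X 0 = lim (\<Sum>i. X t\<^sub>i (\<alpha> \<Delta> + \<epsilon> (B t\<^sub>i\<^sub>+\<^sub>1 - B t\<^sub>i)))\<close> in probability along uniform partitions: for an
  Ito process this follows from the estimate
  \<open>P(\<bar>\<integral> H dB\<bar> > e) \<le> P(\<integral> H\<^sup>2 ds > \<delta>) + \<delta>/e\<^sup>2\<close> for simple \<open>H\<close>, for the geometric Brownian motion from an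
  \<open>L\<^sup>2\<close> estimate of the Euler error, so that Ito's formula is never needed. The difference of the two
  processes then vanishes by a localised Gronwall argument. What remains is that the explicit density
  solves the Fokker--Planck equation, and a convolution of two Gaussian densities.
\<close>

section \<open>Increments of Brownian motion\<close>

text \<open>The integral in the hypothesis is known only, for each \<open>t\<close> separately, as a
  limit in probability along some unspecified simple integrands. Moments of the integrand are not
  given, so the isometry cannot be applied to it; the tail estimate takes its place, since it sees
  the integrand only through the probability that its squared path norm is large. It must cover
  differences of simple integrals over unrelated partitions, for this is how the unknown
  approximation is exchanged for samples on a uniform grid. The grid relation is linear in the
  process, so uniqueness concerns a process starting at zero. Its second moments might still be
  infinite, hence the cut-off at a level \<open>K\<close>. The coefficients of the equation come
  from expanding \<open>- d/du (lam_m u p) + 1/2 d^2/du^2 (eps_m^2 u^2 p)\<close> with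
  \<open>lam_m = b_m + eps_m^2 / 2\<close>: the terms of order two and one form the generator of
  \<open>U_hat\<close>, and the term of order zero is a constant potential, which accounts for the
  exponential factor.\<close>

lemma integrable_mult_of_squares:
  fixes f g :: "'a \<Rightarrow> real"
  assumes [measurable]: "f \<in> borel_measurable M" "g \<in> borel_measurable M"
    and "integrable M (\<lambda>x. (f x)\<^sup>2)" "integrable M (\<lambda>x. (g x)\<^sup>2)"
  shows "integrable M (\<lambda>x. f x * g x)"
proof (rule Bochner_Integration.integrable_bound)
  show "integrable M (\<lambda>x. (f x)\<^sup>2 + (g x)\<^sup>2)" using assms by simp
  show "AE x in M. norm (f x * g x) \<le> norm ((f x)\<^sup>2 + (g x)\<^sup>2)"
  proof (rule AE_I2)
    fix x
    have "2 * \<bar>f x\<bar> * \<bar>g x\<bar> \<le> (f x)\<^sup>2 + (g x)\<^sup>2"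
      using sum_squares_bound[of "\<bar>f x\<bar>" "\<bar>g x\<bar>"] by simp
    moreover have "0 \<le> \<bar>f x\<bar> * \<bar>g x\<bar>" by simp
    ultimately show "norm (f x * g x) \<le> norm ((f x)\<^sup>2 + (g x)\<^sup>2)"
      unfolding real_norm_def abs_mult by linarith
  qed
qed simp

locale brownian =
  fixes M :: "'w measure" and F :: "real \<Rightarrow> 'w measure" and B :: "real \<Rightarrow> 'w \<Rightarrow> real"
  assumes bm: "brownian_motion M F B"

sublocale brownian \<subseteq> prob_space M
  using bm by (simp add: brownian_motion_def)

context brownian
begin

lemma space_F [simp]: "space (F t) = space M"
  using bm by (simp add: brownian_motion_def filtration_on_def subalgebra_def)

lemma measurable_F_M: "f \<in> borel_measurable (F t) \<Longrightarrow> f \<in> borel_measurable M"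
  using bm by (auto simp: brownian_motion_def filtration_on_def intro: measurable_from_subalg)

lemma sets_F_mono: "s \<le> t \<Longrightarrow> sets (F s) \<subseteq> sets (F t)"
  using bm by (auto simp: brownian_motion_def filtration_on_def filtration_def)

lemma measurable_F_mono:
  "f \<in> borel_measurable (F s) \<Longrightarrow> s \<le> t \<Longrightarrow> f \<in> borel_measurable (F t)"
  using sets_F_mono by (intro measurable_from_subalg[of "F t" "F s"]) (auto simp: subalgebra_def)

lemma B_measurable_F: "0 \<le> s \<Longrightarrow> B s \<in> borel_measurable (F s)"
  using bm by (simp add: brownian_motion_def adapted_def)

lemma B_measurable: "0 \<le> s \<Longrightarrow> B s \<in> borel_measurable M"
  by (blast intro: measurable_F_M B_measurable_F)

lemma increment_distributed:
  "0 \<le> s \<Longrightarrow> s < t \<Longrightarrow>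
    distributed M lborel (\<lambda>\<omega>. B t \<omega> - B s \<omega>) (normal_density 0 (sqrt (t - s)))"
  using bm by (simp add: brownian_motion_def)

lemma increment_measurable_F:
  fixes g :: "real \<Rightarrow> real"
  assumes "0 \<le> s" "s \<le> t" "g \<in> borel_measurable borel"
  shows "(\<lambda>\<omega>. g (B t \<omega> - B s \<omega>)) \<in> borel_measurable (F t)"
proof -
  have "(\<lambda>\<omega>. B t \<omega> - B s \<omega>) \<in> borel_measurable (F t)"
    using B_measurable_F[of t] measurable_F_mono[OF B_measurable_F[of s], of t] assms
    by (intro borel_measurable_diff) auto
  from measurable_compose[OF this assms(3)] show ?thesis .
qed

text \<open>\<open>brownian_motion\<close> speaks of a sigma-algebra and a family of preimages,
  whereas the product rule for expectations is about random variables; this lemma is the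
  bridge.\<close>

lemma increment_indep_var:
  fixes f :: "'w \<Rightarrow> real" and g :: "real \<Rightarrow> real"
  assumes s: "0 \<le> s" "s < t" and f: "f \<in> borel_measurable (F s)"
    and [measurable]: "g \<in> borel_measurable borel"
  shows "indep_var borel f borel (\<lambda>\<omega>. g (B t \<omega> - B s \<omega>))"
proof -
  let ?Z = "\<lambda>\<omega>. B t \<omega> - B s \<omega>"
  let ?A = "{?Z -` A \<inter> space M | A. A \<in> sets borel}"
  have ind: "indep_set (sets (F s)) ?A"
    using bm s by (simp add: brownian_motion_def)
  have Zm: "?Z \<in> borel_measurable M"
    using B_measurable s by (intro borel_measurable_diff) auto
  have "indep_var borel f borel ?Z"
    unfolding indep_var_eq
  proof (intro conjI)
    show "random_variable borel f" using f by (rule measurable_F_M)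
    show "random_variable borel ?Z" by (rule Zm)
    have 1: "sigma_sets (space M) {f -` A \<inter> space M |A. A \<in> sets borel} \<subseteq> sets (F s)"
      using sets.sigma_sets_subset[of "{f -` A \<inter> space M |A. A \<in> sets borel}" "F s"]
        measurable_sets[OF f] by auto
    \<comment> \<open>The preimages of Borel sets already form a sigma-algebra, so generating one
      from them adds nothing and the independence in the definition applies as it stands.\<close>
    have "?A = sets (vimage_algebra (space M) ?Z borel)"
      by (simp add: sets_vimage_algebra2)
    then have 2: "sigma_sets (space M) ?A = ?A"
      using sets.sigma_sets_eq[of "vimage_algebra (space M) ?Z borel"] by simp
    show "indep_set (sigma_sets (space M) {f -` A \<inter> space M |A. A \<in> sets borel}) (sigma_sets (space M) ?A)"
      unfolding 2 using ind 1 unfolding indep_sets2_eq by blast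
  qed
  from indep_var_compose[OF this, of "\<lambda>x. x" borel g borel]
  show ?thesis by (simp add: comp_def)
qed

lemma increment_mult:
  fixes f :: "'w \<Rightarrow> real" and g :: "real \<Rightarrow> real"
  assumes s: "0 \<le> s" "s < t" and f: "f \<in> borel_measurable (F s)" "integrable M f"
    and g: "g \<in> borel_measurable borel" "integrable M (\<lambda>\<omega>. g (B t \<omega> - B s \<omega>))"
  shows "integrable M (\<lambda>\<omega>. f \<omega> * g (B t \<omega> - B s \<omega>))"
    and "expectation (\<lambda>\<omega>. f \<omega> * g (B t \<omega> - B s \<omega>)) =
         expectation f * expectation (\<lambda>\<omega>. g (B t \<omega> - B s \<omega>))"
  using indep_var_integrable[OF increment_indep_var[OF s f(1) g(1)] f(2) g(2)]
    indep_var_lebesgue_integral[OF increment_indep_var[OF s f(1) g(1)] f(2) g(2)] by auto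

text \<open>Nonnegativity of \<open>p n\<close> travels through the same induction, because
  adaptedness of \<open>B\<close> is available only at nonnegative times.\<close>

lemma sum_measurable_F:
  fixes c :: "nat \<Rightarrow> 'w \<Rightarrow> real" and g :: "nat \<Rightarrow> real \<Rightarrow> real"
  assumes p: "0 \<le> p 0" "\<And>j. j < n \<Longrightarrow> p j < p (Suc j)"
    and c: "\<And>j. j < n \<Longrightarrow> c j \<in> borel_measurable (F (p j))"
    and g: "\<And>j. j < n \<Longrightarrow> g j \<in> borel_measurable borel"
  shows "0 \<le> p n \<and> (\<lambda>\<omega>. \<Sum>j<n. c j \<omega> * g j (B (p (Suc j)) \<omega> - B (p j) \<omega>)) \<in> borel_measurable (F (p n))"
  using p c g
proof (induction n)
  case (Suc n)
  then have IH: "0 \<le> p n" "(\<lambda>\<omega>. \<Sum>j<n. c j \<omega> * g j (B (p (Suc j)) \<omega> - B (p j) \<omega>)) \<in> borel_measurable (F (p n))"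
    by simp_all
  have lt: "p n < p (Suc n)" using Suc.prems by simp
  have "(\<lambda>\<omega>. c n \<omega> * g n (B (p (Suc n)) \<omega> - B (p n) \<omega>)) \<in> borel_measurable (F (p (Suc n)))"
    using measurable_F_mono[OF Suc.prems(3)[of n] less_imp_le[OF lt]]
      increment_measurable_F[OF IH(1) less_imp_le[OF lt] Suc.prems(4)[of n]]
    by (intro borel_measurable_times) auto
  note borel_measurable_add[OF measurable_F_mono[OF IH(2) less_imp_le[OF lt]] this]
  then show ?case using IH(1) lt by simp
qed simp

text \<open>
  Stated for centred functions of the increments, because the Euler error of geometric Brownian
  motion is of this kind.
\<close>

lemma sum_increments_isometry:
  fixes c :: "nat \<Rightarrow> 'w \<Rightarrow> real" and g :: "nat \<Rightarrow> real \<Rightarrow> real"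
  assumes p: "0 \<le> p 0" "\<And>j. j < n \<Longrightarrow> p j < p (Suc j)"
    and c: "\<And>j. j < n \<Longrightarrow> c j \<in> borel_measurable (F (p j))"
    and g: "\<And>j. j < n \<Longrightarrow> g j \<in> borel_measurable borel"
    and c2: "\<And>j. j < n \<Longrightarrow> integrable M (\<lambda>\<omega>. (c j \<omega>)\<^sup>2)"
    and g2: "\<And>j. j < n \<Longrightarrow> integrable M (\<lambda>\<omega>. (g j (B (p (Suc j)) \<omega> - B (p j) \<omega>))\<^sup>2)"
    and g0: "\<And>j. j < n \<Longrightarrow> expectation (\<lambda>\<omega>. g j (B (p (Suc j)) \<omega> - B (p j) \<omega>)) = 0"
  shows "integrable M (\<lambda>\<omega>. (\<Sum>j<n. c j \<omega> * g j (B (p (Suc j)) \<omega> - B (p j) \<omega>))\<^sup>2) \<and>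
    expectation (\<lambda>\<omega>. (\<Sum>j<n. c j \<omega> * g j (B (p (Suc j)) \<omega> - B (p j) \<omega>))\<^sup>2) =
      (\<Sum>j<n. expectation (\<lambda>\<omega>. (c j \<omega>)\<^sup>2) * expectation (\<lambda>\<omega>. (g j (B (p (Suc j)) \<omega> - B (p j) \<omega>))\<^sup>2))"
  using p c g c2 g2 g0
proof (induction n)
  case (Suc n)
  define S where "S = (\<lambda>\<omega>. \<Sum>j<n. c j \<omega> * g j (B (p (Suc j)) \<omega> - B (p j) \<omega>))"
  define G where "G = (\<lambda>\<omega>. g n (B (p (Suc n)) \<omega> - B (p n) \<omega>))"
  have IH: "integrable M (\<lambda>\<omega>. (S \<omega>)\<^sup>2)" "expectation (\<lambda>\<omega>. (S \<omega>)\<^sup>2) =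
      (\<Sum>j<n. expectation (\<lambda>\<omega>. (c j \<omega>)\<^sup>2) * expectation (\<lambda>\<omega>. (g j (B (p (Suc j)) \<omega> - B (p j) \<omega>))\<^sup>2))"
    unfolding S_def using Suc by simp_all
  have pn: "0 \<le> p n" and S: "S \<in> borel_measurable (F (p n))"
    unfolding S_def using sum_measurable_F[of p n c g] Suc.prems by simp_all
  have lt: "p n < p (Suc n)" using Suc.prems by simp
  have c: "c n \<in> borel_measurable (F (p n))" and c2: "integrable M (\<lambda>\<omega>. (c n \<omega>)\<^sup>2)"
    and g[measurable]: "g n \<in> borel_measurable borel" using Suc.prems by simp_all
  note [measurable] = measurable_F_M[OF S] measurable_F_M[OF c]
  have G[measurable]: "G \<in> borel_measurable M"
    unfolding G_def by (rule measurable_F_M[OF increment_measurable_F]) (use pn lt in auto)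
  have G2: "integrable M (\<lambda>\<omega>. (G \<omega>)\<^sup>2)" unfolding G_def using Suc.prems by simp
  have G1: "integrable M G" using square_integrable_imp_integrable[OF G G2] .
  have Sc: "integrable M (\<lambda>\<omega>. S \<omega> * c n \<omega>)"
    by (rule integrable_mult_of_squares) (use IH c2 in auto)
  \<comment> \<open>\<open>S\<close> and \<open>c n\<close> are known at time \<open>p n\<close>,
    while \<open>G\<close> is independent of that past and has mean zero, so the cross term of the
    square drops out.\<close>
  have 1: "integrable M (\<lambda>\<omega>. (S \<omega> * c n \<omega>) * G \<omega>)" "expectation (\<lambda>\<omega>. (S \<omega> * c n \<omega>) * G \<omega>) = 0"
    unfolding G_def
    using increment_mult[OF pn lt borel_measurable_times[OF S c] Sc g G1[unfolded G_def]] Suc.prems(7)[of n] by auto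
  have g2: "(\<lambda>x. (g n x)\<^sup>2) \<in> borel_measurable borel" and c2': "(\<lambda>x. (c n x)\<^sup>2) \<in> borel_measurable (F (p n))"
    using c by measurable
  have 2: "integrable M (\<lambda>\<omega>. (c n \<omega>)\<^sup>2 * (G \<omega>)\<^sup>2)"
      "expectation (\<lambda>\<omega>. (c n \<omega>)\<^sup>2 * (G \<omega>)\<^sup>2) = expectation (\<lambda>\<omega>. (c n \<omega>)\<^sup>2) * expectation (\<lambda>\<omega>. (G \<omega>)\<^sup>2)"
    unfolding G_def using increment_mult[OF pn lt c2' c2 g2 G2[unfolded G_def]] by auto
  have eq: "(S \<omega> + c n \<omega> * G \<omega>)\<^sup>2 = (S \<omega>)\<^sup>2 + 2 * (S \<omega> * c n \<omega> * G \<omega>) + (c n \<omega>)\<^sup>2 * (G \<omega>)\<^sup>2" for \<omega>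
    by (simp add: power2_sum power_mult_distrib)
  have "integrable M (\<lambda>\<omega>. (S \<omega> + c n \<omega> * G \<omega>)\<^sup>2)"
    "expectation (\<lambda>\<omega>. (S \<omega> + c n \<omega> * G \<omega>)\<^sup>2) = expectation (\<lambda>\<omega>. (S \<omega>)\<^sup>2) + expectation (\<lambda>\<omega>. (c n \<omega>)\<^sup>2) * expectation (\<lambda>\<omega>. (G \<omega>)\<^sup>2)"
    unfolding eq using IH(1) 1 2 by simp_all
  then show ?case unfolding S_def G_def IH(2)[unfolded S_def] by (simp add: IH(2)[unfolded S_def])
qed simp

end

section \<open>Simple integrals\<close>

lemma partition_less:
  fixes p :: "nat \<Rightarrow> real"
  assumes "\<And>j. j < n \<Longrightarrow> p j < p (Suc j)" "i < j" "j \<le> n"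
  shows "p i < p j"
  using assms(2,3)
proof (induction j)
  case (Suc j)
  then show ?case using assms(1)[of j] by (cases "i = j") auto
qed simp

lemma partition_less_iff:
  fixes p :: "nat \<Rightarrow> real"
  assumes "\<And>j. j < n \<Longrightarrow> p j < p (Suc j)" "i \<le> n" "j \<le> n"
  shows "p i < p j \<longleftrightarrow> i < j"
  using partition_less[of n p i j] partition_less[of n p j i] assms by (cases i j rule: linorder_cases) auto

lemma partition_le_iff:
  fixes p :: "nat \<Rightarrow> real"
  assumes "\<And>j. j < n \<Longrightarrow> p j < p (Suc j)" "i \<le> n" "j \<le> n"
  shows "p i \<le> p j \<longleftrightarrow> i \<le> j"
  using partition_less_iff[of n p j i, OF assms(1)] assms(2,3) by (simp add: not_less[symmetric])

text \<open>Supplies the common refinement of several unrelated intervals.\<close>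

lemma partition_of_finite_set:
  fixes P :: "real set"
  assumes "finite P" "P \<noteq> {}"
  obtains p :: "nat \<Rightarrow> real" and n where "\<And>j. j < n \<Longrightarrow> p j < p (Suc j)" "P = p ` {..n}"
proof
  let ?L = "sorted_list_of_set P"
  have len: "length ?L = Suc (card P - 1)" using assms by (simp add: card_gt_0_iff)
  show "?L ! j < ?L ! Suc j" if "j < card P - 1" for j
    using that len strict_sorted_list_of_set[of P] by (simp add: sorted_wrt_nth_less)
  have "P = set ?L" using assms by simp
  also have "\<dots> = (!) ?L ` {..card P - 1}"
    unfolding set_conv_nth len lessThan_Suc_atMost[symmetric] by auto
  finally show "P = (!) ?L ` {..card P - 1}" .
qed

lemma partition_cell:
  fixes p :: "nat \<Rightarrow> real"
  assumes "p 0 < s" "s \<le> p n"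
  obtains j where "j < n" "p j < s" "s \<le> p (Suc j)"
proof -
  from assms have "\<exists>j<n. p j < s \<and> s \<le> p (Suc j)"
  proof (induction n)
    case (Suc n)
    show ?case
    proof (cases "s \<le> p n")
      case True
      then show ?thesis using Suc less_SucI by blast
    next
      case False
      then show ?thesis using Suc by (intro exI[of _ n]) auto
    qed
  qed simp
  then show ?thesis using that by blast
qed

lemma partition_indicator_sum:
  fixes p a :: "nat \<Rightarrow> real"
  assumes p: "\<And>j. j < n \<Longrightarrow> p j < p (Suc j)" and j: "j < n" "p j < s" "s \<le> p (Suc j)"
  shows "(\<Sum>i<n. a i * indicator {p i<..p (Suc i)} s) = a j"
proof -
  have "indicator {p i<..p (Suc i)} s = (if i = j then 1 else 0 :: real)" if "i < n" for i
  proof (cases i j rule: linorder_cases)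
    case less
    then have "p (Suc i) \<le> p j" using j partition_le_iff[of n p "Suc i" j, OF p] by simp
    with less j show ?thesis by simp
  next
    case greater
    then have "p (Suc j) \<le> p i" using j that partition_le_iff[of n p "Suc j" i, OF p] by simp
    with greater j show ?thesis by simp
  qed (use j in simp)
  then have "(\<Sum>i<n. a i * indicator {p i<..p (Suc i)} s) = (\<Sum>i<n. a i * (if i = j then 1 else 0))"
    by (intro sum.cong refl) simp
  also have "\<dots> = a j" using j by (simp add: if_distrib cong: if_cong)
  finally show ?thesis .
qed

text \<open>The right end point \<open>p (Suc j)\<close> stands for its whole cell: it lies in
  \<open>{p k<..p l}\<close> exactly when \<open>k \<le> j < l\<close>, so only the increments
  between \<open>k\<close> and \<open>l\<close> survive.\<close>

lemma partition_telescope: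
  fixes p :: "nat \<Rightarrow> real" and f :: "real \<Rightarrow> real"
  assumes p: "\<And>j. j < n \<Longrightarrow> p j < p (Suc j)" and kl: "k \<le> l" "l \<le> n"
  shows "(\<Sum>j<n. indicator {p k<..p l} (p (Suc j)) * (f (p (Suc j)) - f (p j))) = f (p l) - f (p k)"
proof -
  have "(\<Sum>j<n. indicator {p k<..p l} (p (Suc j)) * (f (p (Suc j)) - f (p j)))
      = (\<Sum>j\<in>{k..<l}. f (p (Suc j)) - f (p j))"
    using kl by (intro sum.mono_neutral_cong_right)
      (auto simp: partition_less_iff[of n p, OF p] partition_le_iff[of n p, OF p] indicator_def Suc_le_eq)
  also have "\<dots> = f (p l) - f (p k)"
    using kl(1) by (rule sum_Suc_diff')
  finally show ?thesis .
qed

section \<open>Tail estimate for simple integrals\<close>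

context brownian
begin

lemma increment_moments:
  assumes "0 \<le> s" "s < t"
  shows "integrable M (\<lambda>\<omega>. (B t \<omega> - B s \<omega>)\<^sup>2)"
    and "expectation (\<lambda>\<omega>. B t \<omega> - B s \<omega>) = 0"
    and "expectation (\<lambda>\<omega>. (B t \<omega> - B s \<omega>)\<^sup>2) = t - s"
proof -
  note D = increment_distributed[OF assms]
  have pos: "0 < sqrt (t - s)" using assms by simp
  show "integrable M (\<lambda>\<omega>. (B t \<omega> - B s \<omega>)\<^sup>2)"
    using distributed_integrable[OF D, of "\<lambda>x. x\<^sup>2"] integrable_normal_moment[OF pos, of 0 2] by simp
  show 0: "expectation (\<lambda>\<omega>. B t \<omega> - B s \<omega>) = 0"
    using normal_distributed_expectation[OF pos D] .
  show "expectation (\<lambda>\<omega>. (B t \<omega> - B s \<omega>)\<^sup>2) = t - s"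
    using normal_distributed_variance[OF pos D] assms unfolding 0 by simp
qed

text \<open>
  The coefficients are set to zero as soon as the running sum of \<open>c\<^sub>i\<^sup>2 (p\<^sub>i\<^sub>+\<^sub>1 - p\<^sub>i)\<close> exceeds \<open>\<delta>\<close>;
  this keeps them adapted and makes them square-integrable.
\<close>

lemma prob_sum_increments_le:
  fixes c :: "nat \<Rightarrow> 'w \<Rightarrow> real"
  assumes p: "0 \<le> p 0" "\<And>j. j < n \<Longrightarrow> p j < p (Suc j)"
    and c: "\<And>j. j < n \<Longrightarrow> c j \<in> borel_measurable (F (p j))"
    and e: "0 < e" and \<delta>: "0 < \<delta>"
  shows "prob {\<omega>\<in>space M. e < \<bar>\<Sum>j<n. c j \<omega> * (B (p (Suc j)) \<omega> - B (p j) \<omega>)\<bar>}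
    \<le> prob {\<omega>\<in>space M. \<delta> < (\<Sum>j<n. (c j \<omega>)\<^sup>2 * (p (Suc j) - p j))} + \<delta> / e\<^sup>2"
proof -
  define q where "q = (\<lambda>j \<omega>. (c j \<omega>)\<^sup>2 * (p (Suc j) - p j))"
  \<comment> \<open>The running sum includes the index \<open>j\<close> itself. As the time step is
    deterministic this is still known at time \<open>p j\<close>, and it bounds \<open>c' j\<close>
    uniformly although \<open>c j\<close> may be unbounded.\<close>
  define c' where "c' = (\<lambda>j \<omega>. if (\<Sum>i\<le>j. q i \<omega>) \<le> \<delta> then c j \<omega> else 0)"
  have p0: "0 \<le> p j" if "j \<le> n" for j
    using partition_le_iff[of n p 0 j, OF p(2)] that p(1) by force
  have q0: "0 \<le> q j \<omega>" if "j < n" for j \<omega>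
    using p(2)[OF that] by (simp add: q_def)
  have qm: "q i \<in> borel_measurable (F (p j))" if "i \<le> j" "j < n" for i j
  proof -
    have "p i \<le> p j" using that partition_le_iff[of n p i j, OF p(2)] by simp
    then have [measurable]: "c i \<in> borel_measurable (F (p j))"
      using that by (intro measurable_F_mono[OF c]) auto
    show ?thesis unfolding q_def by measurable
  qed
  have c'm: "c' j \<in> borel_measurable (F (p j))" if j: "j < n" for j
  proof -
    have [measurable]: "(\<lambda>\<omega>. \<Sum>i\<le>j. q i \<omega>) \<in> borel_measurable (F (p j))"
      using qm j by (intro borel_measurable_sum) auto
    note [measurable] = c[OF j]
    show ?thesis unfolding c'_def by measurable
  qed
  have c'b: "(c' j \<omega>)\<^sup>2 * (p (Suc j) - p j) \<le> \<delta>" if j: "j < n" for j \<omega>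
  proof (cases "(\<Sum>i\<le>j. q i \<omega>) \<le> \<delta>")
    case True
    moreover have "q j \<omega> \<le> (\<Sum>i\<le>j. q i \<omega>)"
      using q0 j by (intro member_le_sum) auto
    ultimately show ?thesis by (simp add: c'_def q_def)
  qed (use \<delta> in \<open>simp add: c'_def\<close>)
  have int: "integrable M (\<lambda>\<omega>. (c' j \<omega>)\<^sup>2)" if j: "j < n" for j
  proof (rule integrable_const_bound)
    show "AE \<omega> in M. norm ((c' j \<omega>)\<^sup>2) \<le> \<delta> / (p (Suc j) - p j)"
      using c'b[OF j] p(2)[OF j] by (intro AE_I2) (simp add: field_simps)
    show "(\<lambda>\<omega>. (c' j \<omega>)\<^sup>2) \<in> borel_measurable M"
      using measurable_F_M[OF c'm[OF j]] by measurable
  qed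
  define S where "S = (\<lambda>\<omega>. \<Sum>j<n. c' j \<omega> * (B (p (Suc j)) \<omega> - B (p j) \<omega>))"
  have iso: "integrable M (\<lambda>\<omega>. (S \<omega>)\<^sup>2)"
    "expectation (\<lambda>\<omega>. (S \<omega>)\<^sup>2) = (\<Sum>j<n. expectation (\<lambda>\<omega>. (c' j \<omega>)\<^sup>2) * (p (Suc j) - p j))"
    using sum_increments_isometry[of p n c' "\<lambda>_ x. x", OF p c'm _ int] increment_moments p0 p(2)
    by (simp_all add: S_def)
  \<comment> \<open>The two bounds support each other: at a step where the cut-off does not act, the
    second one leads to the full sum of \<open>q\<close>, which is then at most
    \<open>\<delta>\<close>; where it acts, the new summand is zero.\<close>
  have sum_le: "(\<Sum>j<k. (c' j \<omega>)\<^sup>2 * (p (Suc j) - p j)) \<le> \<delta> \<and>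
     (\<Sum>j<k. (c' j \<omega>)\<^sup>2 * (p (Suc j) - p j)) \<le> (\<Sum>j<k. q j \<omega>)" if "k \<le> n" for k \<omega>
    using that
  proof (induction k)
    case (Suc k)
    then show ?case using q0[of k \<omega>]
      by (auto simp: c'_def q_def lessThan_Suc_atMost[symmetric])
  qed (use \<delta> in simp)
  have "expectation (\<lambda>\<omega>. (S \<omega>)\<^sup>2) = expectation (\<lambda>\<omega>. \<Sum>j<n. (c' j \<omega>)\<^sup>2 * (p (Suc j) - p j))"
    unfolding iso(2) using int by (subst Bochner_Integration.integral_sum) auto
  also have "\<dots> \<le> expectation (\<lambda>\<omega>. \<delta>)"
    using int sum_le[of n] by (intro integral_mono) auto
  finally have ES: "expectation (\<lambda>\<omega>. (S \<omega>)\<^sup>2) \<le> \<delta>" by (simp add: prob_space)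
  have Bm: "(\<lambda>\<omega>. B (p (Suc j)) \<omega> - B (p j) \<omega>) \<in> borel_measurable M" if "j < n" for j
    using that p0 by (intro borel_measurable_diff B_measurable) auto
  have [measurable]: "S \<in> borel_measurable M"
    unfolding S_def using measurable_F_M[OF c'm] Bm by (intro borel_measurable_sum borel_measurable_times) auto
  have [measurable]: "(\<lambda>\<omega>. \<Sum>j<n. q j \<omega>) \<in> borel_measurable M"
    using measurable_F_M[OF qm] by (intro borel_measurable_sum) blast
  have "prob {\<omega>\<in>space M. e < \<bar>\<Sum>j<n. c j \<omega> * (B (p (Suc j)) \<omega> - B (p j) \<omega>)\<bar>}
    \<le> prob ({\<omega>\<in>space M. \<delta> < (\<Sum>j<n. q j \<omega>)} \<union> {\<omega>\<in>space M. e\<^sup>2 \<le> (S \<omega>)\<^sup>2})"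
  proof (rule finite_measure_mono)
    show "{\<omega>\<in>space M. \<delta> < (\<Sum>j<n. q j \<omega>)} \<union> {\<omega>\<in>space M. e\<^sup>2 \<le> (S \<omega>)\<^sup>2} \<in> events"
      by measurable
    \<comment> \<open>If the total of \<open>q\<close> is at most \<open>\<delta>\<close>, so are
      its partial sums; then no coefficient is cut off and \<open>S\<close> is the original
      sum.\<close>
    have sub: "e\<^sup>2 \<le> (S \<omega>)\<^sup>2"
      if *: "(\<Sum>j<n. q j \<omega>) \<le> \<delta>" "e < \<bar>\<Sum>j<n. c j \<omega> * (B (p (Suc j)) \<omega> - B (p j) \<omega>)\<bar>" for \<omega>
    proof -
      have "c' j \<omega> = c j \<omega>" if j: "j < n" for j
      proof -
        have "(\<Sum>i\<le>j. q i \<omega>) \<le> (\<Sum>j<n. q j \<omega>)"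
          using q0 j by (intro sum_mono2) auto
        with * show ?thesis by (simp add: c'_def)
      qed
      then have "e < \<bar>S \<omega>\<bar>" using * by (simp add: S_def)
      then show ?thesis using e by (simp add: abs_le_square_iff[symmetric])
    qed
    show "{\<omega>\<in>space M. e < \<bar>\<Sum>j<n. c j \<omega> * (B (p (Suc j)) \<omega> - B (p j) \<omega>)\<bar>}
      \<subseteq> {\<omega>\<in>space M. \<delta> < (\<Sum>j<n. q j \<omega>)} \<union> {\<omega>\<in>space M. e\<^sup>2 \<le> (S \<omega>)\<^sup>2}"
    proof
      fix \<omega> assume "\<omega> \<in> {\<omega>\<in>space M. e < \<bar>\<Sum>j<n. c j \<omega> * (B (p (Suc j)) \<omega> - B (p j) \<omega>)\<bar>}"
      then show "\<omega> \<in> {\<omega>\<in>space M. \<delta> < (\<Sum>j<n. q j \<omega>)} \<union> {\<omega>\<in>space M. e\<^sup>2 \<le> (S \<omega>)\<^sup>2}"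
        using sub[of \<omega>] by (cases "\<delta> < (\<Sum>j<n. q j \<omega>)") simp_all
    qed
  qed
  also have "\<dots> \<le> prob {\<omega>\<in>space M. \<delta> < (\<Sum>j<n. q j \<omega>)} + prob {\<omega>\<in>space M. e\<^sup>2 \<le> (S \<omega>)\<^sup>2}"
    by (rule measure_Un_le) measurable
  also have "prob {\<omega>\<in>space M. e\<^sup>2 \<le> (S \<omega>)\<^sup>2} \<le> expectation (\<lambda>\<omega>. (S \<omega>)\<^sup>2) / e\<^sup>2"
    by (rule integral_Markov_inequality_measure[where A="{}"]) (use iso(1) e in auto)
  also have "\<dots> \<le> \<delta> / e\<^sup>2"
    using ES by (rule divide_right_mono) simp
  finally show ?thesis unfolding q_def by simp
qed

text \<open>
  The intervals may overlap, so that the difference of two simple integrals over unrelated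
  partitions is covered.
\<close>

lemma prob_interval_family_le:
  fixes \<xi> :: "'i \<Rightarrow> 'w \<Rightarrow> real" and \<alpha> \<beta> :: "'i \<Rightarrow> real"
  assumes fin: "finite A" and \<alpha>: "\<And>i. i \<in> A \<Longrightarrow> 0 \<le> \<alpha> i" "\<And>i. i \<in> A \<Longrightarrow> \<alpha> i \<le> \<beta> i"
    and \<xi>: "\<And>i. i \<in> A \<Longrightarrow> \<alpha> i < \<beta> i \<Longrightarrow> \<xi> i \<in> borel_measurable (F (\<alpha> i))"
    and e: "0 < e" and \<delta>: "0 < \<delta>"
  shows "prob {\<omega>\<in>space M. e < \<bar>\<Sum>i\<in>A. \<xi> i \<omega> * (B (\<beta> i) \<omega> - B (\<alpha> i) \<omega>)\<bar>}
    \<le> prob {\<omega>\<in>space M. ennreal \<delta> <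
        (\<integral>\<^sup>+ s. ennreal ((\<Sum>i\<in>A. \<xi> i \<omega> * indicator {\<alpha> i<..\<beta> i} s)\<^sup>2) \<partial>lborel)} + \<delta> / e\<^sup>2"
proof -
  \<comment> \<open>One partition refines all intervals at once; the added point 0 keeps it
    non-empty when \<open>A\<close> is empty.\<close>
  let ?P = "insert 0 (\<alpha> ` A \<union> \<beta> ` A)"
  have "finite ?P" "?P \<noteq> {}" using fin by auto
  then obtain p n where p: "\<And>j. j < n \<Longrightarrow> p j < p (Suc j)" and P: "?P = p ` {..n}"
    by (rule partition_of_finite_set) blast
  note less = partition_less_iff[of n p, OF p]
  note le = partition_le_iff[of n p, OF p]
  have P_ge: "0 \<le> x" if "x \<in> ?P" for x
    using that \<alpha> by (auto intro: order_trans)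
  then have p0: "0 \<le> p 0" unfolding P by blast
  obtain k where k: "\<And>i. i \<in> A \<Longrightarrow> k i \<le> n \<and> \<alpha> i = p (k i)"
  proof -
    have "\<forall>i\<in>A. \<exists>k. k \<le> n \<and> \<alpha> i = p k" using P by auto
    then show ?thesis using that by metis
  qed
  obtain l where l: "\<And>i. i \<in> A \<Longrightarrow> l i \<le> n \<and> \<beta> i = p (l i)"
  proof -
    have "\<forall>i\<in>A. \<exists>k. k \<le> n \<and> \<beta> i = p k" using P by auto
    then show ?thesis using that by metis
  qed
  have kl: "k i \<le> l i" if "i \<in> A" for i
    using k[OF that] l[OF that] \<alpha>(2)[OF that] le[of "k i" "l i"] by simp
  define h where "h = (\<lambda>s \<omega>. \<Sum>i\<in>A. \<xi> i \<omega> * indicator {\<alpha> i<..\<beta> i} s)"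
  \<comment> \<open>The integrand is constant on each half-open cell, so its value at the right end
    point represents the cell. Only those \<open>\<xi> i\<close> contribute whose interval starts no
    later than \<open>p j\<close>, hence adaptedness.\<close>
  define c where "c = (\<lambda>j \<omega>. h (p (Suc j)) \<omega>)"
  have cm: "c j \<in> borel_measurable (F (p j))" if j: "j < n" for j
    unfolding c_def h_def
  proof (rule borel_measurable_sum)
    fix i assume i: "i \<in> A"
    show "(\<lambda>\<omega>. \<xi> i \<omega> * indicator {\<alpha> i<..\<beta> i} (p (Suc j))) \<in> borel_measurable (F (p j))"
    proof (cases "p (Suc j) \<in> {\<alpha> i<..\<beta> i}")
      case True
      then have "\<alpha> i \<le> p j" "\<alpha> i < \<beta> i"
        using k[OF i] j less[of "k i" "Suc j"] le[of "k i" j] by auto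
      then have "\<xi> i \<in> borel_measurable (F (p j))"
        using \<xi>[OF i] by (blast intro: measurable_F_mono)
      then show ?thesis by measurable
    qed simp
  qed
  have sum_eq: "(\<Sum>i\<in>A. \<xi> i \<omega> * (B (\<beta> i) \<omega> - B (\<alpha> i) \<omega>)) = (\<Sum>j<n. c j \<omega> * (B (p (Suc j)) \<omega> - B (p j) \<omega>))" for \<omega>
  proof -
    have "(\<Sum>j<n. c j \<omega> * (B (p (Suc j)) \<omega> - B (p j) \<omega>)) =
        (\<Sum>i\<in>A. \<xi> i \<omega> * (\<Sum>j<n. indicator {p (k i)<..p (l i)} (p (Suc j)) * (B (p (Suc j)) \<omega> - B (p j) \<omega>)))"
      unfolding c_def h_def sum_distrib_right sum_distrib_left using k l
      by (subst sum.swap) (simp add: mult.assoc)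
    also have "\<dots> = (\<Sum>i\<in>A. \<xi> i \<omega> * (B (\<beta> i) \<omega> - B (\<alpha> i) \<omega>))"
    proof (intro sum.cong refl)
      fix i assume i: "i \<in> A"
      have "(\<Sum>j<n. indicator {p (k i)<..p (l i)} (p (Suc j)) * (B (p (Suc j)) \<omega> - B (p j) \<omega>)) =
          B (p (l i)) \<omega> - B (p (k i)) \<omega>"
        by (rule partition_telescope[of n p, OF p, where f="\<lambda>s. B s \<omega>"]) (use kl[OF i] l[OF i] in auto)
      then show "\<xi> i \<omega> * (\<Sum>j<n. indicator {p (k i)<..p (l i)} (p (Suc j)) * (B (p (Suc j)) \<omega> - B (p j) \<omega>)) =
          \<xi> i \<omega> * (B (\<beta> i) \<omega> - B (\<alpha> i) \<omega>)"
        using k[OF i] l[OF i] by simp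
    qed
    finally show ?thesis by simp
  qed
  \<comment> \<open>At each \<open>s\<close> at most one cell indicator is nonzero, so squaring the
    step function squares its coefficients.\<close>
  have h_eq: "(h s \<omega>)\<^sup>2 = (\<Sum>j<n. (c j \<omega>)\<^sup>2 * indicator {p j<..p (Suc j)} s)" for s \<omega>
  proof (cases "p 0 < s \<and> s \<le> p n")
    case True
    then obtain j where j: "j < n" "p j < s" "s \<le> p (Suc j)" by (metis partition_cell)
    then have "(\<Sum>i<n. (c i \<omega>)\<^sup>2 * indicator {p i<..p (Suc i)} s) = (c j \<omega>)\<^sup>2"
      by (intro partition_indicator_sum p) auto
    also have "c j \<omega> = h s \<omega>"
      unfolding c_def h_def
    proof (intro sum.cong refl arg_cong2[where f="(*)"])
      fix i assume i: "i \<in> A"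
      have "p (k i) < p (Suc j) \<longleftrightarrow> p (k i) < s"
        using j k[OF i] less[of "k i" "Suc j"] le[of "k i" j] by auto
      moreover have "p (Suc j) \<le> p (l i) \<longleftrightarrow> s \<le> p (l i)"
        using j l[OF i] less[of j "l i"] le[of "Suc j" "l i"] by auto
      ultimately show "indicator {\<alpha> i<..\<beta> i} (p (Suc j)) = (indicator {\<alpha> i<..\<beta> i} s :: real)"
        using k[OF i] l[OF i] by (simp add: indicator_def)
    qed
    finally show ?thesis by simp
  next
    case False
    have "indicator {\<alpha> i<..\<beta> i} s = (0::real)" if "i \<in> A" for i
      using k[OF that] l[OF that] False le[of 0 "k i"] le[of "l i" n] by (auto simp: indicator_def)
    moreover have "indicator {p j<..p (Suc j)} s = (0::real)" if "j < n" for j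
      using False le[of 0 j] le[of "Suc j" n] that by (auto simp: indicator_def)
    ultimately show ?thesis by (simp add: h_def)
  qed
  have int_eq: "(\<integral>\<^sup>+ s. ennreal ((h s \<omega>)\<^sup>2) \<partial>lborel) = ennreal (\<Sum>j<n. (c j \<omega>)\<^sup>2 * (p (Suc j) - p j))" for \<omega>
  proof -
    have "(\<integral>\<^sup>+ s. ennreal ((h s \<omega>)\<^sup>2) \<partial>lborel) =
      (\<integral>\<^sup>+ s. (\<Sum>j<n. ennreal ((c j \<omega>)\<^sup>2) * indicator {p j<..p (Suc j)} s) \<partial>lborel)"
      unfolding h_eq
    proof (intro nn_integral_cong)
      fix s
      show "ennreal (\<Sum>j<n. (c j \<omega>)\<^sup>2 * indicator {p j<..p (Suc j)} s) =
          (\<Sum>j<n. ennreal ((c j \<omega>)\<^sup>2) * indicator {p j<..p (Suc j)} s)"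
        by (subst sum_ennreal[symmetric]) (auto split: split_indicator intro!: sum.cong)
    qed
    also have "\<dots> = (\<Sum>j<n. ennreal ((c j \<omega>)\<^sup>2) * ennreal (p (Suc j) - p j))"
      using p by (subst nn_integral_sum) (auto simp: nn_integral_cmult less_imp_le)
    also have "\<dots> = ennreal (\<Sum>j<n. (c j \<omega>)\<^sup>2 * (p (Suc j) - p j))"
      using p by (subst sum_ennreal[symmetric]) (auto simp: ennreal_mult'' less_imp_le)
    finally show ?thesis .
  qed
  have set_eq: "{\<omega>\<in>space M. ennreal \<delta> < (\<integral>\<^sup>+ s. ennreal ((h s \<omega>)\<^sup>2) \<partial>lborel)}
     = {\<omega>\<in>space M. \<delta> < (\<Sum>j<n. (c j \<omega>)\<^sup>2 * (p (Suc j) - p j))}"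
    unfolding int_eq using \<delta> by (auto simp: ennreal_less_iff)
  have "prob {\<omega>\<in>space M. e < \<bar>\<Sum>j<n. c j \<omega> * (B (p (Suc j)) \<omega> - B (p j) \<omega>)\<bar>}
    \<le> prob {\<omega>\<in>space M. \<delta> < (\<Sum>j<n. (c j \<omega>)\<^sup>2 * (p (Suc j) - p j))} + \<delta> / e\<^sup>2"
    by (rule prob_sum_increments_le) (use p0 p cm e \<delta> in auto)
  then show ?thesis
    unfolding sum_eq set_eq[symmetric] unfolding h_def .
qed

end

section \<open>Convergence in probability\<close>

text \<open>Since \<open>measure\<close> is 0 on non-measurable sets, this has its intended meaning
  only for measurable \<open>X n\<close> and \<open>Y\<close>; hence the measurability premises of
  most rules below.\<close>

definition tendsto_prob :: "'a measure \<Rightarrow> (nat \<Rightarrow> 'a \<Rightarrow> real) \<Rightarrow> ('a \<Rightarrow> real) \<Rightarrow> bool" where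
  "tendsto_prob M X Y \<longleftrightarrow> (\<forall>e>0. (\<lambda>n. measure M {\<omega>\<in>space M. e < \<bar>X n \<omega> - Y \<omega>\<bar>}) \<longlonglongrightarrow> 0)"

context prob_space
begin

lemma tendsto_prob_less_ennreal:
  fixes f :: "nat \<Rightarrow> 'a \<Rightarrow> ennreal"
  assumes [measurable]: "\<And>n. f n \<in> borel_measurable M"
    and lim: "AE \<omega> in M. (\<lambda>n. f n \<omega>) \<longlonglongrightarrow> 0" and e: "0 < e"
  shows "(\<lambda>n. prob {\<omega>\<in>space M. e < f n \<omega>}) \<longlonglongrightarrow> 0"
proof -
  have "(\<lambda>n. expectation (indicator {\<omega>\<in>space M. e < f n \<omega>})) \<longlonglongrightarrow> expectation (\<lambda>\<omega>. 0::real)"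
  proof (rule integral_dominated_convergence[where w="\<lambda>_. 1"])
    show "AE \<omega> in M. (\<lambda>n. indicator {\<omega>\<in>space M. e < f n \<omega>} \<omega>) \<longlonglongrightarrow> (0::real)"
      using lim
    proof eventually_elim
      case (elim \<omega>)
      from order_tendstoD(2)[OF this e]
      have "\<forall>\<^sub>F n in sequentially. indicator {\<omega>\<in>space M. e < f n \<omega>} \<omega> = (0::real)"
        by eventually_elim (auto simp: indicator_def)
      then show ?case by (rule tendsto_eventually)
    qed
  qed (auto intro!: AE_I2)
  then show ?thesis by simp
qed

lemma tendsto_prob_AE:
  assumes [measurable]: "\<And>n. X n \<in> borel_measurable M" "Y \<in> borel_measurable M"
    and lim: "AE \<omega> in M. (\<lambda>n. X n \<omega>) \<longlonglongrightarrow> Y \<omega>"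
  shows "tendsto_prob M X Y"
  unfolding tendsto_prob_def
proof (intro allI impI)
  fix e :: real assume e: "0 < e"
  have "(\<lambda>n. prob {\<omega>\<in>space M. ennreal e < ennreal \<bar>X n \<omega> - Y \<omega>\<bar>}) \<longlonglongrightarrow> 0"
  proof (rule tendsto_prob_less_ennreal)
    show "AE \<omega> in M. (\<lambda>n. ennreal \<bar>X n \<omega> - Y \<omega>\<bar>) \<longlonglongrightarrow> 0"
      using lim
    proof eventually_elim
      case (elim \<omega>)
      then have "(\<lambda>n. \<bar>X n \<omega> - Y \<omega>\<bar>) \<longlonglongrightarrow> 0"
        by (simp add: tendsto_rabs_zero_iff LIM_zero_iff)
      from tendsto_ennrealI[OF this] show ?case by simp
    qed
  qed (use e in auto)
  then show "(\<lambda>n. prob {\<omega>\<in>space M. e < \<bar>X n \<omega> - Y \<omega>\<bar>}) \<longlonglongrightarrow> 0"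
    using e by (simp add: ennreal_less_iff)
qed

lemma tendsto_prob_add:
  assumes [measurable]: "\<And>n. X n \<in> borel_measurable M" "Y \<in> borel_measurable M"
    "\<And>n. X' n \<in> borel_measurable M" "Y' \<in> borel_measurable M"
    and lim: "tendsto_prob M X Y" "tendsto_prob M X' Y'"
  shows "tendsto_prob M (\<lambda>n \<omega>. X n \<omega> + X' n \<omega>) (\<lambda>\<omega>. Y \<omega> + Y' \<omega>)"
  unfolding tendsto_prob_def
proof (intro allI impI)
  fix e :: real assume e: "0 < e"
  let ?S = "\<lambda>n. {\<omega>\<in>space M. e / 2 < \<bar>X n \<omega> - Y \<omega>\<bar>}"
  let ?S' = "\<lambda>n. {\<omega>\<in>space M. e / 2 < \<bar>X' n \<omega> - Y' \<omega>\<bar>}"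
  have null: "(\<lambda>n. prob (?S n) + prob (?S' n)) \<longlonglongrightarrow> 0"
    using lim[unfolded tendsto_prob_def, rule_format, of "e / 2"] e by (intro tendsto_add_zero) simp_all
  have le: "prob {\<omega>\<in>space M. e < \<bar>X n \<omega> + X' n \<omega> - (Y \<omega> + Y' \<omega>)\<bar>} \<le> prob (?S n) + prob (?S' n)" for n
  proof -
    have "prob {\<omega>\<in>space M. e < \<bar>X n \<omega> + X' n \<omega> - (Y \<omega> + Y' \<omega>)\<bar>} \<le> prob (?S n \<union> ?S' n)"
    proof (rule finite_measure_mono)
      have "e / 2 < \<bar>x - y\<bar> \<or> e / 2 < \<bar>x' - y'\<bar>" if "e < \<bar>x + x' - (y + y')\<bar>" for x x' y y' :: real
        using that by arith
      then show "{\<omega>\<in>space M. e < \<bar>X n \<omega> + X' n \<omega> - (Y \<omega> + Y' \<omega>)\<bar>} \<subseteq> ?S n \<union> ?S' n"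
        by blast
    qed measurable
    also have "\<dots> \<le> prob (?S n) + prob (?S' n)"
      by (rule measure_Un_le) measurable
    finally show ?thesis .
  qed
  show "(\<lambda>n. prob {\<omega>\<in>space M. e < \<bar>X n \<omega> + X' n \<omega> - (Y \<omega> + Y' \<omega>)\<bar>}) \<longlonglongrightarrow> 0"
    by (rule Lim_null_comparison[OF _ null]) (use le in simp)
qed

lemma tendsto_prob_cmult:
  assumes "tendsto_prob M X Y"
  shows "tendsto_prob M (\<lambda>n \<omega>. c * X n \<omega>) (\<lambda>\<omega>. c * Y \<omega>)"
  unfolding tendsto_prob_def
proof (intro allI impI)
  fix e :: real assume e: "0 < e"
  show "(\<lambda>n. prob {\<omega>\<in>space M. e < \<bar>c * X n \<omega> - c * Y \<omega>\<bar>}) \<longlonglongrightarrow> 0"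
  proof (cases "c = 0")
    case False
    have "e < \<bar>c * x - c * y\<bar> \<longleftrightarrow> e / \<bar>c\<bar> < \<bar>x - y\<bar>" for x y
    proof -
      have "\<bar>c * x - c * y\<bar> = \<bar>x - y\<bar> * \<bar>c\<bar>"
        by (simp only: right_diff_distrib[symmetric] abs_mult mult.commute)
      then show ?thesis using False by (simp add: pos_divide_less_eq)
    qed
    then show ?thesis
      using assms e False by (simp add: tendsto_prob_def)
  qed (use e in simp)
qed

lemma tendsto_prob_diff:
  assumes "\<And>n. X n \<in> borel_measurable M" "Y \<in> borel_measurable M"
    "\<And>n. X' n \<in> borel_measurable M" "Y' \<in> borel_measurable M"
    and "tendsto_prob M X Y" "tendsto_prob M X' Y'"
  shows "tendsto_prob M (\<lambda>n \<omega>. X n \<omega> - X' n \<omega>) (\<lambda>\<omega>. Y \<omega> - Y' \<omega>)"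
  using tendsto_prob_add[of X Y "\<lambda>n \<omega>. - 1 * X' n \<omega>" "\<lambda>\<omega>. - 1 * Y' \<omega>"] tendsto_prob_cmult[of X' Y' "- 1"] assms
  by simp

lemma tendsto_prob_mono_AE:
  assumes [measurable]: "\<And>n. X n \<in> borel_measurable M" "Y \<in> borel_measurable M"
    "\<And>n. X' n \<in> borel_measurable M" "Y' \<in> borel_measurable M"
    and le: "AE \<omega> in M. \<forall>n. \<bar>X' n \<omega> - Y' \<omega>\<bar> \<le> \<bar>X n \<omega> - Y \<omega>\<bar>"
    and lim: "tendsto_prob M X Y"
  shows "tendsto_prob M X' Y'"
  unfolding tendsto_prob_def
proof (intro allI impI)
  fix e :: real assume e: "0 < e"
  have null: "(\<lambda>n. prob {\<omega>\<in>space M. e < \<bar>X n \<omega> - Y \<omega>\<bar>}) \<longlonglongrightarrow> 0"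
    using lim e by (simp add: tendsto_prob_def)
  have "prob {\<omega>\<in>space M. e < \<bar>X' n \<omega> - Y' \<omega>\<bar>} \<le> prob {\<omega>\<in>space M. e < \<bar>X n \<omega> - Y \<omega>\<bar>}" for n
  proof (rule finite_measure_mono_AE)
    show "AE \<omega> in M. \<omega> \<in> {\<omega>\<in>space M. e < \<bar>X' n \<omega> - Y' \<omega>\<bar>} \<longrightarrow> \<omega> \<in> {\<omega>\<in>space M. e < \<bar>X n \<omega> - Y \<omega>\<bar>}"
      using le by eventually_elim (auto intro: less_le_trans)
  qed measurable
  then show "(\<lambda>n. prob {\<omega>\<in>space M. e < \<bar>X' n \<omega> - Y' \<omega>\<bar>}) \<longlonglongrightarrow> 0"
    by (intro Lim_null_comparison[OF _ null] always_eventually) simp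
qed

lemma tendsto_prob_power2:
  assumes [measurable]: "\<And>n. X n \<in> borel_measurable M"
    and int: "\<And>n. integrable M (\<lambda>\<omega>. (X n \<omega>)\<^sup>2)"
    and lim: "(\<lambda>n. expectation (\<lambda>\<omega>. (X n \<omega>)\<^sup>2)) \<longlonglongrightarrow> 0"
  shows "tendsto_prob M X (\<lambda>_. 0)"
  unfolding tendsto_prob_def
proof (intro allI impI)
  fix e :: real assume e: "0 < e"
  have le: "prob {\<omega>\<in>space M. e < \<bar>X n \<omega> - 0\<bar>} \<le> expectation (\<lambda>\<omega>. (X n \<omega>)\<^sup>2) / e\<^sup>2" for n
  proof -
    have "prob {\<omega>\<in>space M. e < \<bar>X n \<omega> - 0\<bar>} \<le> prob {\<omega>\<in>space M. e\<^sup>2 \<le> (X n \<omega>)\<^sup>2}"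
      using e by (intro finite_measure_mono) (auto simp: abs_le_square_iff[symmetric])
    also have "\<dots> \<le> expectation (\<lambda>\<omega>. (X n \<omega>)\<^sup>2) / e\<^sup>2"
      by (rule integral_Markov_inequality_measure[where A="{}"]) (use int e in auto)
    finally show ?thesis .
  qed
  have null: "(\<lambda>n. expectation (\<lambda>\<omega>. (X n \<omega>)\<^sup>2) / e\<^sup>2) \<longlonglongrightarrow> 0"
    using lim by (rule tendsto_divide_zero)
  show "(\<lambda>n. prob {\<omega>\<in>space M. e < \<bar>X n \<omega> - 0\<bar>}) \<longlonglongrightarrow> 0"
    by (rule Lim_null_comparison[OF _ null]) (use le in simp)
qed

text \<open>Since \<open>Y\<close> is bounded by \<open>K\<close>, the event of a deviation above
  \<open>e\<close> costs at most \<open>K\<^sup>2\<close> times its probability, which tends to 0.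
  Elsewhere \<open>Y^2 \<le> 2 X^2 + 2 (Y - X)^2\<close> is used, the origin of the factor 2; the
  Gronwall argument tolerates it.\<close>

lemma expectation_power2_le_of_tendsto_prob:
  assumes [measurable]: "\<And>n. X n \<in> borel_measurable M" "Y \<in> borel_measurable M"
    and lim: "tendsto_prob M X Y"
    and K: "\<And>\<omega>. \<omega> \<in> space M \<Longrightarrow> \<bar>Y \<omega>\<bar> \<le> K"
    and int: "\<And>n. integrable M (\<lambda>\<omega>. (X n \<omega>)\<^sup>2)"
    and b: "\<And>n. expectation (\<lambda>\<omega>. (X n \<omega>)\<^sup>2) \<le> b"
  shows "expectation (\<lambda>\<omega>. (Y \<omega>)\<^sup>2) \<le> 2 * b"
proof (rule field_le_epsilon)
  fix d :: real assume d: "0 < d"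
  define e where "e = sqrt (d / 2)"
  have e: "0 < e" "2 * e\<^sup>2 = d" using d by (simp_all add: e_def)
  let ?S = "\<lambda>n. {\<omega>\<in>space M. e < \<bar>X n \<omega> - Y \<omega>\<bar>}"
  have le: "expectation (\<lambda>\<omega>. (Y \<omega>)\<^sup>2) \<le> 2 * b + d + K\<^sup>2 * prob (?S n)" for n
  proof -
    have "expectation (\<lambda>\<omega>. (Y \<omega>)\<^sup>2) \<le> expectation (\<lambda>\<omega>. 2 * (X n \<omega>)\<^sup>2 + d + K\<^sup>2 * indicator (?S n) \<omega>)"
    proof (rule integral_mono)
      have Y2: "(Y \<omega>)\<^sup>2 \<le> K\<^sup>2" if "\<omega> \<in> space M" for \<omega>
        using K[OF that] by (metis abs_ge_zero power2_abs power_mono)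
      show "integrable M (\<lambda>\<omega>. (Y \<omega>)\<^sup>2)"
        by (rule integrable_const_bound[where B="K\<^sup>2"]) (use Y2 in auto)
      show "integrable M (\<lambda>\<omega>. 2 * (X n \<omega>)\<^sup>2 + d + K\<^sup>2 * indicator (?S n) \<omega>)"
        using int[of n] by (intro Bochner_Integration.integrable_add integrable_mult_right integrable_real_indicator) (auto simp: emeasure_eq_measure)
      show "(Y \<omega>)\<^sup>2 \<le> 2 * (X n \<omega>)\<^sup>2 + d + K\<^sup>2 * indicator (?S n) \<omega>" if \<omega>: "\<omega> \<in> space M" for \<omega>
      proof (cases "\<omega> \<in> ?S n")
        case True
        then show ?thesis using Y2[OF \<omega>] d by (simp add: add_increasing)
      next
        case False
        then have "\<bar>Y \<omega> - X n \<omega>\<bar> \<le> \<bar>e\<bar>" using \<omega> by (simp add: not_less abs_minus_commute)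
        then have "(Y \<omega> - X n \<omega>)\<^sup>2 \<le> e\<^sup>2" by (simp only: abs_le_square_iff)
        moreover have "(Y \<omega>)\<^sup>2 \<le> 2 * (X n \<omega>)\<^sup>2 + 2 * (Y \<omega> - X n \<omega>)\<^sup>2"
          using zero_le_power2[of "Y \<omega> - 2 * X n \<omega>"] by (simp add: power2_eq_square algebra_simps)
        ultimately show ?thesis using False e by simp
      qed
    qed
    also have "\<dots> = 2 * expectation (\<lambda>\<omega>. (X n \<omega>)\<^sup>2) + d + K\<^sup>2 * prob (?S n)"
      using int[of n] by (simp add: prob_space emeasure_eq_measure)
    finally show ?thesis using b[of n] by linarith
  qed
  have "(\<lambda>n. 2 * b + d + K\<^sup>2 * prob (?S n)) \<longlonglongrightarrow> 2 * b + d + K\<^sup>2 * 0"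
    using lim e(1) by (intro tendsto_intros) (auto simp: tendsto_prob_def)
  from tendsto_lowerbound[OF this] le show "expectation (\<lambda>\<omega>. (Y \<omega>)\<^sup>2) \<le> 2 * b + d" by simp
qed

end

section \<open>Uniform partitions\<close>

text \<open>With \<open>Suc n\<close> cells, \<open>n = 0\<close> is a genuine partition and no
  division by zero occurs.\<close>

definition grid :: "real \<Rightarrow> nat \<Rightarrow> nat \<Rightarrow> real" where
  "grid t n i = t * real i / real (Suc n)"

lemma grid_0 [simp]: "grid t n 0 = 0"
  by (simp add: grid_def)

lemma grid_last [simp]: "grid t n (Suc n) = t"
  by (simp add: grid_def)

lemma grid_less: "0 < t \<Longrightarrow> grid t n i < grid t n (Suc i)"
  unfolding grid_def by (intro divide_strict_right_mono mult_strict_left_mono) auto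

lemma grid_diff: "grid t n (Suc i) - grid t n i = t / real (Suc n)"
  unfolding grid_def diff_divide_distrib[symmetric] by (simp add: algebra_simps)

lemma grid_nonneg: "0 \<le> t \<Longrightarrow> 0 \<le> grid t n i"
  by (simp add: grid_def)

lemma grid_le: "0 \<le> t \<Longrightarrow> i \<le> Suc n \<Longrightarrow> grid t n i \<le> t"
  unfolding grid_def by (simp add: divide_le_eq mult_left_mono)

text \<open>Uniform continuity on a compact interval. Sampling at the left end point keeps the step
  process adapted; the cells are open on the left, so \<open>s = 0\<close> belongs to none of
  them.\<close>

lemma grid_approx:
  fixes f :: "real \<Rightarrow> real"
  assumes t: "0 < t" and f: "continuous_on {0..t} f" and e: "0 < e"
  shows "\<forall>\<^sub>F n in sequentially. \<forall>s\<in>{0<..t}.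
    \<bar>(\<Sum>i<Suc n. f (grid t n i) * indicator {grid t n i<..grid t n (Suc i)} s) - f s\<bar> < e"
proof -
  have "uniformly_continuous_on {0..t} f"
    using f by (intro compact_uniformly_continuous) auto
  then obtain d where d: "0 < d" "\<And>s s'. s \<in> {0..t} \<Longrightarrow> s' \<in> {0..t} \<Longrightarrow> dist s' s < d \<Longrightarrow> dist (f s') (f s) < e"
    using e unfolding uniformly_continuous_on_def by metis
  have "(\<lambda>n. t / real (Suc n)) \<longlonglongrightarrow> 0"
    using LIMSEQ_Suc[OF lim_const_over_n[of t]] .
  from order_tendstoD(2)[OF this d(1)] show ?thesis
  proof eventually_elim
    case (elim n)
    show ?case
    proof
      fix s assume s: "s \<in> {0<..t}"
      then obtain j where j: "j < Suc n" "grid t n j < s" "s \<le> grid t n (Suc j)"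
        using partition_cell[of "grid t n" s "Suc n"] by auto
      have "(\<Sum>i<Suc n. f (grid t n i) * indicator {grid t n i<..grid t n (Suc i)} s) = f (grid t n j)"
        using partition_indicator_sum[of "Suc n" "grid t n" j s "\<lambda>i. f (grid t n i)"] j grid_less[OF t] by simp
      moreover have "dist (f (grid t n j)) (f s) < e"
      proof (rule d)
        show "s \<in> {0..t}" "grid t n j \<in> {0..t}"
          using s j t by (auto simp: grid_nonneg grid_le)
        show "dist (grid t n j) s < d"
          using j grid_diff[of t n j] elim by (simp add: dist_real_def)
      qed
      ultimately show "\<bar>(\<Sum>i<Suc n. f (grid t n i) * indicator {grid t n i<..grid t n (Suc i)} s) - f s\<bar> < e"
        by (simp add: dist_real_def)
    qed
  qed
qed

text \<open>The Riemann sum is the Lebesgue integral of the step function \<open>h n\<close>, which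
  approaches the integrand uniformly off the null set \<open>{0}\<close>.\<close>

lemma riemann_sum_tendsto:
  fixes f :: "real \<Rightarrow> real"
  assumes t: "0 < t" and f: "continuous_on {0..t} f"
  shows "(\<lambda>n. \<Sum>i<Suc n. f (grid t n i) * (t / real (Suc n))) \<longlonglongrightarrow> (LBINT s:{0..t}. f s)"
proof (rule metric_LIMSEQ_I)
  fix e :: real assume e: "0 < e"
  define h where "h = (\<lambda>n s. \<Sum>i<Suc n. f (grid t n i) * indicator {grid t n i<..grid t n (Suc i)} s)"
  have int: "set_integrable lborel {0..t} f"
    using f by (rule borel_integrable_atLeastAtMost')
  have ih: "integrable lborel (h n)" for n
    unfolding h_def by (intro Bochner_Integration.integrable_sum integrable_mult_right integrable_real_indicator)
      (auto simp: less_imp_le[OF grid_less[OF t]])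
  have ih_eq: "integral\<^sup>L lborel (h n) = (\<Sum>i<Suc n. f (grid t n i) * (t / real (Suc n)))" for n
  proof -
    have "integral\<^sup>L lborel (h n) = (\<Sum>i<Suc n. f (grid t n i) * measure lborel {grid t n i<..grid t n (Suc i)})"
      unfolding h_def by (subst Bochner_Integration.integral_sum)
        (auto intro!: integrable_mult_right integrable_real_indicator simp: less_imp_le[OF grid_less[OF t]] simp del: sum.lessThan_Suc)
    also have "\<dots> = (\<Sum>i<Suc n. f (grid t n i) * (t / real (Suc n)))"
      using grid_less[OF t] by (intro sum.cong refl) (simp add: less_imp_le grid_diff del: of_nat_Suc)
    finally show ?thesis .
  qed
  have "0 < e / (2 * t)" using e t by simp
  from grid_approx[OF t f this]
  have "\<forall>\<^sub>F n in sequentially. dist (\<Sum>i<Suc n. f (grid t n i) * (t / real (Suc n))) (LBINT s:{0..t}. f s) < e"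
  proof eventually_elim
    case (elim n)
    have h0: "h n s = 0" if "s \<notin> {0<..t}" for s
    proof -
      have "s \<notin> {grid t n i<..grid t n (Suc i)}" if "i < Suc n" for i
        using \<open>s \<notin> {0<..t}\<close> grid_nonneg[of t n i] grid_le[of t "Suc i" n] t that by auto
      then show ?thesis unfolding h_def by (intro sum.neutral) auto
    qed
    have "dist (integral\<^sup>L lborel (h n)) (LBINT s:{0..t}. f s) = \<bar>LBINT s. h n s - indicator {0..t} s *\<^sub>R f s\<bar>"
      using int ih unfolding set_lebesgue_integral_def set_integrable_def dist_real_def
      by (subst Bochner_Integration.integral_diff) auto
    also have "\<dots> \<le> (LBINT s. \<bar>h n s - indicator {0..t} s *\<^sub>R f s\<bar>)"
      by (rule integral_abs_bound)
    also have "\<dots> \<le> (LBINT s. e / (2 * t) * indicator {0..t} s)"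
    proof (rule integral_mono_AE)
      show "integrable lborel (\<lambda>s. \<bar>h n s - indicator {0..t} s *\<^sub>R f s\<bar>)"
        using int ih unfolding set_integrable_def by auto
      show "integrable lborel (\<lambda>s. e / (2 * t) * indicator {0..t} s)"
        by (intro integrable_mult_right integrable_real_indicator) (auto simp: emeasure_lborel_Icc_eq)
      have "AE s in lborel. s \<noteq> (0::real)" by (rule AE_lborel_singleton)
      then show "AE s in lborel. \<bar>h n s - indicator {0..t} s *\<^sub>R f s\<bar> \<le> e / (2 * t) * indicator {0..t} s"
      proof eventually_elim
        case (elim s)
        show ?case
        proof (cases "s \<in> {0<..t}")
          case True
          then show ?thesis
            using \<open>\<forall>s\<in>{0<..t}. _ s\<close> unfolding h_def by (auto simp: less_imp_le)
        next
          case False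
          then show ?thesis using elim h0[OF False] by (auto simp: indicator_def)
        qed
      qed
    qed
    also have "\<dots> = e / 2" using t by simp
    also have "\<dots> < e" using e by simp
    finally show ?case unfolding ih_eq .
  qed
  then show "\<exists>no. \<forall>n\<ge>no. dist (\<Sum>i<Suc n. f (grid t n i) * (t / real (Suc n))) (LBINT s:{0..t}. f s) < e"
    by (simp add: eventually_sequentially)
qed

section \<open>The Ito integral as a limit of grid sums\<close>

context brownian
begin

lemma sets_F_subset: "sets (F t) \<subseteq> sets M"
  using bm by (auto simp: brownian_motion_def filtration_on_def subalgebra_def)

text \<open>
  Without this, the events in \<open>has_ito_integral\<close> might be non-measurable, and \<open>measure\<close> would be
  the junk value 0 on them.
\<close>

lemma measurable_nn_integral_diff_progressive:
  fixes \<xi> :: "'i \<Rightarrow> 'w \<Rightarrow> real"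
  assumes H: "progressive F H" and t: "0 \<le> t" and \<xi>: "\<And>i. i \<in> A \<Longrightarrow> \<xi> i \<in> borel_measurable M"
  shows "(\<lambda>\<omega>. \<integral>\<^sup>+ s\<in>{0..t}. ennreal (((\<Sum>i\<in>A. \<xi> i \<omega> * indicator {\<alpha> i<..\<beta> i} s) - H s \<omega>)\<^sup>2) \<partial>lborel)
    \<in> borel_measurable M"
proof -
  let ?L = "restrict_space lborel {0..t}"
  \<comment> \<open>Measurability of the integral in \<open>\<omega>\<close> is a Fubini argument
    and needs a sigma-finite measure on \<open>{0..t}\<close>.\<close>
  interpret L: finite_measure ?L
    by (rule finite_measureI) (simp add: emeasure_restrict_space space_restrict_space emeasure_lborel_Icc_eq)
  have Hm: "(\<lambda>(s, \<omega>). H s \<omega>) \<in> borel_measurable (restrict_space borel {0..t} \<Otimes>\<^sub>M F t)"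
    using H t by (simp add: progressive_def)
  have "(\<lambda>\<omega>. \<omega>) \<in> measurable M (F t)"
    by (intro measurableI) (auto intro!: sets.Int dest: subsetD[OF sets_F_subset])
  moreover have "(\<lambda>s. s) \<in> measurable ?L (restrict_space borel {0..t})"
    by (rule measurable_ident_sets) (simp add: sets_restrict_space)
  \<comment> \<open>Progressive measurability puts time first, the parametrised integral puts
    \<open>\<omega>\<close> first; hence the swap.\<close>
  ultimately have "(\<lambda>x. (snd x, fst x)) \<in> measurable (M \<Otimes>\<^sub>M ?L) (restrict_space borel {0..t} \<Otimes>\<^sub>M F t)"
    using measurable_compose[OF measurable_snd] measurable_compose[OF measurable_fst]
    by (intro measurable_Pair) blast+
  from measurable_compose[OF this Hm]
  have [measurable]: "(\<lambda>x. H (snd x) (fst x)) \<in> borel_measurable (M \<Otimes>\<^sub>M ?L)"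
    by (simp add: case_prod_beta)
  have [measurable]: "(\<lambda>x. \<Sum>i\<in>A. \<xi> i (fst x) * indicator {\<alpha> i<..\<beta> i} (snd x)) \<in> borel_measurable (M \<Otimes>\<^sub>M ?L)"
  proof (intro borel_measurable_sum borel_measurable_times)
    fix i assume "i \<in> A"
    then show "(\<lambda>x. \<xi> i (fst x)) \<in> borel_measurable (M \<Otimes>\<^sub>M ?L)"
      using measurable_compose[OF measurable_fst \<xi>] by blast
    have "(\<lambda>s. s) \<in> borel_measurable ?L" by (intro measurable_restrict_space1) simp
    then have "snd \<in> measurable (M \<Otimes>\<^sub>M ?L) borel" using measurable_compose[OF measurable_snd] by blast
    then show "(\<lambda>x. indicator {\<alpha> i<..\<beta> i} (snd x)) \<in> borel_measurable (M \<Otimes>\<^sub>M ?L)"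
      by measurable
  qed
  have "(\<lambda>\<omega>. \<integral>\<^sup>+ s. ennreal (((\<Sum>i\<in>A. \<xi> i \<omega> * indicator {\<alpha> i<..\<beta> i} s) - H s \<omega>)\<^sup>2) \<partial>?L) \<in> borel_measurable M"
    by (rule L.borel_measurable_nn_integral) (simp add: case_prod_beta, measurable)
  then show ?thesis
    by (simp add: nn_integral_restrict_space)
qed

lemma simple_integrand_nonneg:
  "simple_integrand F n \<tau> \<xi> \<Longrightarrow> i \<le> n \<Longrightarrow> 0 \<le> \<tau> i"
proof (induction i)
  case (Suc i)
  then have "0 \<le> \<tau> i" "\<tau> i \<le> \<tau> (Suc i)" by (auto simp: simple_integrand_def)
  then show ?case by linarith
qed (simp add: simple_integrand_def)

text \<open>Continuity of \<open>H\<close> makes its grid samples close to \<open>H\<close> in the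
  pathwise square norm (\<open>R\<close>); the definition of the integral gives the same for the
  supplied simple integrands (\<open>Q\<close>). The two step processes are therefore close to each
  other, and the tail estimate carries this over to their integrals. The samples may be unbounded,
  which is why that estimate is stated for merely measurable coefficients.\<close>

lemma ito_integral_grid:
  assumes t: "0 < t" and H: "has_ito_integral M F B H t I"
    and ad: "adapted F H" and cont: "continuous_paths M H"
  shows "tendsto_prob M (\<lambda>n \<omega>. \<Sum>i<Suc n. H (grid t n i) \<omega> * (B (grid t n (Suc i)) \<omega> - B (grid t n i) \<omega>)) I"
proof -
  from H obtain n \<tau> \<xi> where prog: "progressive F H" and I[measurable]: "I \<in> borel_measurable M"
    and si: "\<And>k. simple_integrand F (n k) (\<tau> k) (\<xi> k)"
    and L2: "\<And>e. e > 0 \<Longrightarrow> (\<lambda>k. prob {\<omega>\<in>space M.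
             (\<integral>\<^sup>+ s\<in>{0..t}. ennreal ((simple_process (n k) (\<tau> k) (\<xi> k) s \<omega> - H s \<omega>)\<^sup>2) \<partial>lborel)
               > ennreal e}) \<longlonglongrightarrow> 0"
    and lim: "tendsto_prob M (\<lambda>k. simple_ito_integral B (n k) (\<tau> k) (\<xi> k) t) I"
    unfolding has_ito_integral_def tendsto_prob_def by blast
  define J where "J = (\<lambda>k \<omega>. \<Sum>i<Suc k. H (grid t k i) \<omega> * (B (grid t k (Suc i)) \<omega> - B (grid t k i) \<omega>))"
  define S where "S = (\<lambda>k. simple_ito_integral B (n k) (\<tau> k) (\<xi> k) t)"
  define Q where "Q = (\<lambda>k \<omega>. \<integral>\<^sup>+ s\<in>{0..t}. ennreal ((simple_process (n k) (\<tau> k) (\<xi> k) s \<omega> - H s \<omega>)\<^sup>2) \<partial>lborel)"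
  define R where "R = (\<lambda>k \<omega>. \<integral>\<^sup>+ s\<in>{0..t}. ennreal (((\<Sum>i<Suc k. H (grid t k i) \<omega> * indicator {grid t k i<..grid t k (Suc i)} s) - H s \<omega>)\<^sup>2) \<partial>lborel)"
  have t0: "0 \<le> t" using t by simp
  have Hm: "H (grid t k i) \<in> borel_measurable (F (grid t k i))" for k i
    using ad grid_nonneg[OF t0] by (simp add: adapted_def)
  have \<xi>F: "\<xi> k i \<in> borel_measurable (F (\<tau> k i))" if "i < n k" for k i
    using si[of k] that by (simp add: simple_integrand_def)
  have [measurable]: "Q k \<in> borel_measurable M" for k
    unfolding Q_def simple_process_def
    by (rule measurable_nn_integral_diff_progressive[OF prog t0]) (use measurable_F_M[OF \<xi>F] in auto)
  have [measurable]: "R k \<in> borel_measurable M" for k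
    unfolding R_def
    by (rule measurable_nn_integral_diff_progressive[OF prog t0]) (use measurable_F_M[OF Hm] in auto)
  have [measurable]: "J k \<in> borel_measurable M" for k
    unfolding J_def using grid_nonneg[OF t0] measurable_F_M[OF Hm]
    by (intro borel_measurable_sum borel_measurable_times borel_measurable_diff B_measurable) auto
  have [measurable]: "S k \<in> borel_measurable M" for k
    unfolding S_def simple_ito_integral_def
    using simple_integrand_nonneg[OF si] measurable_F_M[OF \<xi>F] t0
    by (intro borel_measurable_sum borel_measurable_times borel_measurable_diff B_measurable) auto
  have R_lim: "AE \<omega> in M. (\<lambda>k. R k \<omega>) \<longlonglongrightarrow> 0"
    using cont unfolding continuous_paths_def
  proof eventually_elim
    case (elim \<omega>)
    then have c: "continuous_on {0..t} (\<lambda>s. H s \<omega>)" by (rule continuous_on_subset) auto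
    show ?case
    proof (rule tendsto_zero_ennreal)
      fix r :: real assume r: "0 < r"
      define e where "e = sqrt (r / (2 * t))"
      have e: "0 < e" "e\<^sup>2 * t = r / 2" using r t by (simp_all add: e_def)
      from grid_approx[OF t c e(1)]
      show "\<forall>\<^sub>F k in sequentially. R k \<omega> < ennreal r"
      proof eventually_elim
        case (elim k)
        have "R k \<omega> \<le> (\<integral>\<^sup>+ s. ennreal (e\<^sup>2) * indicator {0..t} s \<partial>lborel)"
          unfolding R_def
        proof (rule nn_integral_mono_AE)
          have "AE s in lborel. s \<noteq> (0::real)" by (rule AE_lborel_singleton)
          then show "AE s in lborel. ennreal (((\<Sum>i<Suc k. H (grid t k i) \<omega> * indicator {grid t k i<..grid t k (Suc i)} s) - H s \<omega>)\<^sup>2)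
              * indicator {0..t} s \<le> ennreal (e\<^sup>2) * indicator {0..t} s"
          proof eventually_elim
            case (elim s)
            show ?case
            proof (cases "s \<in> {0<..t}")
              case True
              with \<open>\<forall>s\<in>{0<..t}. _ s\<close> have "\<bar>(\<Sum>i<Suc k. H (grid t k i) \<omega> * indicator {grid t k i<..grid t k (Suc i)} s) - H s \<omega>\<bar> \<le> \<bar>e\<bar>"
                using e(1) by (simp only: abs_of_pos) (meson less_imp_le)
              then have "((\<Sum>i<Suc k. H (grid t k i) \<omega> * indicator {grid t k i<..grid t k (Suc i)} s) - H s \<omega>)\<^sup>2 \<le> e\<^sup>2"
                by (simp only: abs_le_square_iff)
              then show ?thesis by (intro mult_right_mono ennreal_leI) auto
            qed (use elim in \<open>auto simp: indicator_def\<close>)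
          qed
        qed
        also have "\<dots> = ennreal (e\<^sup>2 * t)"
          using t by (simp add: nn_integral_cmult ennreal_mult'')
        also have "\<dots> < ennreal r" using e r by (simp add: ennreal_less_iff)
        finally show ?case .
      qed
    qed
  qed
  \<comment> \<open>If \<open>Q\<close> and \<open>R\<close> are both at most
    \<open>\<delta> / 4\<close>, then \<open>(x - y)^2 \<le> 2 (y - h)^2 + 2 (x - h)^2\<close>
    bounds the squared norm of the difference by \<open>\<delta>\<close>.\<close>
  have ito_le: "prob {\<omega>\<in>space M. e < \<bar>J k \<omega> - S k \<omega>\<bar>} \<le>
      prob {\<omega>\<in>space M. ennreal (\<delta> / 4) < Q k \<omega>} + prob {\<omega>\<in>space M. ennreal (\<delta> / 4) < R k \<omega>} + \<delta> / e\<^sup>2"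
    if e: "0 < e" and \<delta>: "0 < \<delta>" for e \<delta> k
  proof -
    \<comment> \<open>The disjoint sum of the index sets merges both partitions into one overlapping
      family; the sign in \<open>z\<close> performs the subtraction, and \<open>min\<close> stops
      the supplied integrand at \<open>t\<close>.\<close>
    define A where "A = {..<Suc k} <+> {..<n k}"
    define a where "a = case_sum (grid t k) (\<lambda>i. min (\<tau> k i) t)"
    define b where "b = case_sum (\<lambda>i. grid t k (Suc i)) (\<lambda>i. min (\<tau> k (Suc i)) t)"
    define z where "z = case_sum (\<lambda>i. H (grid t k i)) (\<lambda>i \<omega>. - \<xi> k i \<omega>)"
    have sumA: "(\<Sum>i\<in>A. f i) = (\<Sum>i<Suc k. f (Inl i)) + (\<Sum>i<n k. f (Inr i))" for f :: "nat + nat \<Rightarrow> real"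
      unfolding A_def by (subst sum.Plus) auto
    let ?h = "\<lambda>s \<omega>. \<Sum>i\<in>A. z i \<omega> * indicator {a i<..b i} s"
    have J_S: "(\<Sum>i\<in>A. z i \<omega> * (B (b i) \<omega> - B (a i) \<omega>)) = J k \<omega> - S k \<omega>" for \<omega>
      unfolding sumA by (simp add: z_def a_def b_def J_def S_def simple_ito_integral_def sum_negf del: sum.lessThan_Suc)
    have "prob {\<omega>\<in>space M. e < \<bar>\<Sum>i\<in>A. z i \<omega> * (B (b i) \<omega> - B (a i) \<omega>)\<bar>}
      \<le> prob {\<omega>\<in>space M. ennreal \<delta> < (\<integral>\<^sup>+ s. ennreal ((?h s \<omega>)\<^sup>2) \<partial>lborel)} + \<delta> / e\<^sup>2"
    proof (rule prob_interval_family_le)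
      show "finite A" by (simp add: A_def)
      fix i assume i: "i \<in> A"
      then consider j where "i = Inl j" "j < Suc k" | j where "i = Inr j" "j < n k"
        by (auto simp: A_def)
      note cs = this
      show "0 \<le> a i"
        using cs by cases (auto simp: a_def grid_nonneg t0 simple_integrand_nonneg[OF si])
      show "a i \<le> b i"
        using cs
      proof cases
        case 2
        then have "\<tau> k j \<le> \<tau> k (Suc j)" using si[of k] by (simp add: simple_integrand_def)
        then show ?thesis by (auto simp: 2 a_def b_def)
      qed (auto simp: a_def b_def less_imp_le[OF grid_less[OF t]])
      \<comment> \<open>An interval that starts at or after \<open>t\<close> collapses to a point.
        Its coefficient is known only at \<open>\<tau> k j\<close>, possibly later than
        \<open>t\<close>, so measurability is claimed for proper intervals alone.\<close>
      show "z i \<in> borel_measurable (F (a i))" if "a i < b i"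
        using cs
      proof cases
        case 1
        then show ?thesis using Hm by (simp add: z_def a_def)
      next
        case 2
        then have "min (\<tau> k j) t = \<tau> k j" using that by (auto simp: a_def b_def min_def split: if_splits)
        then show ?thesis using \<xi>F[of j k] 2 by (simp add: z_def a_def)
      qed
    qed (use e \<delta> in auto)
    also have "prob {\<omega>\<in>space M. ennreal \<delta> < (\<integral>\<^sup>+ s. ennreal ((?h s \<omega>)\<^sup>2) \<partial>lborel)} \<le>
      prob ({\<omega>\<in>space M. ennreal (\<delta> / 4) < Q k \<omega>} \<union> {\<omega>\<in>space M. ennreal (\<delta> / 4) < R k \<omega>})"
    proof (rule finite_measure_mono)
      have "(\<integral>\<^sup>+ s. ennreal ((?h s \<omega>)\<^sup>2) \<partial>lborel) \<le> ennreal \<delta>"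
        if \<omega>: "\<omega> \<in> space M" and Q: "Q k \<omega> \<le> ennreal (\<delta> / 4)" and R: "R k \<omega> \<le> ennreal (\<delta> / 4)" for \<omega>
      proof -
        let ?g = "\<lambda>s. \<Sum>i<Suc k. H (grid t k i) \<omega> * indicator {grid t k i<..grid t k (Suc i)} s"
        let ?p = "\<lambda>s. simple_process (n k) (\<tau> k) (\<xi> k) s \<omega>"
        have hs: "?h s \<omega> = (if s \<in> {0<..t} then ?g s - ?p s else 0)" for s
        proof -
          have 1: "s \<in> {0<..t}" if "s \<in> {grid t k i<..grid t k (Suc i)}" "i < Suc k" for i
            using that grid_nonneg[OF t0, of k i] grid_le[OF t0, of "Suc i" k] by auto
          have 2: "indicator {min (\<tau> k i) t<..min (\<tau> k (Suc i)) t} s =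
              (if s \<in> {0<..t} then indicator {\<tau> k i<..\<tau> k (Suc i)} s else (0::real))" if "i < n k" for i
            using simple_integrand_nonneg[OF si, of i k] that t by (auto simp: indicator_def)
          have "?h s \<omega> = ?g s - (\<Sum>i<n k. \<xi> k i \<omega> * indicator {min (\<tau> k i) t<..min (\<tau> k (Suc i)) t} s)"
            unfolding sumA by (simp add: z_def a_def b_def sum_negf del: sum.lessThan_Suc)
          also have "(\<Sum>i<n k. \<xi> k i \<omega> * indicator {min (\<tau> k i) t<..min (\<tau> k (Suc i)) t} s) =
              (if s \<in> {0<..t} then ?p s else 0)"
            unfolding simple_process_def using 2 by (auto intro!: sum.cong sum.neutral)
          also have "?g s = (if s \<in> {0<..t} then ?g s else 0)"
            using 1 by (auto intro!: sum.neutral simp del: sum.lessThan_Suc)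
          finally show ?thesis by simp
        qed
        have "(\<integral>\<^sup>+ s. ennreal ((?h s \<omega>)\<^sup>2) \<partial>lborel) \<le>
          (\<integral>\<^sup>+ s\<in>{0..t}. (ennreal (2 * (?p s - H s \<omega>)\<^sup>2) + ennreal (2 * (?g s - H s \<omega>)\<^sup>2)) \<partial>lborel)"
        proof (rule nn_integral_mono)
          fix s
          show "ennreal ((?h s \<omega>)\<^sup>2) \<le> (ennreal (2 * (?p s - H s \<omega>)\<^sup>2) + ennreal (2 * (?g s - H s \<omega>)\<^sup>2)) * indicator {0..t} s"
          proof (cases "s \<in> {0<..t}")
            case True
            have "(x - y)\<^sup>2 \<le> 2 * (y - h)\<^sup>2 + 2 * (x - h)\<^sup>2" for x y h :: real
              using zero_le_power2[of "x + y - 2 * h"] by (simp add: power2_eq_square algebra_simps)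
            then have "(?h s \<omega>)\<^sup>2 \<le> 2 * (?p s - H s \<omega>)\<^sup>2 + 2 * (?g s - H s \<omega>)\<^sup>2"
              unfolding hs using True by simp
            from ennreal_leI[OF this] show ?thesis using True by (simp add: ennreal_plus)
          next
            case False
            have "ennreal ((?h s \<omega>)\<^sup>2) = 0"
              unfolding hs if_not_P[OF False] by simp
            then show ?thesis by (simp only: zero_le)
          qed
        qed
        also have "\<dots> = (\<integral>\<^sup>+ s. (2 * (ennreal ((?p s - H s \<omega>)\<^sup>2) * indicator {0..t} s) + 2 * (ennreal ((?g s - H s \<omega>)\<^sup>2) * indicator {0..t} s)) \<partial>lborel)"
          by (intro nn_integral_cong) (auto simp: ennreal_mult' indicator_def)
        also have "\<dots> = 2 * Q k \<omega> + 2 * R k \<omega>"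
        proof -
          \<comment> \<open>Joint measurability on \<open>{0..t}\<close> gives measurability of the
            section at \<open>\<omega>\<close> only there; hence the cut-off by the indicator
            below.\<close>
          have "(\<lambda>s. H s \<omega>) \<in> borel_measurable (restrict_space borel {0..t})"
          proof -
            have "(\<lambda>(s, \<omega>). H s \<omega>) \<in> borel_measurable (restrict_space borel {0..t} \<Otimes>\<^sub>M F t)"
              using prog t0 by (simp add: progressive_def)
            from measurable_compose[OF measurable_Pair2' this, of \<omega>] \<omega> show ?thesis by simp
          qed
          then have Hi: "(\<lambda>s. H s \<omega> * indicator {0..t} s) \<in> borel_measurable lborel"
            by (subst (asm) borel_measurable_restrict_space_iff) (auto simp: mult.commute)
          have eq: "ennreal ((x s - H s \<omega>)\<^sup>2) * indicator {0..t} s =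
            ennreal ((x s - H s \<omega> * indicator {0..t} s)\<^sup>2) * indicator {0..t} s" for x s
            by (simp add: indicator_def)
          have m: "(\<lambda>s. ennreal ((x s - H s \<omega>)\<^sup>2) * indicator {0..t} s) \<in> borel_measurable lborel"
            if [measurable]: "x \<in> borel_measurable lborel" for x
            unfolding eq using Hi by measurable
          have "?p \<in> borel_measurable lborel" "?g \<in> borel_measurable lborel"
            unfolding simple_process_def by (intro borel_measurable_sum borel_measurable_times; simp)+
          note [measurable] = m[OF this(1)] m[OF this(2)]
          show ?thesis
            unfolding Q_def R_def
            by (subst nn_integral_add; (measurable | simp only: nn_integral_cmult[OF m])?)
               (subst nn_integral_cmult, measurable, subst nn_integral_cmult, measurable)
        qed
        also have "\<dots> \<le> 2 * ennreal (\<delta> / 4) + 2 * ennreal (\<delta> / 4)"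
          using Q R by (intro add_mono mult_left_mono) auto
        also have "\<dots> = ennreal \<delta>"
        proof -
          have "2 * ennreal (\<delta> / 4) = ennreal (\<delta> / 2)"
            using \<delta> ennreal_mult''[of "\<delta> / 4" 2] by simp
          then show ?thesis using \<delta> by (simp flip: ennreal_plus)
        qed
        finally show ?thesis .
      qed
      then show "{\<omega>\<in>space M. ennreal \<delta> < (\<integral>\<^sup>+ s. ennreal ((?h s \<omega>)\<^sup>2) \<partial>lborel)} \<subseteq>
        {\<omega>\<in>space M. ennreal (\<delta> / 4) < Q k \<omega>} \<union> {\<omega>\<in>space M. ennreal (\<delta> / 4) < R k \<omega>}"
        by (auto simp: not_le[symmetric])
    qed measurable
    also have "\<dots> \<le> prob {\<omega>\<in>space M. ennreal (\<delta> / 4) < Q k \<omega>} + prob {\<omega>\<in>space M. ennreal (\<delta> / 4) < R k \<omega>}"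
      by (rule measure_Un_le) measurable
    finally show ?thesis unfolding J_S by simp
  qed
  have "tendsto_prob M (\<lambda>k \<omega>. J k \<omega> - S k \<omega>) (\<lambda>_. 0)"
    unfolding tendsto_prob_def
  proof (intro allI impI)
    fix e :: real assume e: "0 < e"
    show "(\<lambda>k. prob {\<omega>\<in>space M. e < \<bar>J k \<omega> - S k \<omega> - 0\<bar>}) \<longlonglongrightarrow> 0"
    proof (rule order_tendstoI)
      fix r :: real assume r: "0 < r"
      \<comment> \<open>This choice makes the last term of \<open>ito_le\<close> equal to
        \<open>r / 2\<close> and leaves \<open>r / 2\<close> for the two probabilities.\<close>
      define \<delta> where "\<delta> = r / 2 * e\<^sup>2"
      have \<delta>: "0 < \<delta>" "\<delta> / e\<^sup>2 = r / 2" using r e by (simp_all add: \<delta>_def)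
      have "(\<lambda>k. prob {\<omega>\<in>space M. ennreal (\<delta> / 4) < Q k \<omega>} + prob {\<omega>\<in>space M. ennreal (\<delta> / 4) < R k \<omega>}) \<longlonglongrightarrow> 0"
      proof (rule tendsto_add_zero)
        show "(\<lambda>k. prob {\<omega>\<in>space M. ennreal (\<delta> / 4) < Q k \<omega>}) \<longlonglongrightarrow> 0"
          using L2[of "\<delta> / 4"] \<delta> unfolding Q_def by simp
        show "(\<lambda>k. prob {\<omega>\<in>space M. ennreal (\<delta> / 4) < R k \<omega>}) \<longlonglongrightarrow> 0"
          by (rule tendsto_prob_less_ennreal[OF _ R_lim]) (use \<delta> in auto)
      qed
      from order_tendstoD(2)[OF this, of "r / 2"] r
      have "\<forall>\<^sub>F k in sequentially. prob {\<omega>\<in>space M. ennreal (\<delta> / 4) < Q k \<omega>} + prob {\<omega>\<in>space M. ennreal (\<delta> / 4) < R k \<omega>} < r / 2"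
        by simp
      then show "\<forall>\<^sub>F k in sequentially. prob {\<omega>\<in>space M. e < \<bar>J k \<omega> - S k \<omega> - 0\<bar>} < r"
      proof eventually_elim
        case (elim k)
        then show ?case using ito_le[OF e \<delta>(1), of k] \<delta>(2) by simp
      qed
    next
      fix a :: real assume "a < 0"
      then show "\<forall>\<^sub>F k in sequentially. a < prob {\<omega>\<in>space M. e < \<bar>J k \<omega> - S k \<omega> - 0\<bar>}"
        by (intro always_eventually allI less_le_trans[OF _ measure_nonneg])
    qed
  qed
  from tendsto_prob_add[OF _ _ _ _ this lim[folded S_def]]
  have "tendsto_prob M J I" by simp
  then show ?thesis unfolding J_def .
qed

end

section \<open>Geometric Brownian motion\<close>

text \<open>Completing the square: an exponential weight moves the mean of a Gaussian by
  \<open>c * \<sigma>\<^sup>2\<close>. This yields the moments of the Euler error and, at the end,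
  the shift of the mean caused by the factor \<open>1 / \<bar>u\<bar>\<close> of the
  density.\<close>

lemma normal_density_mult_exp:
  assumes "0 < \<sigma>"
  shows "normal_density 0 \<sigma> z * exp (c * z) = exp (c\<^sup>2 * \<sigma>\<^sup>2 / 2) * normal_density (c * \<sigma>\<^sup>2) \<sigma> z"
proof -
  have "- (z - 0)\<^sup>2 / (2 * \<sigma>\<^sup>2) + c * z = c\<^sup>2 * \<sigma>\<^sup>2 / 2 + - (z - c * \<sigma>\<^sup>2)\<^sup>2 / (2 * \<sigma>\<^sup>2)"
    using assms by (simp add: field_simps power2_eq_square)
  then have "exp (- (z - 0)\<^sup>2 / (2 * \<sigma>\<^sup>2)) * exp (c * z) = exp (c\<^sup>2 * \<sigma>\<^sup>2 / 2) * exp (- (z - c * \<sigma>\<^sup>2)\<^sup>2 / (2 * \<sigma>\<^sup>2))"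
    by (simp only: exp_add[symmetric])
  then show ?thesis unfolding normal_density_def by simp
qed

lemma (in prob_space) normal_distributed_exp:
  assumes D: "distributed M lborel Z (normal_density 0 \<sigma>)" and \<sigma>: "0 < \<sigma>"
  shows "integrable M (\<lambda>\<omega>. exp (c * Z \<omega>))" "expectation (\<lambda>\<omega>. exp (c * Z \<omega>)) = exp (c\<^sup>2 * \<sigma>\<^sup>2 / 2)"
    and "integrable M (\<lambda>\<omega>. Z \<omega> * exp (c * Z \<omega>))"
    and "expectation (\<lambda>\<omega>. Z \<omega> * exp (c * Z \<omega>)) = c * \<sigma>\<^sup>2 * exp (c\<^sup>2 * \<sigma>\<^sup>2 / 2)"
proof -
  note [simp] = \<sigma>
  note eq = normal_density_mult_exp[OF \<sigma>]
  have eq': "normal_density 0 \<sigma> z * (z * exp (c * z)) = exp (c\<^sup>2 * \<sigma>\<^sup>2 / 2) * (normal_density (c * \<sigma>\<^sup>2) \<sigma> z * z)" for z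
    using eq[of z c] by (simp add: algebra_simps)
  have "integrable lborel (\<lambda>z. normal_density 0 \<sigma> z * exp (c * z))"
    unfolding eq by (intro integrable_mult_right integrable_normal_density \<sigma>)
  then show "integrable M (\<lambda>\<omega>. exp (c * Z \<omega>))"
    using distributed_integrable[OF D, of "\<lambda>z. exp (c * z)"] by simp
  show "expectation (\<lambda>\<omega>. exp (c * Z \<omega>)) = exp (c\<^sup>2 * \<sigma>\<^sup>2 / 2)"
    using distributed_integral[OF D, of "\<lambda>z. exp (c * z)", symmetric] by (simp add: eq)
  have "integrable lborel (\<lambda>z. normal_density 0 \<sigma> z * (z * exp (c * z)))"
    unfolding eq' by (intro integrable_mult_right integrable_normal_moment_nz_1 \<sigma>)
  then show "integrable M (\<lambda>\<omega>. Z \<omega> * exp (c * Z \<omega>))"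
    using distributed_integrable[OF D, of "\<lambda>z. z * exp (c * z)"] by simp
  show "expectation (\<lambda>\<omega>. Z \<omega> * exp (c * Z \<omega>)) = c * \<sigma>\<^sup>2 * exp (c\<^sup>2 * \<sigma>\<^sup>2 / 2)"
    using distributed_integral[OF D, of "\<lambda>z. z * exp (c * z)", symmetric]
    by (simp add: eq' integral_normal_moment_nz_1)
qed

text \<open>\<open>exp h - 1 - h\<close> is of second order in \<open>h\<close>, so even
  \<open>Suc n\<close> copies of it with \<open>h = a / Suc n\<close> vanish in the limit.\<close>

lemma Suc_mult_exp_remainder_tendsto:
  "(\<lambda>n. real (Suc n) * (exp (a / real (Suc n)) - 1 - a / real (Suc n))) \<longlonglongrightarrow> 0"
proof -
  consider "a < 0" | "a = 0" | "0 < a" by linarith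
  then show ?thesis by cases (simp_all, real_asymp+)
qed

context brownian
begin

text \<open>The drift part is a Riemann sum along a continuous path and converges almost surely; the
  noise part is the grid form of the Ito integral.\<close>

lemma ito_process_linear_grid:
  assumes t: "0 < t" and X: "ito_process M F B X (\<lambda>s \<omega>. \<alpha> * X s \<omega>) (\<lambda>s \<omega>. \<epsilon> * X s \<omega>)"
  shows "tendsto_prob M (\<lambda>n \<omega>. \<Sum>i<Suc n. X (grid t n i) \<omega> *
      (\<alpha> * (t / real (Suc n)) + \<epsilon> * (B (grid t n (Suc i)) \<omega> - B (grid t n i) \<omega>)))
    (\<lambda>\<omega>. X t \<omega> - X 0 \<omega>)"
proof -
  have t0: "0 \<le> t" using t by simp
  have ad: "adapted F X" and cont: "continuous_paths M X" using X by (simp_all add: ito_process_def)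
  obtain I where I: "has_ito_integral M F B (\<lambda>s \<omega>. \<epsilon> * X s \<omega>) t I"
    and eq: "AE \<omega> in M. X t \<omega> = X 0 \<omega> + (LBINT s:{0..t}. \<alpha> * X s \<omega>) + I \<omega>"
    using X t0 unfolding ito_process_def by blast
  have Im: "I \<in> borel_measurable M" using I by (simp add: has_ito_integral_def)
  have XF: "X s \<in> borel_measurable (F s)" if "0 \<le> s" for s
    using ad that by (simp add: adapted_def)
  note Xm = measurable_F_M[OF XF]
  have Bm: "(\<lambda>\<omega>. B (grid t n (Suc i)) \<omega> - B (grid t n i) \<omega>) \<in> borel_measurable M" for n i
    by (intro borel_measurable_diff B_measurable grid_nonneg t0)
  have 1: "tendsto_prob M (\<lambda>n \<omega>. \<Sum>i<Suc n. \<epsilon> * X (grid t n i) \<omega> * (B (grid t n (Suc i)) \<omega> - B (grid t n i) \<omega>)) I"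
  proof (rule ito_integral_grid[OF t I])
    show "adapted F (\<lambda>s \<omega>. \<epsilon> * X s \<omega>)"
      using XF unfolding adapted_def by (auto intro!: borel_measurable_times)
    show "continuous_paths M (\<lambda>s \<omega>. \<epsilon> * X s \<omega>)"
      using cont unfolding continuous_paths_def
      by eventually_elim (intro continuous_on_mult continuous_on_const)
  qed
  \<comment> \<open>The limit is written as \<open>X t - X 0 - I\<close>, which is visibly
    measurable, in place of the path integral of the drift.\<close>
  have 2: "tendsto_prob M (\<lambda>n \<omega>. \<Sum>i<Suc n. \<alpha> * X (grid t n i) \<omega> * (t / real (Suc n))) (\<lambda>\<omega>. X t \<omega> - X 0 \<omega> - I \<omega>)"
  proof (rule tendsto_prob_AE)
    show "(\<lambda>\<omega>. \<Sum>i<Suc n. \<alpha> * X (grid t n i) \<omega> * (t / real (Suc n))) \<in> borel_measurable M" for n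
      by (intro borel_measurable_sum borel_measurable_times borel_measurable_const Xm grid_nonneg t0)
    show "(\<lambda>\<omega>. X t \<omega> - X 0 \<omega> - I \<omega>) \<in> borel_measurable M"
      by (intro borel_measurable_diff Xm Im t0 order_refl)
    show "AE \<omega> in M. (\<lambda>n. \<Sum>i<Suc n. \<alpha> * X (grid t n i) \<omega> * (t / real (Suc n))) \<longlonglongrightarrow> X t \<omega> - X 0 \<omega> - I \<omega>"
      using eq cont[unfolded continuous_paths_def]
    proof eventually_elim
      case (elim \<omega>)
      have "continuous_on {0..t} (\<lambda>s. \<alpha> * X s \<omega>)"
        by (intro continuous_on_mult continuous_on_const continuous_on_subset[OF elim(2)]) auto
      from riemann_sum_tendsto[OF t this] elim(1) show ?case by simp
    qed
  qed
  have "tendsto_prob M (\<lambda>n \<omega>. (\<Sum>i<Suc n. \<epsilon> * X (grid t n i) \<omega> * (B (grid t n (Suc i)) \<omega> - B (grid t n i) \<omega>))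
      + (\<Sum>i<Suc n. \<alpha> * X (grid t n i) \<omega> * (t / real (Suc n)))) (\<lambda>\<omega>. I \<omega> + (X t \<omega> - X 0 \<omega> - I \<omega>))"
    by (rule tendsto_prob_add[OF _ _ _ _ 1 2];
        intro borel_measurable_sum borel_measurable_times borel_measurable_diff borel_measurable_const Xm Bm Im grid_nonneg t0 order_refl)
  then show ?thesis
    unfolding sum.distrib[symmetric] by (simp add: algebra_simps del: sum.lessThan_Suc)
qed

lemma B_0: "AE \<omega> in M. B 0 \<omega> = 0"
  using bm by (simp add: brownian_motion_def)

lemma B_distributed:
  assumes "0 < s"
  shows "distributed M lborel (B s) (normal_density 0 (sqrt s))"
proof -
  have "distributed M lborel (\<lambda>\<omega>. B s \<omega> - B 0 \<omega>) (normal_density 0 (sqrt s))"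
    using increment_distributed[of 0 s] assms by simp
  moreover have "distr M lborel (\<lambda>\<omega>. B s \<omega> - B 0 \<omega>) = distr M lborel (B s)"
    using B_0 assms by (intro distr_cong_AE) (auto intro!: borel_measurable_diff B_measurable)
  ultimately show ?thesis
    using B_measurable[of s] assms by (simp add: distributed_def)
qed

text \<open>The explicit solution, with the Ito correction \<open>- \<epsilon>\<^sup>2 / 2\<close>
  in the exponent. The factor \<open>u\<close> may be negative, and its sign is kept for all times,
  as \<open>D2\<close> demands.\<close>

definition gbm :: "real \<Rightarrow> real \<Rightarrow> real \<Rightarrow> real \<Rightarrow> 'w \<Rightarrow> real" where
  "gbm u \<alpha> \<epsilon> s \<omega> = u * exp ((\<alpha> - \<epsilon>\<^sup>2 / 2) * s + \<epsilon> * B s \<omega>)"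

lemma gbm_measurable_F: "0 \<le> s \<Longrightarrow> gbm u \<alpha> \<epsilon> s \<in> borel_measurable (F s)"
proof -
  assume "0 \<le> s"
  note [measurable] = B_measurable_F[OF this]
  show ?thesis unfolding gbm_def[abs_def] by measurable
qed

lemma gbm_0: "AE \<omega> in M. gbm u \<alpha> \<epsilon> 0 \<omega> = u"
  using B_0 by eventually_elim (simp add: gbm_def)

lemma gbm_power2:
  assumes s: "0 \<le> s"
  shows "integrable M (\<lambda>\<omega>. (gbm u \<alpha> \<epsilon> s \<omega>)\<^sup>2)"
    and "expectation (\<lambda>\<omega>. (gbm u \<alpha> \<epsilon> s \<omega>)\<^sup>2) = u\<^sup>2 * exp ((2 * \<alpha> + \<epsilon>\<^sup>2) * s)"
proof -
  note [measurable] = measurable_F_M[OF gbm_measurable_F[OF s]]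
  have "integrable M (\<lambda>\<omega>. (gbm u \<alpha> \<epsilon> s \<omega>)\<^sup>2) \<and>
    expectation (\<lambda>\<omega>. (gbm u \<alpha> \<epsilon> s \<omega>)\<^sup>2) = u\<^sup>2 * exp ((2 * \<alpha> + \<epsilon>\<^sup>2) * s)"
  \<comment> \<open>\<open>B 0\<close> has no Gaussian density, so time zero is treated through
    \<open>B 0 = 0\<close> almost surely.\<close>
  proof (cases "s = 0")
    case True
    have ae: "AE \<omega> in M. (gbm u \<alpha> \<epsilon> s \<omega>)\<^sup>2 = u\<^sup>2"
      using gbm_0[of u \<alpha> \<epsilon>] unfolding True by eventually_elim simp
    have "integrable M (\<lambda>\<omega>. (gbm u \<alpha> \<epsilon> s \<omega>)\<^sup>2) \<longleftrightarrow> integrable M (\<lambda>\<omega>. u\<^sup>2)"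
      by (rule integrable_cong_AE) (use ae in auto)
    moreover have "expectation (\<lambda>\<omega>. (gbm u \<alpha> \<epsilon> s \<omega>)\<^sup>2) = expectation (\<lambda>\<omega>. u\<^sup>2)"
      by (rule integral_cong_AE) (use ae in auto)
    ultimately show ?thesis using True by (simp add: prob_space)
  next
    case False
    then have s0: "0 < s" and "0 < sqrt s" using s by simp_all
    note Z = normal_distributed_exp[OF B_distributed[OF s0] this(2), of "2 * \<epsilon>"]
    have eq: "(gbm u \<alpha> \<epsilon> s \<omega>)\<^sup>2 = u\<^sup>2 * exp (2 * (\<alpha> - \<epsilon>\<^sup>2 / 2) * s) * exp (2 * \<epsilon> * B s \<omega>)" for \<omega>
      by (simp add: gbm_def power_mult_distrib exp_double[symmetric] exp_add[symmetric] algebra_simps)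
    have "expectation (\<lambda>\<omega>. (gbm u \<alpha> \<epsilon> s \<omega>)\<^sup>2) = u\<^sup>2 * (exp (2 * (\<alpha> - \<epsilon>\<^sup>2 / 2) * s) * exp ((2 * \<epsilon>)\<^sup>2 * (sqrt s)\<^sup>2 / 2))"
      unfolding eq using Z(2) by simp
    also have "exp (2 * (\<alpha> - \<epsilon>\<^sup>2 / 2) * s) * exp ((2 * \<epsilon>)\<^sup>2 * (sqrt s)\<^sup>2 / 2) = exp ((2 * \<alpha> + \<epsilon>\<^sup>2) * s)"
      using s by (simp add: exp_add[symmetric] power_mult_distrib algebra_simps)
    finally show ?thesis using Z(1) by (simp add: eq)
  qed
  then show "integrable M (\<lambda>\<omega>. (gbm u \<alpha> \<epsilon> s \<omega>)\<^sup>2)"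
    and "expectation (\<lambda>\<omega>. (gbm u \<alpha> \<epsilon> s \<omega>)\<^sup>2) = u\<^sup>2 * exp ((2 * \<alpha> + \<epsilon>\<^sup>2) * s)" by auto
qed

text \<open>
  The error of one Euler step of \<open>gbm\<close>, relative to its current value. Its mean \<open>euler_mean\<close> and
  its second moment \<open>euler_sq\<close> are of order \<open>\<Delta>\<^sup>2\<close>, which is why the error disappears in the limit.
\<close>

definition euler_err :: "real \<Rightarrow> real \<Rightarrow> real \<Rightarrow> real \<Rightarrow> real" where
  "euler_err \<alpha> \<epsilon> \<Delta> z = exp ((\<alpha> - \<epsilon>\<^sup>2 / 2) * \<Delta> + \<epsilon> * z) - 1 - \<alpha> * \<Delta> - \<epsilon> * z"

definition euler_mean :: "real \<Rightarrow> real \<Rightarrow> real" where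
  "euler_mean \<alpha> \<Delta> = exp (\<alpha> * \<Delta>) - 1 - \<alpha> * \<Delta>"

definition euler_sq :: "real \<Rightarrow> real \<Rightarrow> real \<Rightarrow> real" where
  "euler_sq \<alpha> \<epsilon> \<Delta> = (exp ((2 * \<alpha> + \<epsilon>\<^sup>2) * \<Delta>) - 1 - (2 * \<alpha> + \<epsilon>\<^sup>2) * \<Delta>)
     - 2 * (1 + (\<alpha> + \<epsilon>\<^sup>2) * \<Delta>) * euler_mean \<alpha> \<Delta> + (\<alpha>\<^sup>2 - 2 * \<alpha> * (\<alpha> + \<epsilon>\<^sup>2)) * \<Delta>\<^sup>2"

lemma euler_err_moments:
  assumes s: "0 \<le> s" "s < t"
  defines "Z \<equiv> (\<lambda>\<omega>. B t \<omega> - B s \<omega>)"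
  shows "integrable M (\<lambda>\<omega>. (euler_err \<alpha> \<epsilon> (t - s) (Z \<omega>))\<^sup>2)"
    and "expectation (\<lambda>\<omega>. euler_err \<alpha> \<epsilon> (t - s) (Z \<omega>)) = euler_mean \<alpha> (t - s)"
    and "expectation (\<lambda>\<omega>. (euler_err \<alpha> \<epsilon> (t - s) (Z \<omega>))\<^sup>2) = euler_sq \<alpha> \<epsilon> (t - s)"
    and "integrable M (\<lambda>\<omega>. euler_err \<alpha> \<epsilon> (t - s) (Z \<omega>))"
proof -
  define d where "d = t - s"
  have d: "0 < d" "0 < sqrt d" "(sqrt d)\<^sup>2 = d" using s by (simp_all add: d_def)
  have D: "distributed M lborel Z (normal_density 0 (sqrt d))"
    using increment_distributed[OF s] by (simp add: Z_def d_def)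
  have Z2: "integrable M (\<lambda>\<omega>. (Z \<omega>)\<^sup>2)" "expectation Z = 0" "expectation (\<lambda>\<omega>. (Z \<omega>)\<^sup>2) = d"
    using increment_moments[OF s] by (simp_all add: Z_def d_def)
  have [measurable]: "Z \<in> borel_measurable M" unfolding Z_def
    using s by (intro borel_measurable_diff B_measurable) auto
  have Z1: "integrable M Z" by (rule square_integrable_imp_integrable) (use Z2 in auto)
  \<comment> \<open>The factor \<open>k\<close> contains the Ito correction, which the exponential
    moments of the increment compensate: \<open>k1\<close> for the mean, \<open>k2\<close> for the
    square.\<close>
  define k where "k = exp ((\<alpha> - \<epsilon>\<^sup>2 / 2) * d)"
  define q where "q = 1 + \<alpha> * d"
  note E1 = normal_distributed_exp[OF D d(2), of \<epsilon>, unfolded d(3)]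
  note E2 = normal_distributed_exp[OF D d(2), of "2 * \<epsilon>", unfolded d(3)]
  have err: "euler_err \<alpha> \<epsilon> d z = k * exp (\<epsilon> * z) - q - \<epsilon> * z" for z
    by (simp add: euler_err_def k_def q_def exp_add)
  have e2: "exp (2 * \<epsilon> * z) = exp (\<epsilon> * z) * exp (\<epsilon> * z)" for z
    by (simp add: exp_add[symmetric])
  have sq: "(euler_err \<alpha> \<epsilon> d z)\<^sup>2 = k\<^sup>2 * exp (2 * \<epsilon> * z) + q\<^sup>2 + \<epsilon>\<^sup>2 * z\<^sup>2 - 2 * q * k * exp (\<epsilon> * z)
      - 2 * \<epsilon> * k * (z * exp (\<epsilon> * z)) + 2 * q * \<epsilon> * z" for z
    unfolding err e2 by (simp add: power2_eq_square algebra_simps)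
  have k1: "k * exp (\<epsilon>\<^sup>2 * d / 2) = exp (\<alpha> * d)"
    by (simp add: k_def exp_add[symmetric] algebra_simps)
  have k2: "k\<^sup>2 * exp ((2 * \<epsilon>)\<^sup>2 * d / 2) = exp ((2 * \<alpha> + \<epsilon>\<^sup>2) * d)"
    by (simp add: k_def exp_double[symmetric] exp_add[symmetric] power_mult_distrib algebra_simps)
  show "integrable M (\<lambda>\<omega>. (euler_err \<alpha> \<epsilon> (t - s) (Z \<omega>))\<^sup>2)"
    unfolding d_def[symmetric] sq using E1 E2 Z1 Z2 by simp
  show "integrable M (\<lambda>\<omega>. euler_err \<alpha> \<epsilon> (t - s) (Z \<omega>))"
    unfolding d_def[symmetric] err using E1 Z1 by simp
  have "expectation (\<lambda>\<omega>. euler_err \<alpha> \<epsilon> d (Z \<omega>)) = k * exp (\<epsilon>\<^sup>2 * d / 2) - q"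
    unfolding err using E1 Z1 Z2 by (simp add: prob_space)
  then show "expectation (\<lambda>\<omega>. euler_err \<alpha> \<epsilon> (t - s) (Z \<omega>)) = euler_mean \<alpha> (t - s)"
    unfolding d_def[symmetric] k1 by (simp add: euler_mean_def q_def)
  have "expectation (\<lambda>\<omega>. (euler_err \<alpha> \<epsilon> d (Z \<omega>))\<^sup>2) =
      k\<^sup>2 * expectation (\<lambda>\<omega>. exp (2 * \<epsilon> * Z \<omega>)) + q\<^sup>2 + \<epsilon>\<^sup>2 * expectation (\<lambda>\<omega>. (Z \<omega>)\<^sup>2)
      - 2 * q * k * expectation (\<lambda>\<omega>. exp (\<epsilon> * Z \<omega>))
      - 2 * \<epsilon> * k * expectation (\<lambda>\<omega>. Z \<omega> * exp (\<epsilon> * Z \<omega>)) + 2 * q * \<epsilon> * expectation Z"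
    unfolding sq using E1(1,3) E2(1) Z1 Z2(1) by (simp add: prob_space)
  also have "\<dots> =
      k\<^sup>2 * exp ((2 * \<epsilon>)\<^sup>2 * d / 2) + q\<^sup>2 + \<epsilon>\<^sup>2 * d - 2 * q * (k * exp (\<epsilon>\<^sup>2 * d / 2)) - 2 * \<epsilon>\<^sup>2 * d * (k * exp (\<epsilon>\<^sup>2 * d / 2))"
    unfolding E1(2,4) E2(2) Z2(2,3) by (simp add: power2_eq_square)
  \<comment> \<open>Substituting \<open>exp (\<alpha> * d) = euler_mean \<alpha> d + q\<close>
    cancels the terms of order 0 and 1 in \<open>d\<close>; this is the origin of the grouping in
    \<open>euler_sq\<close>.\<close>
  also have "\<dots> = euler_sq \<alpha> \<epsilon> d"
    unfolding k1 k2 by (simp add: euler_sq_def euler_mean_def q_def power2_eq_square algebra_simps)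
  finally show "expectation (\<lambda>\<omega>. (euler_err \<alpha> \<epsilon> (t - s) (Z \<omega>))\<^sup>2) = euler_sq \<alpha> \<epsilon> (t - s)"
    unfolding d_def .
qed

text \<open>The increments telescope exactly, and what separates them from the claimed sum is the
  accumulated Euler error \<open>W + V\<close>. The centred part \<open>W\<close> is a sum of
  orthogonal terms with second moment at most \<open>C * Suc n * v n\<close>. The means collected in
  \<open>V\<close> do not cancel, but Cauchy-Schwarz bounds its second moment by \<open>C\<close>
  times the square of \<open>Suc n * m n\<close>. Both bounds tend to 0.\<close>

lemma gbm_grid:
  assumes t: "0 < t"
  shows "tendsto_prob M (\<lambda>n \<omega>. \<Sum>i<Suc n. gbm u \<alpha> \<epsilon> (grid t n i) \<omega> *
      (\<alpha> * (t / real (Suc n)) + \<epsilon> * (B (grid t n (Suc i)) \<omega> - B (grid t n i) \<omega>)))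
    (\<lambda>\<omega>. gbm u \<alpha> \<epsilon> t \<omega> - gbm u \<alpha> \<epsilon> 0 \<omega>)"
proof -
  let ?S = "\<lambda>n i. gbm u \<alpha> \<epsilon> (grid t n i)"
  let ?Z = "\<lambda>n i \<omega>. B (grid t n (Suc i)) \<omega> - B (grid t n i) \<omega>"
  let ?d = "\<lambda>n. t / real (Suc n)"
  \<comment> \<open>Bounds the second moment of \<open>gbm\<close> on all of \<open>{0..t}\<close>;
    the absolute value covers both signs of the rate.\<close>
  define C where "C = u\<^sup>2 * exp (\<bar>2 * \<alpha> + \<epsilon>\<^sup>2\<bar> * t)"
  define m where "m = (\<lambda>n. euler_mean \<alpha> (?d n))"
  define v where "v = (\<lambda>n. euler_sq \<alpha> \<epsilon> (?d n))"
  define W where "W = (\<lambda>n \<omega>. \<Sum>i<Suc n. ?S n i \<omega> * (euler_err \<alpha> \<epsilon> (?d n) (?Z n i \<omega>) - m n))"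
  define V where "V = (\<lambda>n \<omega>. m n * (\<Sum>i<Suc n. ?S n i \<omega>))"
  have t0: "0 \<le> t" using t by simp
  note g0 = grid_nonneg[OF t0]
  have SF: "?S n i \<in> borel_measurable (F (grid t n i))" for n i
    by (rule gbm_measurable_F[OF g0])
  note [measurable] = measurable_F_M[OF SF] measurable_F_M[OF gbm_measurable_F[OF t0]]
  have Zm[measurable]: "?Z n i \<in> borel_measurable M" for n i
    by (intro borel_measurable_diff B_measurable g0)
  have [measurable]: "euler_err \<alpha> \<epsilon> d \<in> borel_measurable borel" for d
    unfolding euler_err_def[abs_def] by measurable
  have S2: "integrable M (\<lambda>\<omega>. (?S n i \<omega>)\<^sup>2)" for n i
    by (rule gbm_power2[OF g0])
  have ES2: "expectation (\<lambda>\<omega>. (?S n i \<omega>)\<^sup>2) \<le> C" if "i < Suc n" for n i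
  proof -
    have "(2 * \<alpha> + \<epsilon>\<^sup>2) * grid t n i \<le> \<bar>2 * \<alpha> + \<epsilon>\<^sup>2\<bar> * t"
      using g0[of n i] grid_le[OF t0, of i n] that by (intro mult_mono) auto
    then show ?thesis unfolding gbm_power2(2)[OF g0] C_def by (intro mult_left_mono) auto
  qed
  have C0: "0 \<le> C" by (simp add: C_def)
  have [measurable]: "W n \<in> borel_measurable M" "V n \<in> borel_measurable M" for n
    unfolding W_def V_def by measurable
  have gl: "grid t n i < grid t n (Suc i)" for n i by (rule grid_less[OF t])
  have mom: "integrable M (\<lambda>\<omega>. (euler_err \<alpha> \<epsilon> (?d n) (?Z n i \<omega>))\<^sup>2)"
    "integrable M (\<lambda>\<omega>. euler_err \<alpha> \<epsilon> (?d n) (?Z n i \<omega>))"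
    "expectation (\<lambda>\<omega>. euler_err \<alpha> \<epsilon> (?d n) (?Z n i \<omega>)) = m n"
    "expectation (\<lambda>\<omega>. (euler_err \<alpha> \<epsilon> (?d n) (?Z n i \<omega>))\<^sup>2) = v n" for n i
    using euler_err_moments[OF g0[of n i] gl[of n i], where \<alpha>=\<alpha> and \<epsilon>=\<epsilon>] unfolding grid_diff m_def v_def by auto
  have cen: "integrable M (\<lambda>\<omega>. (euler_err \<alpha> \<epsilon> (?d n) (?Z n i \<omega>) - m n)\<^sup>2)"
    "expectation (\<lambda>\<omega>. euler_err \<alpha> \<epsilon> (?d n) (?Z n i \<omega>) - m n) = 0"
    "expectation (\<lambda>\<omega>. (euler_err \<alpha> \<epsilon> (?d n) (?Z n i \<omega>) - m n)\<^sup>2) \<le> v n" for n i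
  proof -
    have eq: "(y - m n)\<^sup>2 = y\<^sup>2 - 2 * m n * y + (m n)\<^sup>2" for y
      by (simp add: power2_diff)
    show "integrable M (\<lambda>\<omega>. (euler_err \<alpha> \<epsilon> (?d n) (?Z n i \<omega>) - m n)\<^sup>2)"
      unfolding eq using mom(1,2)[of n i] by simp
    show "expectation (\<lambda>\<omega>. euler_err \<alpha> \<epsilon> (?d n) (?Z n i \<omega>) - m n) = 0"
      using mom(2,3)[of n i] by (simp add: prob_space)
    have "expectation (\<lambda>\<omega>. (euler_err \<alpha> \<epsilon> (?d n) (?Z n i \<omega>) - m n)\<^sup>2) = v n - 2 * m n * m n + (m n)\<^sup>2"
      unfolding eq using mom[of n i] by (simp add: prob_space)
    then show "expectation (\<lambda>\<omega>. (euler_err \<alpha> \<epsilon> (?d n) (?Z n i \<omega>) - m n)\<^sup>2) \<le> v n"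
      by (simp add: power2_eq_square)
  qed
  have W2: "integrable M (\<lambda>\<omega>. (W n \<omega>)\<^sup>2)"
      "expectation (\<lambda>\<omega>. (W n \<omega>)\<^sup>2) = (\<Sum>i<Suc n. expectation (\<lambda>\<omega>. (?S n i \<omega>)\<^sup>2) *
         expectation (\<lambda>\<omega>. (euler_err \<alpha> \<epsilon> (?d n) (?Z n i \<omega>) - m n)\<^sup>2))" for n
    using sum_increments_isometry[of "grid t n" "Suc n" "?S n" "\<lambda>_ z. euler_err \<alpha> \<epsilon> (?d n) z - m n",
        OF _ gl SF _ S2 cen(1,2)] unfolding W_def by auto
  have W_le: "expectation (\<lambda>\<omega>. (W n \<omega>)\<^sup>2) \<le> C * (real (Suc n) * v n)" for n
  proof -
    have "expectation (\<lambda>\<omega>. (W n \<omega>)\<^sup>2) \<le> (\<Sum>i<Suc n. C * v n)"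
      unfolding W2(2) using ES2 cen(3) C0 by (intro sum_mono mult_mono) auto
    then show ?thesis by (simp add: algebra_simps)
  qed
  have V_pt: "(V n \<omega>)\<^sup>2 \<le> (m n)\<^sup>2 * (real (Suc n) * (\<Sum>i<Suc n. (?S n i \<omega>)\<^sup>2))" for n \<omega>
    unfolding V_def power_mult_distrib using sum_squared_le_sum_of_squares[of "\<lambda>i. ?S n i \<omega>" "{..<Suc n}"]
    by (intro mult_left_mono) (auto simp: mult.commute)
  have Vi: "integrable M (\<lambda>\<omega>. (m n)\<^sup>2 * (real (Suc n) * (\<Sum>i<Suc n. (?S n i \<omega>)\<^sup>2)))" for n
    using S2 by (intro integrable_mult_right Bochner_Integration.integrable_sum) auto
  have V2: "integrable M (\<lambda>\<omega>. (V n \<omega>)\<^sup>2)" for n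
    by (rule Bochner_Integration.integrable_bound[OF Vi[of n]]) (use V_pt in \<open>auto intro!: AE_I2 order_trans[OF V_pt]\<close>)
  have V_le: "expectation (\<lambda>\<omega>. (V n \<omega>)\<^sup>2) \<le> C * (real (Suc n) * m n)\<^sup>2" for n
  proof -
    have "expectation (\<lambda>\<omega>. (V n \<omega>)\<^sup>2) \<le> expectation (\<lambda>\<omega>. (m n)\<^sup>2 * (real (Suc n) * (\<Sum>i<Suc n. (?S n i \<omega>)\<^sup>2)))"
      using V2 Vi V_pt by (intro integral_mono) auto
    also have "\<dots> = (m n)\<^sup>2 * (real (Suc n) * (\<Sum>i<Suc n. expectation (\<lambda>\<omega>. (?S n i \<omega>)\<^sup>2)))"
      using S2 by (simp del: sum.lessThan_Suc)
    also have "\<dots> \<le> (m n)\<^sup>2 * (real (Suc n) * (\<Sum>i<Suc n. C))"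
      using ES2 by (intro mult_left_mono sum_mono) auto
    also have "\<dots> = C * (real (Suc n) * m n)\<^sup>2"
      by (simp add: power2_eq_square algebra_simps)
    finally show ?thesis .
  qed
  have lim_m: "(\<lambda>n. real (Suc n) * m n) \<longlonglongrightarrow> 0"
    using Suc_mult_exp_remainder_tendsto[of "\<alpha> * t"] unfolding m_def euler_mean_def by simp
  have lim_v: "(\<lambda>n. real (Suc n) * v n) \<longlonglongrightarrow> 0"
  proof -
    have d0: "?d \<longlonglongrightarrow> 0" using LIMSEQ_Suc[OF lim_const_over_n[of t]] .
    \<comment> \<open>The three parts of \<open>euler_sq\<close>, multiplied by
      \<open>Suc n\<close>; the last uses
      \<open>Suc n * \<Delta>\<^sup>2 = t * \<Delta>\<close>.\<close>
    have "(\<lambda>n. real (Suc n) * (exp ((2 * \<alpha> + \<epsilon>\<^sup>2) * t / real (Suc n)) - 1 - (2 * \<alpha> + \<epsilon>\<^sup>2) * t / real (Suc n))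
        - 2 * (1 + (\<alpha> + \<epsilon>\<^sup>2) * ?d n) * (real (Suc n) * m n) + (\<alpha>\<^sup>2 - 2 * \<alpha> * (\<alpha> + \<epsilon>\<^sup>2)) * t * ?d n)
      \<longlonglongrightarrow> 0 - 2 * (1 + (\<alpha> + \<epsilon>\<^sup>2) * 0) * 0 + (\<alpha>\<^sup>2 - 2 * \<alpha> * (\<alpha> + \<epsilon>\<^sup>2)) * t * 0"
      by (intro tendsto_intros d0 lim_m Suc_mult_exp_remainder_tendsto)
    moreover have "real (Suc n) * (exp ((2 * \<alpha> + \<epsilon>\<^sup>2) * t / real (Suc n)) - 1 - (2 * \<alpha> + \<epsilon>\<^sup>2) * t / real (Suc n))
        - 2 * (1 + (\<alpha> + \<epsilon>\<^sup>2) * ?d n) * (real (Suc n) * m n) + (\<alpha>\<^sup>2 - 2 * \<alpha> * (\<alpha> + \<epsilon>\<^sup>2)) * t * ?d n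
      = real (Suc n) * v n" for n
    proof -
      have "real (Suc n) * (\<Delta>\<^sup>2) = t * \<Delta>" if "\<Delta> = t / real (Suc n)" for \<Delta>
        unfolding that by (simp add: power2_eq_square)
      then have sqd: "real (Suc n) * (?d n)\<^sup>2 = t * ?d n" by blast
      have alg: "N * (A - 2 * x * y + g * z) = N * A - 2 * x * (N * y) + g * (N * z)" for N A x y g z :: real
        by (simp add: algebra_simps)
      have mn: "euler_mean \<alpha> (?d n) = m n" by (simp add: m_def)
      show ?thesis
        unfolding v_def euler_sq_def alg mn sqd by (simp only: mult.assoc times_divide_eq_right)
    qed
    ultimately show ?thesis by simp
  qed
  have WV: "tendsto_prob M (\<lambda>n \<omega>. W n \<omega> + V n \<omega>) (\<lambda>_. 0 + 0)"
  proof (rule tendsto_prob_add)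
    show "tendsto_prob M W (\<lambda>_. 0)"
    proof (rule tendsto_prob_power2)
      have null: "(\<lambda>n. C * (real (Suc n) * v n)) \<longlonglongrightarrow> 0"
        using lim_v by (rule tendsto_mult_right_zero)
      show "(\<lambda>n. expectation (\<lambda>\<omega>. (W n \<omega>)\<^sup>2)) \<longlonglongrightarrow> 0"
        by (rule Lim_null_comparison[OF _ null]) (use W_le in simp)
    qed (use W2 in auto)
    show "tendsto_prob M V (\<lambda>_. 0)"
    proof (rule tendsto_prob_power2)
      have null: "(\<lambda>n. C * (real (Suc n) * m n)\<^sup>2) \<longlonglongrightarrow> 0"
        using tendsto_mult_right_zero[OF tendsto_null_power[OF lim_m, of 2]] by simp
      show "(\<lambda>n. expectation (\<lambda>\<omega>. (V n \<omega>)\<^sup>2)) \<longlonglongrightarrow> 0"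
        by (rule Lim_null_comparison[OF _ null]) (use V_le in simp)
    qed (use V2 in auto)
  qed auto
  have step: "?S n (Suc i) \<omega> - ?S n i \<omega> = ?S n i \<omega> * (\<alpha> * ?d n + \<epsilon> * ?Z n i \<omega>) + ?S n i \<omega> * euler_err \<alpha> \<epsilon> (?d n) (?Z n i \<omega>)" for n i \<omega>
  proof -
    have g: "grid t n (Suc i) = grid t n i + ?d n" using grid_diff[of t n i] by simp
    have "?S n (Suc i) \<omega> = ?S n i \<omega> * exp ((\<alpha> - \<epsilon>\<^sup>2 / 2) * ?d n + \<epsilon> * ?Z n i \<omega>)"
    proof -
      have "(\<alpha> - \<epsilon>\<^sup>2 / 2) * grid t n (Suc i) + \<epsilon> * B (grid t n (Suc i)) \<omega> =
          ((\<alpha> - \<epsilon>\<^sup>2 / 2) * grid t n i + \<epsilon> * B (grid t n i) \<omega>) + ((\<alpha> - \<epsilon>\<^sup>2 / 2) * ?d n + \<epsilon> * ?Z n i \<omega>)"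
        unfolding right_diff_distrib[of \<epsilon>] distrib_left[symmetric] using g by (simp add: algebra_simps)
      then show ?thesis unfolding gbm_def by (simp only: exp_add mult.assoc)
    qed
    then show ?thesis by (simp add: euler_err_def algebra_simps)
  qed
  have tele: "gbm u \<alpha> \<epsilon> t \<omega> - gbm u \<alpha> \<epsilon> 0 \<omega> - (W n \<omega> + V n \<omega>) =
      (\<Sum>i<Suc n. ?S n i \<omega> * (\<alpha> * ?d n + \<epsilon> * ?Z n i \<omega>))" for n \<omega>
  proof -
    have "gbm u \<alpha> \<epsilon> t \<omega> - gbm u \<alpha> \<epsilon> 0 \<omega> = (\<Sum>i<Suc n. ?S n (Suc i) \<omega> - ?S n i \<omega>)"
      using sum_lessThan_telescope[of "\<lambda>i. ?S n i \<omega>" "Suc n"] by simp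
    also have "\<dots> = (\<Sum>i<Suc n. ?S n i \<omega> * (\<alpha> * ?d n + \<epsilon> * ?Z n i \<omega>)) + (\<Sum>i<Suc n. ?S n i \<omega> * euler_err \<alpha> \<epsilon> (?d n) (?Z n i \<omega>))"
      unfolding step sum.distrib ..
    also have "(\<Sum>i<Suc n. ?S n i \<omega> * euler_err \<alpha> \<epsilon> (?d n) (?Z n i \<omega>)) = W n \<omega> + V n \<omega>"
      unfolding W_def V_def sum_distrib_left sum.distrib[symmetric] by (simp add: algebra_simps del: sum.lessThan_Suc)
    finally show ?thesis by simp
  qed
  have const: "tendsto_prob M (\<lambda>n \<omega>. gbm u \<alpha> \<epsilon> t \<omega> - gbm u \<alpha> \<epsilon> 0 \<omega>) (\<lambda>\<omega>. gbm u \<alpha> \<epsilon> t \<omega> - gbm u \<alpha> \<epsilon> 0 \<omega>)"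
    by (simp add: tendsto_prob_def)
  have [measurable]: "gbm u \<alpha> \<epsilon> 0 \<in> borel_measurable M"
    by (rule measurable_F_M[OF gbm_measurable_F]) simp
  have "tendsto_prob M (\<lambda>n \<omega>. gbm u \<alpha> \<epsilon> t \<omega> - gbm u \<alpha> \<epsilon> 0 \<omega> - (W n \<omega> + V n \<omega>)) (\<lambda>\<omega>. gbm u \<alpha> \<epsilon> t \<omega> - gbm u \<alpha> \<epsilon> 0 \<omega> - (0 + 0))"
    by (rule tendsto_prob_diff[OF _ _ _ _ const WV]) measurable
  then show ?thesis unfolding tele by simp
qed

end

section \<open>Uniqueness for the linear equation\<close>

text \<open>Density of the rationals. The approximation runs through \<open>{0<..<t}\<close>, whose
  closure is \<open>{0..t}\<close> only for positive \<open>t\<close>; hence the separate degenerate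
  case.\<close>

lemma bounded_on_rats_imp_bounded:
  fixes f :: "real \<Rightarrow> real"
  assumes f: "continuous_on {0..t} f" and le: "\<And>q. q \<in> {0..t} \<inter> \<rat> \<Longrightarrow> \<bar>f q\<bar> \<le> K"
    and r: "r \<in> {0..t}"
  shows "\<bar>f r\<bar> \<le> K"
proof (cases "0 < t")
  case True
  have cl: "closure ({0<..<t} \<inter> \<rat>) = {0..t}"
    using closure_open_Int_superset[of "{0<..<t}" "\<rat> :: real set"] True by (simp add: Rats_closure_real)
  show ?thesis
    by (rule continuous_le_on_closure[of "{0<..<t} \<inter> \<rat>" "\<lambda>r. \<bar>f r\<bar>"])
      (use f r le in \<open>auto simp: cl intro!: continuous_on_rabs\<close>)
next
  case False
  then show ?thesis using r le[of r] by (cases "t = 0") auto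
qed

text \<open>A left Riemann sum of an increasing function lies below its integral. The factor
  \<open>1 / l\<close> is what a large \<open>l\<close> gains in the Gronwall iteration.\<close>

lemma sum_exp_grid_le:
  assumes t: "0 < t" and l: "0 < l"
  shows "(\<Sum>i<Suc n. exp (l * grid t n i) * (t / real (Suc n))) \<le> exp (l * t) / l"
proof -
  have "(\<Sum>i<Suc n. exp (l * grid t n i) * (t / real (Suc n))) \<le>
      (\<Sum>i<Suc n. exp (l * grid t n (Suc i)) / l - exp (l * grid t n i) / l)"
  proof (rule sum_mono)
    fix i
    define d where "d = t / real (Suc n)"
    have "grid t n (Suc i) = grid t n i + d" using grid_diff[of t n i] by (simp add: d_def)
    then have "exp (l * grid t n (Suc i)) = exp (l * grid t n i) * exp (l * d)"
      by (simp add: distrib_left exp_add)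
    also have "\<dots> \<ge> exp (l * grid t n i) * (1 + l * d)"
      by (intro mult_left_mono exp_ge_add_one_self) simp
    finally have "exp (l * grid t n i) * (l * d) \<le> exp (l * grid t n (Suc i)) - exp (l * grid t n i)"
      by (simp add: algebra_simps)
    then have "exp (l * grid t n i) * d \<le> (exp (l * grid t n (Suc i)) - exp (l * grid t n i)) / l"
      using l by (simp add: pos_le_divide_eq algebra_simps)
    then show "exp (l * grid t n i) * (t / real (Suc n)) \<le> exp (l * grid t n (Suc i)) / l - exp (l * grid t n i) / l"
      by (simp add: d_def diff_divide_distrib)
  qed
  also have "\<dots> = exp (l * t) / l - 1 / l"
    using sum_lessThan_telescope[of "\<lambda>i. exp (l * grid t n i) / l" "Suc n"] by simp
  also have "\<dots> \<le> exp (l * t) / l" using l by simp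
  finally show ?thesis .
qed

context brownian
begin

text \<open>
  Gronwall's argument for \<open>E[G\<^sub>t\<^sup>2]\<close>, where \<open>G\<close> is \<open>X\<close> set to zero once \<open>\<bar>X\<bar>\<close> has exceeded \<open>K\<close>: this
  localises without stopping times, since \<open>G\<^sub>t \<noteq> 0\<close> forces \<open>G = X\<close> on the whole of \<open>[0, t]\<close>.
  Besides the current time only rational ones enter the definition of \<open>G\<close>, so that it is adapted.
\<close>

lemma linear_grid_unique:
  fixes X :: "real \<Rightarrow> 'w \<Rightarrow> real"
  assumes ad: "adapted F X" and cont: "continuous_paths M X" and X0: "AE \<omega> in M. X 0 \<omega> = 0"
    and lim: "\<And>t. 0 < t \<Longrightarrow> tendsto_prob M (\<lambda>n \<omega>. \<Sum>i<Suc n. X (grid t n i) \<omega> *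
      (\<alpha> * (t / real (Suc n)) + \<epsilon> * (B (grid t n (Suc i)) \<omega> - B (grid t n i) \<omega>))) (X t)"
    and T: "0 \<le> T"
  shows "AE \<omega> in M. X T \<omega> = 0"
proof -
  have XF: "X s \<in> borel_measurable (F s)" if "0 \<le> s" for s
    using ad that by (simp add: adapted_def)
  have cont': "AE \<omega> in M. \<forall>t. continuous_on {0..t} (\<lambda>s. X s \<omega>)"
    using cont unfolding continuous_paths_def
    by eventually_elim (auto intro: continuous_on_subset)
  \<comment> \<open>Including the current time makes \<open>\<bar>G\<bar> \<le> K\<close> true at
    every point of the space, also on the null set of discontinuous paths.\<close>
  define N where "N = (\<lambda>(K::real) s \<omega>. \<forall>r\<in>insert s ({0..s} \<inter> \<rat>). \<bar>X r \<omega>\<bar> \<le> K)"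
  define G where "G = (\<lambda>K s \<omega>. if N K s \<omega> then X s \<omega> else 0)"
  have Nm: "Measurable.pred (F s) (N K s)" if s: "0 \<le> s" for K s
  proof -
    let ?I = "insert s ({0..s} \<inter> \<rat>)"
    have "{\<omega>\<in>space (F s). N K s \<omega>} = (\<Inter>r\<in>?I. {\<omega>\<in>space (F s). \<bar>X r \<omega>\<bar> \<le> K})"
      by (auto simp: N_def)
    also have "\<dots> \<in> sets (F s)"
    proof (rule sets.countable_INT')
      show "countable ?I"
        by (intro countable_insert countable_Int2 countable_rat)
      have "{\<omega>\<in>space (F s). \<bar>X r \<omega>\<bar> \<le> K} \<in> sets (F s)" if "r \<in> ?I" for r
      proof -
        have "0 \<le> r" "r \<le> s" using s that by auto
        then have [measurable]: "X r \<in> borel_measurable (F s)"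
          by (intro measurable_F_mono[OF XF])
        show ?thesis by measurable
      qed
      then show "(\<lambda>r. {\<omega>\<in>space (F s). \<bar>X r \<omega>\<bar> \<le> K}) ` ?I \<subseteq> sets (F s)" by blast
    qed simp
    finally show ?thesis by (simp add: pred_def)
  qed
  have GF: "G K s \<in> borel_measurable (F s)" if s: "0 \<le> s" for K s
  proof -
    note [measurable] = Nm[OF s, of K] XF[OF s]
    show ?thesis unfolding G_def by measurable
  qed
  note Gm = measurable_F_M[OF GF]
  have NM: "Measurable.pred M (N K s)" if s: "0 \<le> s" for K s
    using Nm[OF s] sets_F_subset[of s] by (auto simp: pred_def)
  have Gb: "\<bar>G K s \<omega>\<bar> \<le> K" if "0 \<le> K" for K s \<omega>
    using that by (simp add: G_def N_def)
  have Gb2: "(G K s \<omega>)\<^sup>2 \<le> K\<^sup>2" if "0 \<le> K" for K s \<omega>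
    using power_mono[OF Gb[OF that], of s \<omega> 2] by simp
  \<comment> \<open>Along a continuous path the bound at rational times extends to all of
    \<open>{0..t}\<close>, so no earlier value has been cut off either.\<close>
  have G_eq: "G K r \<omega> = X r \<omega>" if c: "continuous_on {0..t} (\<lambda>s. X s \<omega>)" and N: "N K t \<omega>" and r: "r \<in> {0..t}" for K r t \<omega>
  proof -
    have "\<bar>X q \<omega>\<bar> \<le> K" if q: "q \<in> {0..t}" for q
      by (rule bounded_on_rats_imp_bounded[OF c _ q]) (use N in \<open>auto simp: N_def\<close>)
    then show ?thesis using r by (auto simp: G_def N_def)
  qed
  have G2: "integrable M (\<lambda>\<omega>. (G K s \<omega>)\<^sup>2)" if "0 \<le> K" "0 \<le> s" for K s
    by (rule integrable_const_bound[where B="K\<^sup>2"])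
      (use Gb2[OF that(1)] Gm[OF that(2)] in auto)
  define g where "g = (\<lambda>K s. expectation (\<lambda>\<omega>. (G K s \<omega>)\<^sup>2))"
  have g_K: "g K s \<le> K\<^sup>2" if "0 \<le> K" "0 \<le> s" for K s
  proof -
    have "g K s \<le> expectation (\<lambda>\<omega>. K\<^sup>2)"
      unfolding g_def using Gb2[OF that(1)] G2[OF that] by (intro integral_mono) auto
    then show ?thesis by (simp add: prob_space)
  qed
  have g_0: "g K 0 = 0" for K
  proof -
    have "AE \<omega> in M. (G K 0 \<omega>)\<^sup>2 = 0" using X0 by eventually_elim (simp add: G_def)
    then have "g K 0 = expectation (\<lambda>\<omega>. 0)"
      unfolding g_def using Gm[of 0 K] by (intro integral_cong_AE) auto
    then show ?thesis by simp
  qed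
  \<comment> \<open>The 4 is a product of two factors 2: one from squaring drift plus noise, one
    from \<open>expectation_power2_le_of_tendsto_prob\<close>.\<close>
  have gronwall: "g K t \<le> 4 * (\<alpha>\<^sup>2 * t + \<epsilon>\<^sup>2) * (A * exp (l * t) / l)"
    if K: "0 \<le> K" and t: "0 < t" and A: "0 \<le> A" and l: "0 < l" and le: "\<And>s. 0 \<le> s \<Longrightarrow> s \<le> t \<Longrightarrow> g K s \<le> A * exp (l * s)" for K t A l
  proof -
    have t0: "0 \<le> t" using t by simp
    let ?d = "\<lambda>n. t / real (Suc n)"
    let ?Z = "\<lambda>n i \<omega>. B (grid t n (Suc i)) \<omega> - B (grid t n i) \<omega>"
    let ?G = "\<lambda>n i \<omega>. G K (grid t n i) \<omega>"
    \<comment> \<open>The grid sum of the adapted and bounded \<open>G\<close> is accessible to the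
      isometry. On the event \<open>N K t\<close> it agrees, for continuous paths, with the grid sum
      of \<open>X\<close>; off this event both \<open>R\<close> and \<open>G\<close> at time
      \<open>t\<close> vanish. So \<open>R\<close> is no further from \<open>G\<close> than the grid
      sum of \<open>X\<close> is from \<open>X\<close>.\<close>
    define L where "L = (\<lambda>n \<omega>. \<Sum>i<Suc n. ?G n i \<omega> * (\<alpha> * ?d n + \<epsilon> * ?Z n i \<omega>))"
    define R where "R = (\<lambda>n \<omega>. if N K t \<omega> then L n \<omega> else 0)"
    define V where "V = (\<lambda>n \<omega>. \<Sum>i<Suc n. ?G n i \<omega>)"
    define W where "W = (\<lambda>n \<omega>. \<Sum>i<Suc n. ?G n i \<omega> * ?Z n i \<omega>)"
    note g0 = grid_nonneg[OF t0]
    note [measurable] = Gm[OF g0] Gm[OF t0] NM[OF t0, of K] measurable_F_M[OF XF[OF g0]] measurable_F_M[OF XF[OF t0]]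
    have [measurable]: "?Z n i \<in> borel_measurable M" for n i
      by (intro borel_measurable_diff B_measurable g0)
    have [measurable]: "L n \<in> borel_measurable M" "V n \<in> borel_measurable M" "W n \<in> borel_measurable M" for n
      unfolding L_def V_def W_def by measurable
    have [measurable]: "R n \<in> borel_measurable M" for n
      unfolding R_def by measurable
    have L_eq: "L n \<omega> = \<alpha> * ?d n * V n \<omega> + \<epsilon> * W n \<omega>" for n \<omega>
      unfolding L_def V_def W_def sum_distrib_left sum.distrib[symmetric]
      by (intro sum.cong refl) (simp add: algebra_simps)
    define h where "h = (\<lambda>n. \<Sum>i<Suc n. g K (grid t n i) * ?d n)"
    have W2: "integrable M (\<lambda>\<omega>. (W n \<omega>)\<^sup>2)" "expectation (\<lambda>\<omega>. (W n \<omega>)\<^sup>2) = h n" for n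
      using sum_increments_isometry[of "grid t n" "Suc n" "?G n" "\<lambda>_ x. x", OF _ grid_less[OF t] GF[OF g0] _ G2[OF K g0]]
        increment_moments[OF g0 grid_less[OF t]]
      unfolding W_def h_def g_def grid_diff by auto
    have V_pt: "(V n \<omega>)\<^sup>2 \<le> real (Suc n) * (\<Sum>i<Suc n. (?G n i \<omega>)\<^sup>2)" for n \<omega>
      unfolding V_def using sum_squared_le_sum_of_squares[of "\<lambda>i. ?G n i \<omega>" "{..<Suc n}"] by (simp add: mult.commute)
    have L2_le: "(L n \<omega>)\<^sup>2 \<le> 2 * \<alpha>\<^sup>2 * t * (\<Sum>i<Suc n. (?G n i \<omega>)\<^sup>2 * ?d n) + 2 * \<epsilon>\<^sup>2 * (W n \<omega>)\<^sup>2" for n \<omega>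
    proof -
      have "(L n \<omega>)\<^sup>2 \<le> 2 * (\<alpha> * ?d n * V n \<omega>)\<^sup>2 + 2 * (\<epsilon> * W n \<omega>)\<^sup>2"
        unfolding L_eq using sum_squares_bound[of "\<alpha> * ?d n * V n \<omega>" "\<epsilon> * W n \<omega>"] by (simp add: power2_sum)
      also have "(\<alpha> * ?d n * V n \<omega>)\<^sup>2 \<le> (\<alpha> * ?d n)\<^sup>2 * (real (Suc n) * (\<Sum>i<Suc n. (?G n i \<omega>)\<^sup>2))"
        unfolding power_mult_distrib[of "\<alpha> * ?d n"] using V_pt by (intro mult_left_mono) auto
      also have "\<dots> = \<alpha>\<^sup>2 * (real (Suc n) * (?d n)\<^sup>2) * (\<Sum>i<Suc n. (?G n i \<omega>)\<^sup>2)"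
        by (simp only: power_mult_distrib mult.assoc mult.left_commute)
      also have "real (Suc n) * (?d n)\<^sup>2 = t * ?d n" by (simp add: power2_eq_square del: of_nat_Suc)
      also have "\<alpha>\<^sup>2 * (t * ?d n) * (\<Sum>i<Suc n. (?G n i \<omega>)\<^sup>2) = \<alpha>\<^sup>2 * t * (\<Sum>i<Suc n. (?G n i \<omega>)\<^sup>2 * ?d n)"
        unfolding sum_distrib_right[symmetric] by simp
      finally show ?thesis by (simp add: power_mult_distrib mult.assoc del: sum.lessThan_Suc)
    qed
    have bi: "integrable M (\<lambda>\<omega>. 2 * \<alpha>\<^sup>2 * t * (\<Sum>i<Suc n. (?G n i \<omega>)\<^sup>2 * ?d n) + 2 * \<epsilon>\<^sup>2 * (W n \<omega>)\<^sup>2)" for n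
      using W2(1) G2[OF K g0] by (intro Bochner_Integration.integrable_add integrable_mult_right Bochner_Integration.integrable_sum integrable_mult_left) auto
    have L2: "integrable M (\<lambda>\<omega>. (L n \<omega>)\<^sup>2)" for n
    proof (rule Bochner_Integration.integrable_bound[OF bi[of n]])
      show "AE \<omega> in M. norm ((L n \<omega>)\<^sup>2) \<le> norm (2 * \<alpha>\<^sup>2 * t * (\<Sum>i<Suc n. (?G n i \<omega>)\<^sup>2 * ?d n) + 2 * \<epsilon>\<^sup>2 * (W n \<omega>)\<^sup>2)"
        by (intro AE_I2) (simp only: real_norm_def abs_power2 order_trans[OF L2_le abs_ge_self])
    qed measurable
    have R2_pt: "(R n \<omega>)\<^sup>2 \<le> (L n \<omega>)\<^sup>2" for n \<omega> by (simp add: R_def)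
    have R2: "integrable M (\<lambda>\<omega>. (R n \<omega>)\<^sup>2)" for n
      by (rule Bochner_Integration.integrable_bound[OF L2[of n]]) (auto intro!: AE_I2 R2_pt)
    have h_le: "h n \<le> A * exp (l * t) / l" for n
    proof -
      have "h n \<le> (\<Sum>i<Suc n. A * (exp (l * grid t n i) * ?d n))"
        unfolding h_def mult.assoc[symmetric] using le[OF g0] grid_le[OF t0, of _ n] t
        by (intro sum_mono mult_right_mono) auto
      also have "\<dots> = A * (\<Sum>i<Suc n. exp (l * grid t n i) * ?d n)"
        by (simp only: sum_distrib_left)
      also have "\<dots> \<le> A * (exp (l * t) / l)"
        using sum_exp_grid_le[OF t l] A by (rule mult_left_mono)
      finally show ?thesis by simp
    qed
    have R_le: "expectation (\<lambda>\<omega>. (R n \<omega>)\<^sup>2) \<le> 2 * (\<alpha>\<^sup>2 * t + \<epsilon>\<^sup>2) * (A * exp (l * t) / l)" for n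
    proof -
      have "expectation (\<lambda>\<omega>. (R n \<omega>)\<^sup>2) \<le> expectation (\<lambda>\<omega>. (L n \<omega>)\<^sup>2)"
        using R2 L2 R2_pt by (intro integral_mono) auto
      also have "\<dots> \<le> expectation (\<lambda>\<omega>. 2 * \<alpha>\<^sup>2 * t * (\<Sum>i<Suc n. (?G n i \<omega>)\<^sup>2 * ?d n) + 2 * \<epsilon>\<^sup>2 * (W n \<omega>)\<^sup>2)"
        using L2 bi L2_le by (intro integral_mono) auto
      also have "\<dots> = 2 * \<alpha>\<^sup>2 * t * h n + 2 * \<epsilon>\<^sup>2 * h n"
        using W2(1) G2[OF K g0] unfolding W2(2)[symmetric] by (simp add: h_def g_def W2(2) del: sum.lessThan_Suc)
      also have "\<dots> = 2 * (\<alpha>\<^sup>2 * t + \<epsilon>\<^sup>2) * h n" by (simp add: algebra_simps)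
      also have "\<dots> \<le> 2 * (\<alpha>\<^sup>2 * t + \<epsilon>\<^sup>2) * (A * exp (l * t) / l)"
        using h_le t by (intro mult_left_mono) auto
      finally show ?thesis .
    qed
    have "tendsto_prob M R (G K t)"
    proof (rule tendsto_prob_mono_AE[OF _ _ _ _ _ lim[OF t]])
      show "AE \<omega> in M. \<forall>n. \<bar>R n \<omega> - G K t \<omega>\<bar> \<le> \<bar>(\<Sum>i<Suc n. X (grid t n i) \<omega> * (\<alpha> * ?d n + \<epsilon> * ?Z n i \<omega>)) - X t \<omega>\<bar>"
        using cont'
      proof (eventually_elim, intro allI)
        fix n \<omega> assume c: "\<forall>t. continuous_on {0..t} (\<lambda>s. X s \<omega>)"
        show "\<bar>R n \<omega> - G K t \<omega>\<bar> \<le> \<bar>(\<Sum>i<Suc n. X (grid t n i) \<omega> * (\<alpha> * ?d n + \<epsilon> * ?Z n i \<omega>)) - X t \<omega>\<bar>"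
        proof (cases "N K t \<omega>")
          case True
          have "L n \<omega> = (\<Sum>i<Suc n. X (grid t n i) \<omega> * (\<alpha> * ?d n + \<epsilon> * ?Z n i \<omega>))"
            unfolding L_def using G_eq[OF spec[OF c] True] g0 grid_le[OF t0, of _ n]
            by (intro sum.cong refl) auto
          then show ?thesis using True by (simp add: R_def G_def)
        qed (simp add: R_def G_def)
      qed
    qed measurable
    from expectation_power2_le_of_tendsto_prob[OF _ _ this Gb[OF K] R2 R_le]
    show ?thesis unfolding g_def by (simp add: algebra_simps)
  qed
  \<comment> \<open>Makes the Gronwall constant
    \<open>4 (\<alpha>\<^sup>2 T + \<epsilon>\<^sup>2) / l\<close> at most 1/2; the added 1 keeps
    \<open>l\<close> positive even if both coefficients vanish.\<close>
  define l where "l = 8 * (\<alpha>\<^sup>2 * T + \<epsilon>\<^sup>2) + 1"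
  have l: "0 < l" using T by (simp add: l_def add_nonneg_pos)
  \<comment> \<open>Measured against the weight \<open>exp (l * s)\<close>, each pass halves the
    bound, starting from the trivial \<open>K\<^sup>2\<close>.\<close>
  have iter: "g K s \<le> K\<^sup>2 / 2 ^ n * exp (l * s)" if K: "0 \<le> K" and "0 \<le> s" "s \<le> T" for K n s
    using that(2,3)
  proof (induction n arbitrary: s)
    case 0
    have "K\<^sup>2 * 1 \<le> K\<^sup>2 * exp (l * s)" using l 0 by (intro mult_left_mono) auto
    then show ?case using g_K[OF K 0(1)] by simp
  next
    case (Suc n)
    show ?case
    proof (cases "s = 0")
      case False
      then have s: "0 < s" using Suc by simp
      have "g K s \<le> 4 * (\<alpha>\<^sup>2 * s + \<epsilon>\<^sup>2) * (K\<^sup>2 / 2 ^ n * exp (l * s) / l)"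
        by (rule gronwall[OF K s _ l]) (use Suc in auto)
      also have "\<dots> \<le> 4 * (\<alpha>\<^sup>2 * T + \<epsilon>\<^sup>2) * (K\<^sup>2 / 2 ^ n * exp (l * s) / l)"
        using Suc l by (intro mult_right_mono mult_left_mono add_right_mono) auto
      also have "\<dots> \<le> (l / 2) * (K\<^sup>2 / 2 ^ n * exp (l * s) / l)"
        using l by (intro mult_right_mono) (auto simp: l_def)
      also have "\<dots> = K\<^sup>2 / 2 ^ Suc n * exp (l * s)" using l by simp
      finally show ?thesis .
    qed (simp add: g_0)
  qed
  have "AE \<omega> in M. G (real k) T \<omega> = 0" for k
  proof -
    have "(\<lambda>n. (real k)\<^sup>2 * exp (l * T) * inverse (2 ^ n)) \<longlonglongrightarrow> (real k)\<^sup>2 * exp (l * T) * 0"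
      by (intro tendsto_mult_left LIMSEQ_inverse_realpow_zero) simp
    from tendsto_lowerbound[OF this, of "g (real k) T"] iter[of "real k" T] T
    have "g (real k) T \<le> 0" by (simp add: field_simps)
    moreover have "0 \<le> g (real k) T" unfolding g_def by (intro Bochner_Integration.integral_nonneg) simp
    ultimately have "g (real k) T = 0" by (rule order_antisym)
    then have "expectation (\<lambda>\<omega>. (G (real k) T \<omega>)\<^sup>2) = 0" by (simp only: g_def)
    then have "AE \<omega> in M. (G (real k) T \<omega>)\<^sup>2 = 0"
      using G2[of "real k" T] T by (subst (asm) integral_nonneg_eq_0_iff_AE) auto
    then show ?thesis by simp
  qed
  then have "AE \<omega> in M. \<forall>k. G (real k) T \<omega> = 0" by (simp add: AE_all_countable)
  then show ?thesis using cont'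
  proof eventually_elim
    case (elim \<omega>)
    \<comment> \<open>A continuous path is bounded on \<open>{0..T}\<close>, so some integer level
      leaves it untouched; countably many levels therefore suffice.\<close>
    have "compact ((\<lambda>s. X s \<omega>) ` {0..T})"
      using elim(2) by (intro compact_continuous_image) auto
    then obtain b where b: "\<And>s. s \<in> {0..T} \<Longrightarrow> \<bar>X s \<omega>\<bar> \<le> b"
      using compact_imp_bounded by (fastforce simp: bounded_real)
    obtain k :: nat where "b \<le> real k" using real_arch_simple by blast
    then have "N (real k) T \<omega>" using b T by (fastforce simp: N_def)
    then show ?case using elim(1) by (auto simp: G_def split: if_splits)
  qed
qed

lemma continuous_paths_B: "continuous_paths M B"
  using bm by (simp add: brownian_motion_def)

text \<open>Both processes satisfy the same linear grid relation, so their difference satisfies it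
  with initial value zero.\<close>

lemma ito_process_linear_eq_gbm:
  assumes X: "ito_process M F B X (\<lambda>s \<omega>. \<alpha> * X s \<omega>) (\<lambda>s \<omega>. \<epsilon> * X s \<omega>)"
    and X0: "AE \<omega> in M. X 0 \<omega> = u" and T: "0 \<le> T"
  shows "AE \<omega> in M. X T \<omega> = gbm u \<alpha> \<epsilon> T \<omega>"
proof -
  let ?S = "gbm u \<alpha> \<epsilon>"
  let ?D = "\<lambda>s \<omega>. X s \<omega> - ?S s \<omega>"
  have ad: "adapted F X" and cont: "continuous_paths M X" using X by (simp_all add: ito_process_def)
  have XF: "X s \<in> borel_measurable (F s)" if "0 \<le> s" for s
    using ad that by (simp add: adapted_def)
  have DF: "?D s \<in> borel_measurable (F s)" if "0 \<le> s" for s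
    by (intro borel_measurable_diff XF gbm_measurable_F that)
  have D0: "AE \<omega> in M. ?D 0 \<omega> = 0"
    using X0 gbm_0[of u \<alpha> \<epsilon>] by eventually_elim simp
  have "AE \<omega> in M. ?D T \<omega> = 0"
  proof (rule linear_grid_unique[where X="?D" and \<alpha>=\<alpha> and \<epsilon>=\<epsilon>, OF _ _ D0 _ T])
    show "adapted F ?D" using DF by (simp add: adapted_def)
    show "continuous_paths M ?D"
      using cont continuous_paths_B unfolding continuous_paths_def gbm_def
      by eventually_elim (intro continuous_intros)
    fix t :: real assume t: "0 < t"
    then have t0: "0 \<le> t" by simp
    note g0 = grid_nonneg[OF t0]
    let ?dB = "\<lambda>n i \<omega>. \<alpha> * (t / real (Suc n)) + \<epsilon> * (B (grid t n (Suc i)) \<omega> - B (grid t n i) \<omega>)"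
    have dBm: "?dB n i \<in> borel_measurable M" for n i
      by (intro borel_measurable_add borel_measurable_times borel_measurable_diff borel_measurable_const B_measurable g0)
    note Xm = measurable_F_M[OF XF] and Sm = measurable_F_M[OF gbm_measurable_F]
    have "tendsto_prob M (\<lambda>n \<omega>. (\<Sum>i<Suc n. X (grid t n i) \<omega> * ?dB n i \<omega>) - (\<Sum>i<Suc n. ?S (grid t n i) \<omega> * ?dB n i \<omega>))
      (\<lambda>\<omega>. (X t \<omega> - X 0 \<omega>) - (?S t \<omega> - ?S 0 \<omega>))"
      by (rule tendsto_prob_diff[OF _ _ _ _ ito_process_linear_grid[OF t X] gbm_grid[OF t]];
          intro borel_measurable_sum borel_measurable_times borel_measurable_diff dBm Xm Sm g0 t0 order_refl)
    then have lim: "tendsto_prob M (\<lambda>n \<omega>. \<Sum>i<Suc n. ?D (grid t n i) \<omega> * ?dB n i \<omega>) (\<lambda>\<omega>. ?D t \<omega> - ?D 0 \<omega>)"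
      unfolding sum_subtractf[symmetric] left_diff_distrib[symmetric] by (simp add: algebra_simps del: sum.lessThan_Suc)
    \<comment> \<open>The initial difference vanishes only almost surely, so it is dropped by an
      almost sure comparison.\<close>
    show "tendsto_prob M (\<lambda>n \<omega>. \<Sum>i<Suc n. ?D (grid t n i) \<omega> * ?dB n i \<omega>) (?D t)"
      by (rule tendsto_prob_mono_AE[OF _ _ _ _ _ lim];
        (intro borel_measurable_sum borel_measurable_times borel_measurable_diff dBm Xm Sm g0 t0 order_refl)?)
        (use D0 in eventually_elim, simp)
  qed
  then show ?thesis by simp
qed

end

section \<open>The Fokker--Planck equation\<close>

text \<open>The starting value is almost surely \<open>u\<close>, so the conditioning event has full
  probability and conditioning on it changes nothing.\<close>

lemma (in prob_space) uniform_measure_prob_1: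
  assumes A: "A \<in> events" "AE \<omega> in M. \<omega> \<in> A"
  shows "uniform_measure M A = M"
proof (rule measure_eqI)
  have A1: "emeasure M A = 1" using emeasure_eq_1_AE[OF A] .
  fix C assume "C \<in> sets (uniform_measure M A)"
  then have C: "C \<in> events" by simp
  have "emeasure M (A \<inter> C) = emeasure M C"
    by (rule emeasure_eq_AE) (use A C in auto)
  then show "emeasure (uniform_measure M A) C = emeasure M C"
    using A1 A C by (simp add: divide_ennreal_def)
qed simp

text \<open>Translation by \<open>a\<close> turns the integral into a convolution of two centred
  Gaussians at \<open>m - a\<close>, where the variances add.\<close>

lemma integral_normal_density_mult:
  assumes [simp, arith]: "0 < \<sigma>" "0 < \<tau>"
  shows "(\<integral>y. normal_density a \<tau> y * normal_density m \<sigma> y \<partial>lborel) = normal_density m (sqrt (\<sigma>\<^sup>2 + \<tau>\<^sup>2)) a"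
proof -
  have "(\<integral>y. normal_density a \<tau> y * normal_density m \<sigma> y \<partial>lborel)
      = (\<integral>y. normal_density a \<tau> (a + 1 * y) * normal_density m \<sigma> (a + 1 * y) \<partial>lborel)"
    by (subst lborel_integral_real_affine[where c=1 and t=a]) simp_all
  also have "\<dots> = (\<integral>y. normal_density 0 \<sigma> ((m - a) - y) * normal_density 0 \<tau> y \<partial>lborel)"
  proof (intro Bochner_Integration.integral_cong refl)
    fix y
    have "(a + y - m)\<^sup>2 = (m - a - y)\<^sup>2" by (simp add: power2_eq_square algebra_simps)
    then show "normal_density a \<tau> (a + 1 * y) * normal_density m \<sigma> (a + 1 * y) =
        normal_density 0 \<sigma> ((m - a) - y) * normal_density 0 \<tau> y"
      by (simp add: normal_density_def mult.commute)
  qed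
  also have "\<dots> = enn2real (\<integral>\<^sup>+y. ennreal (normal_density 0 \<sigma> ((m - a) - y) * normal_density 0 \<tau> y) \<partial>lborel)"
    by (intro integral_eq_nn_integral) auto
  also have "\<dots> = normal_density 0 (sqrt (\<sigma>\<^sup>2 + \<tau>\<^sup>2)) (m - a)"
    using fun_cong[OF conv_normal_density_zero_mean[of \<sigma> \<tau>], of "m - a"] by simp
  also have "\<dots> = normal_density m (sqrt (\<sigma>\<^sup>2 + \<tau>\<^sup>2)) a"
    by (simp add: normal_density_def power2_commute[of m a])
  finally show ?thesis .
qed

section \<open>The log-normal density and its derivatives\<close>

lemma DERIV_ln_abs:
  fixes u :: real
  assumes "u \<noteq> 0"
  shows "((\<lambda>v. ln \<bar>v\<bar>) has_real_derivative 1 / u) (at u)"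
proof (cases "0 < u")
  case True
  have "((\<lambda>v. ln v) has_real_derivative 1 / u) (at u)"
    using DERIV_ln_divide[OF True] .
  then show ?thesis
    by (rule has_field_derivative_transform_within_open[where S="{0<..}"]) (use True in auto)
next
  case False
  then have "0 < - u" using assms by simp
  then have "((\<lambda>v. ln (- v)) has_real_derivative 1 / u) (at u)"
    using DERIV_ln[of "- u"] DERIV_mirror[where f=ln and x=u and y="inverse (- u)"] by (simp add: inverse_eq_divide)
  then show ?thesis
    by (rule has_field_derivative_transform_within_open[where S="{..<0}"]) (use False assms in auto)
qed

text \<open>The log-normal density in \<open>\<bar>u\<bar>\<close> with the square root and
  \<open>1 / \<bar>u\<bar>\<close> moved into the exponent, so that every derivative is the density
  times a logarithmic derivative.\<close>

definition log_normal_form :: "real \<Rightarrow> real \<Rightarrow> real \<Rightarrow> real" where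
  "log_normal_form m n u = exp (- ln (2 * pi * n) / 2 - ln \<bar>u\<bar> - (ln \<bar>u\<bar> - m)\<^sup>2 / (2 * n))"

lemma fp_density_eq_log_normal_form:
  assumes "u \<noteq> 0" "0 < nu N U0 e t"
  shows "fp_density N U0 b e m u t x = log_normal_form (mu N U0 b m t x) (nu N U0 e t) u"
proof -
  have "exp (- ln (2 * pi * nu N U0 e t) / 2) = 1 / sqrt (2 * pi * nu N U0 e t)"
    using assms by (simp add: exp_minus ln_sqrt[symmetric] inverse_eq_divide)
  then show ?thesis
    using assms by (simp add: fp_density_def log_normal_form_def exp_diff exp_minus inverse_eq_divide)
qed

lemma log_normal_form_eq_normal_density:
  assumes "0 < n"
  shows "log_normal_form m n u = exp (- ln \<bar>u\<bar>) * normal_density m (sqrt n) (ln \<bar>u\<bar>)"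
proof -
  have "exp (- ln (2 * pi * n) / 2) = 1 / sqrt (2 * pi * n)"
    using assms by (simp add: exp_minus ln_sqrt[symmetric] inverse_eq_divide)
  then show ?thesis
    using assms by (simp add: normal_density_def log_normal_form_def exp_diff exp_minus inverse_eq_divide)
qed

lemma log_normal_form_deriv_u:
  fixes u m n :: real
  assumes u: "u \<noteq> 0" and n: "0 < n"
  shows "((\<lambda>v. log_normal_form m n v) has_real_derivative
    - (1 + (ln \<bar>u\<bar> - m) / n) / u * log_normal_form m n u) (at u)"
proof -
  let ?k = "- ln (2 * pi * n) / 2"
  note L = DERIV_ln_abs[OF u]
  have 1: "((\<lambda>v. (ln \<bar>v\<bar> - m)\<^sup>2) has_real_derivative 2 * ((ln \<bar>u\<bar> - m) / u)) (at u)"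
    by (rule DERIV_cong[OF DERIV_power[OF DERIV_diff[OF L DERIV_const[of m]], of 2]]) simp
  have "((\<lambda>v. ?k - ln \<bar>v\<bar> - (ln \<bar>v\<bar> - m)\<^sup>2 / (2 * n)) has_real_derivative - (1 + (ln \<bar>u\<bar> - m) / n) / u) (at u)"
  proof (rule DERIV_cong[OF DERIV_diff[OF DERIV_diff[OF DERIV_const L] DERIV_cdivide[OF 1]]])
    show "0 - 1 / u - 2 * ((ln \<bar>u\<bar> - m) / u) / (2 * n) = - (1 + (ln \<bar>u\<bar> - m) / n) / u"
      by argo
  qed
  from DERIV_chain2[where g="\<lambda>v. ?k - ln \<bar>v\<bar> - (ln \<bar>v\<bar> - m)\<^sup>2 / (2 * n)", OF DERIV_exp this]
  show ?thesis unfolding log_normal_form_def by (rule DERIV_cong) (rule mult.commute)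
qed

text \<open>The logarithmic derivative is \<open>- (1 + w) / u\<close>; its square and its own
  derivative \<open>(1 + w - 1 / n) / u\<^sup>2\<close> add up to the coefficient.\<close>

lemma log_normal_form_deriv_uu:
  fixes u m n :: real
  assumes u: "u \<noteq> 0" and n: "0 < n"
  defines "w \<equiv> (ln \<bar>u\<bar> - m) / n"
  shows "((\<lambda>v. - (1 + (ln \<bar>v\<bar> - m) / n) / v * log_normal_form m n v) has_real_derivative
    ((1 + w)\<^sup>2 + (1 + w) - 1 / n) / u\<^sup>2 * log_normal_form m n u) (at u)"
proof -
  have 1: "((\<lambda>v. - (1 + (ln \<bar>v\<bar> - m) / n)) has_real_derivative - (0 + (1 / u - 0) / n)) (at u)"
    by (intro DERIV_minus DERIV_add DERIV_cdivide DERIV_diff DERIV_const DERIV_ln_abs[OF u])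
  show ?thesis
    by (rule DERIV_cong[OF DERIV_mult[OF DERIV_divide[OF 1 DERIV_ident u] log_normal_form_deriv_u[OF u n]]])
      (use u n in \<open>simp add: w_def field_simps power2_eq_square\<close>)
qed

text \<open>With \<open>n\<close> the variance at time \<open>t\<close>, the normalisation
  contributes \<open>- e\<^sup>2 / (2 n)\<close>, the moving mean \<open>w b\<close>, and the
  denominator of the quadratic term \<open>w\<^sup>2 e\<^sup>2 / 2\<close>.\<close>

lemma log_normal_form_deriv_t:
  fixes n0 m0 b e t u :: real
  assumes n: "0 < n0 + e\<^sup>2 * t"
  defines "w \<equiv> (ln \<bar>u\<bar> - (m0 + b * t)) / (n0 + e\<^sup>2 * t)"
  shows "((\<lambda>s. log_normal_form (m0 + b * s) (n0 + e\<^sup>2 * s) u) has_real_derivative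
    (- e\<^sup>2 / (2 * (n0 + e\<^sup>2 * t)) + w * b + w\<^sup>2 * e\<^sup>2 / 2) * log_normal_form (m0 + b * t) (n0 + e\<^sup>2 * t) u) (at t)"
proof -
  let ?l = "ln \<bar>u\<bar>"
  define N where "N = (\<lambda>s. n0 + e\<^sup>2 * s)"
  define K where "K = (\<lambda>s. ?l - (m0 + b * s))"
  have N: "(N has_real_derivative e\<^sup>2) (at t)" and K: "(K has_real_derivative - b) (at t)"
    unfolding N_def K_def by (auto intro!: derivative_eq_intros)
  have Nt: "0 < N t" using n by (simp add: N_def)
  have 1: "((\<lambda>s. - ln (2 * pi * N s) / 2) has_real_derivative - (1 / (2 * pi * N t) * (2 * pi * e\<^sup>2)) / 2) (at t)"
    using Nt by (intro DERIV_cdivide DERIV_minus DERIV_chain2[OF DERIV_ln_divide] DERIV_cmult N) simp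
  have 2: "((\<lambda>s. (K s)\<^sup>2) has_real_derivative 2 * (K t * - b)) (at t)"
    by (rule DERIV_cong[OF DERIV_power[OF K, of 2]]) simp
  have w: "w = K t / N t" by (simp add: w_def K_def N_def)
  have 3: "((\<lambda>s. (K s)\<^sup>2 / (2 * N s)) has_real_derivative - (w * b + w\<^sup>2 * e\<^sup>2 / 2)) (at t)"
  proof (rule DERIV_cong[OF DERIV_divide[OF 2 DERIV_cmult[OF N, of 2]]])
    show "2 * N t \<noteq> 0" using Nt by simp
    have "K t = w * N t" using w Nt by simp
    then show "(2 * (K t * - b) * (2 * N t) - (K t)\<^sup>2 * (2 * e\<^sup>2)) / (2 * N t * (2 * N t)) = - (w * b + w\<^sup>2 * e\<^sup>2 / 2)"
      using Nt by (simp add: power2_eq_square add_divide_distrib diff_divide_distrib)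
  qed
  have "((\<lambda>s. exp (- ln (2 * pi * N s) / 2 - ?l - (K s)\<^sup>2 / (2 * N s))) has_real_derivative
    (- e\<^sup>2 / (2 * N t) + w * b + w\<^sup>2 * e\<^sup>2 / 2) * exp (- ln (2 * pi * N t) / 2 - ?l - (K t)\<^sup>2 / (2 * N t))) (at t)"
  proof (rule DERIV_cong[OF DERIV_chain2[OF DERIV_exp DERIV_diff[OF DERIV_diff[OF 1 DERIV_const] 3]]])
    have "1 / (2 * pi * N t) * (2 * pi * e\<^sup>2) = e\<^sup>2 / N t" using Nt by simp
    then show "exp (- ln (2 * pi * N t) / 2 - ?l - (K t)\<^sup>2 / (2 * N t)) *
        (- (1 / (2 * pi * N t) * (2 * pi * e\<^sup>2)) / 2 - 0 - - (w * b + w\<^sup>2 * e\<^sup>2 / 2)) =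
      (- e\<^sup>2 / (2 * N t) + w * b + w\<^sup>2 * e\<^sup>2 / 2) * exp (- ln (2 * pi * N t) / 2 - ?l - (K t)\<^sup>2 / (2 * N t))"
      by (simp only:) (simp add: mult.commute add_ac)
  qed
  then show ?thesis unfolding N_def K_def log_normal_form_def .
qed

lemma D_imp_nonzero: "(u, x) \<in> D m \<Longrightarrow> u \<noteq> 0"
  by (auto simp: D_def D1_def D2_def)

lemma log_normal_variance_pos:
  assumes "log_normal N Y"
  shows "0 < prob_space.variance N (\<lambda>\<omega>. ln (Y \<omega>))"
proof -
  from assms obtain \<mu> \<sigma> where "prob_space N" "0 < \<sigma>"
    and D: "distributed N lborel (\<lambda>\<omega>. ln (Y \<omega>)) (normal_density \<mu> \<sigma>)"
    by (auto simp: log_normal_def)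
  then show ?thesis using prob_space.normal_distributed_variance[OF _ _ D] by simp
qed

text \<open>Divided by the density, the equation is a polynomial identity in \<open>W\<close> and
  \<open>1 / n\<close>: both sides equal
  \<open>- e\<^sup>2 / (2 n) + W b + W\<^sup>2 e\<^sup>2 / 2\<close>.\<close>

lemma fp_density_solves_fokker_planck:
  assumes Y: "log_normal N U0"
  shows "solves_fokker_planck m b e (fp_density N U0 b e m) (\<lambda>u x. fp_density N U0 b e m u 0 x)"
proof -
  let ?p = "fp_density N U0 b e m"
  define n0 where "n0 = prob_space.variance N (\<lambda>\<omega>. ln (U0 \<omega>))"
  define m0 where "m0 = (\<lambda>x. prob_space.expectation N (\<lambda>\<omega>. ln (U0 \<omega>)) + ln \<bar>e_tilde m x\<bar>)"
  have n0: "0 < n0" using log_normal_variance_pos[OF Y] by (simp add: n0_def)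
  have nu: "nu N U0 e t = n0 + e\<^sup>2 * t" for t by (simp add: nu_def n0_def)
  have mu: "mu N U0 b m t x = m0 x + b * t" for t x by (simp add: mu_def m0_def)
  have n_pos: "0 < n0 + e\<^sup>2 * t" if "0 \<le> t" for t using n0 that by (simp add: add_pos_nonneg)
  define f where "f = (\<lambda>u t x. log_normal_form (m0 x + b * t) (n0 + e\<^sup>2 * t) u)"
  have p_f: "?p u t x = f u t x" if "u \<noteq> 0" "0 < n0 + e\<^sup>2 * t" for u t x
    using fp_density_eq_log_normal_form[of u N U0 e t b m x] that by (simp add: nu mu f_def)
  define w where "w = (\<lambda>u t x. (ln \<bar>u\<bar> - (m0 x + b * t)) / (n0 + e\<^sup>2 * t))"
  define p_t where "p_t = (\<lambda>u t x. (- e\<^sup>2 / (2 * (n0 + e\<^sup>2 * t)) + w u t x * b + (w u t x)\<^sup>2 * e\<^sup>2 / 2) * f u t x)"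
  define p_u where "p_u = (\<lambda>u t x. - (1 + w u t x) / u * f u t x)"
  define p_uu where "p_uu = (\<lambda>u t x. ((1 + w u t x)\<^sup>2 + (1 + w u t x) - 1 / (n0 + e\<^sup>2 * t)) / u\<^sup>2 * f u t x)"
  have dt: "((\<lambda>s. ?p u s x) has_real_derivative p_t u t x) (at t)" if u: "u \<noteq> 0" and t: "0 \<le> t" for u t x
  proof (rule has_field_derivative_transform_within_open)
    show "((\<lambda>s. f u s x) has_real_derivative p_t u t x) (at t)"
      unfolding f_def p_t_def w_def by (rule log_normal_form_deriv_t[OF n_pos[OF t]])
    \<comment> \<open>The set contains slightly negative times, where the variance is still
      positive. So the derivative exists at time 0 too, and the initial value is attained by
      continuity.\<close>
    show "open {s. 0 < n0 + e\<^sup>2 * s}" by (intro open_Collect_less continuous_intros)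
    show "f u s x = ?p u s x" if "s \<in> {s. 0 < n0 + e\<^sup>2 * s}" for s
      using p_f[OF u] that by simp
  qed (use n_pos[OF t] in simp)
  have du: "((\<lambda>v. ?p v t x) has_real_derivative p_u u t x) (at u)" if u: "u \<noteq> 0" and t: "0 \<le> t" for u t x
  proof (rule has_field_derivative_transform_within_open)
    show "((\<lambda>v. f v t x) has_real_derivative p_u u t x) (at u)"
      unfolding f_def p_u_def w_def by (rule log_normal_form_deriv_u[OF u n_pos[OF t]])
    show "open (- {0 :: real})" by (intro open_Compl) simp
    show "f v t x = ?p v t x" if "v \<in> - {0}" for v
      using p_f[OF _ n_pos[OF t]] that by simp
  qed (use u in simp)
  have duu: "((\<lambda>v. p_u v t x) has_real_derivative p_uu u t x) (at u)" if u: "u \<noteq> 0" and t: "0 \<le> t" for u t x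
    unfolding f_def p_u_def p_uu_def w_def by (rule log_normal_form_deriv_uu[OF u n_pos[OF t]])
  have pde: "p_t u t x = e\<^sup>2 / 2 * u\<^sup>2 * p_uu u t x + (3 * e\<^sup>2 / 2 - b) * u * p_u u t x + (e\<^sup>2 / 2 - b) * ?p u t x"
    if u: "u \<noteq> 0" and t: "0 \<le> t" for u t x
  proof -
    define n where "n = n0 + e\<^sup>2 * t"
    define W where "W = w u t x"
    have "e\<^sup>2 / 2 * u\<^sup>2 * p_uu u t x = e\<^sup>2 / 2 * ((1 + W)\<^sup>2 + (1 + W) - 1 / n) * f u t x"
      using u by (simp add: p_uu_def W_def n_def)
    moreover have "(3 * e\<^sup>2 / 2 - b) * u * p_u u t x = (3 * e\<^sup>2 / 2 - b) * (- ((1 + W) * f u t x))"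
    proof -
      have "u * p_u u t x = - ((1 + W) * f u t x)" using u by (simp add: p_u_def W_def) (simp add: algebra_simps)
      then show ?thesis by (simp only: mult.assoc)
    qed
    moreover have "?p u t x = f u t x" by (rule p_f[OF u n_pos[OF t]])
    moreover have "p_t u t x = (- (e\<^sup>2 / 2 * (1 / n)) + W * b + W\<^sup>2 * e\<^sup>2 / 2) * f u t x"
      by (simp add: p_t_def W_def n_def)
    ultimately show ?thesis
      by (simp add: algebra_simps power2_eq_square)
  qed
  have lim: "((\<lambda>t. ?p u t x) \<longlongrightarrow> ?p u 0 x) (at_right 0)" if u: "u \<noteq> 0" for u x
    using tendsto_mono[OF at_le[OF subset_UNIV] DERIV_isCont[OF dt[OF u order_refl], unfolded isCont_def]] .
  show ?thesis
    unfolding solves_fokker_planck_def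
  proof (rule conjI, rule exI[of _ p_t], rule exI[of _ p_u], rule exI[of _ p_uu])
    show "\<forall>(u, x)\<in>D m. \<forall>t>0.
        ((\<lambda>s. ?p u s x) has_real_derivative p_t u t x) (at t) \<and>
        ((\<lambda>v. ?p v t x) has_real_derivative p_u u t x) (at u) \<and>
        ((\<lambda>v. p_u v t x) has_real_derivative p_uu u t x) (at u) \<and>
        p_t u t x = e\<^sup>2 / 2 * u\<^sup>2 * p_uu u t x + (3 * e\<^sup>2 / 2 - b) * u * p_u u t x + (e\<^sup>2 / 2 - b) * ?p u t x"
    proof (intro ballI, unfold split_paired_all case_prod_conv, intro allI impI)
      fix u x t :: real assume "(u, x) \<in> D m" "0 < t"
      then have u: "u \<noteq> 0" and t: "0 \<le> t" using D_imp_nonzero by auto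
      show "((\<lambda>s. ?p u s x) has_real_derivative p_t u t x) (at t) \<and>
        ((\<lambda>v. ?p v t x) has_real_derivative p_u u t x) (at u) \<and>
        ((\<lambda>v. p_u v t x) has_real_derivative p_uu u t x) (at u) \<and>
        p_t u t x = e\<^sup>2 / 2 * u\<^sup>2 * p_uu u t x + (3 * e\<^sup>2 / 2 - b) * u * p_u u t x + (e\<^sup>2 / 2 - b) * ?p u t x"
        by (intro conjI dt[OF u t] du[OF u t] duu[OF u t] pde[OF u t])
    qed
    show "\<forall>(u, x)\<in>D m. ?p u 0 x = ?p u 0 x \<and> ((\<lambda>t. ?p u t x) \<longlongrightarrow> ?p u 0 x) (at_right 0)"
      using lim D_imp_nonzero by auto
  qed
qed

section \<open>The density as an expectation\<close>

lemma fp_density_measurable: "(\<lambda>u. fp_density N U0 b e m u t x) \<in> borel_measurable borel"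
  unfolding fp_density_def by measurable

text \<open>On the logarithmic scale the initial density is \<open>exp (- y)\<close> times a
  Gaussian in \<open>y\<close>, and for nonzero \<open>e\<close> the process at time
  \<open>t\<close> is Gaussian with mean \<open>a\<close> and variance \<open>e\<^sup>2 t\<close>.
  The weight shifts that mean to \<open>a - e\<^sup>2 t = ln \<bar>u\<bar> - b t\<close>, the
  convolution adds the variances to \<open>nu\<close> at time \<open>t\<close>, and the prefactor
  cancels all of the remaining exponential except \<open>- ln \<bar>u\<bar>\<close>.\<close>

lemma (in brownian) expectation_fp_density_gbm:
  assumes Y: "log_normal N U0" and u: "u \<noteq> 0" and t: "0 < t"
  shows "fp_density N U0 b e m u t x = exp ((e\<^sup>2 / 2 - b) * t) *
    expectation (\<lambda>\<omega>. fp_density N U0 b e m (gbm u (3 * e\<^sup>2 / 2 - b) e t \<omega>) 0 x)"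
proof -
  let ?p = "fp_density N U0 b e m"
  define n where "n = nu N U0 e 0"
  define m0 where "m0 = mu N U0 b m 0 x"
  \<comment> \<open>The Ito correction lowers the drift \<open>3 e\<^sup>2 / 2 - b\<close> to the
    exponent \<open>e\<^sup>2 - b\<close>.\<close>
  define a where "a = ln \<bar>u\<bar> + (e\<^sup>2 - b) * t"
  have n: "0 < n" using log_normal_variance_pos[OF Y] by (simp add: n_def nu_def)
  have nut: "nu N U0 e t = n + e\<^sup>2 * t" and mut: "mu N U0 b m t x = m0 + b * t"
    by (simp_all add: n_def nu_def m0_def mu_def)
  have nt: "0 < n + e\<^sup>2 * t" using n t by (simp add: add_pos_nonneg)
  have ln_gbm: "ln \<bar>gbm u (3 * e\<^sup>2 / 2 - b) e t \<omega>\<bar> = a + e * B t \<omega>" for \<omega>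
  proof -
    have "\<bar>gbm u (3 * e\<^sup>2 / 2 - b) e t \<omega>\<bar> = \<bar>u\<bar> * exp ((e\<^sup>2 - b) * t + e * B t \<omega>)"
      by (simp add: gbm_def abs_mult algebra_simps)
    then show ?thesis using u by (simp add: ln_mult a_def)
  qed
  have nz: "gbm u (3 * e\<^sup>2 / 2 - b) e t \<omega> \<noteq> 0" for \<omega> using u by (simp add: gbm_def)
  define \<phi> where "\<phi> = (\<lambda>y. exp (- (a + y)) * normal_density m0 (sqrt n) (a + y))"
  have p_gbm: "?p (gbm u (3 * e\<^sup>2 / 2 - b) e t \<omega>) 0 x = \<phi> (e * B t \<omega>)" for \<omega>
    using fp_density_eq_log_normal_form[OF nz[of \<omega>], of N U0 e 0 b m x] n
    by (simp add: log_normal_form_eq_normal_density ln_gbm \<phi>_def n_def m0_def)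
  \<comment> \<open>The term \<open>b t\<close> moves from the mean to the argument, so that
    \<open>m0\<close> is the mean on both sides of the comparison.\<close>
  have target: "?p u t x = exp (- ln \<bar>u\<bar>) * normal_density m0 (sqrt (n + e\<^sup>2 * t)) (ln \<bar>u\<bar> - b * t)"
  proof -
    have "?p u t x = exp (- ln \<bar>u\<bar>) * normal_density (m0 + b * t) (sqrt (n + e\<^sup>2 * t)) (ln \<bar>u\<bar>)"
      using fp_density_eq_log_normal_form[OF u, of N U0 e t b m x] nt
      by (simp add: log_normal_form_eq_normal_density nut mut)
    then show ?thesis by (simp add: normal_density_def algebra_simps)
  qed
  have "expectation (\<lambda>\<omega>. \<phi> (e * B t \<omega>)) = exp (- a + e\<^sup>2 * t / 2) * normal_density m0 (sqrt (n + e\<^sup>2 * t)) (a - e\<^sup>2 * t)"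
  \<comment> \<open>Vanishing noise occurs for \<open>q_m = 0\<close>: then \<open>e * B t\<close>
    has no density, but the integrand is constant.\<close>
  proof (cases "e = 0")
    case True
    then show ?thesis by (simp add: \<phi>_def prob_space)
  next
    case False
    define \<tau> where "\<tau> = \<bar>e\<bar> * sqrt t"
    have \<tau>: "0 < \<tau>" "\<tau>\<^sup>2 = e\<^sup>2 * t" using False t by (simp_all add: \<tau>_def power_mult_distrib)
    have D: "distributed M lborel (\<lambda>\<omega>. e * B t \<omega>) (normal_density 0 \<tau>)"
      using normal_density_affine[OF B_distributed[OF t], of e 0] t False by (simp add: \<tau>_def)
    have [measurable]: "\<phi> \<in> borel_measurable lborel" unfolding \<phi>_def by measurable
    have "expectation (\<lambda>\<omega>. \<phi> (e * B t \<omega>)) = (\<integral>y. normal_density 0 \<tau> y * \<phi> y \<partial>lborel)"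
      using distributed_integral[OF D, of \<phi>] by simp
    also have "\<dots> = (\<integral>y. exp (- a + \<tau>\<^sup>2 / 2) * (normal_density (- \<tau>\<^sup>2) \<tau> y * normal_density (m0 - a) (sqrt n) y) \<partial>lborel)"
    proof (intro Bochner_Integration.integral_cong refl)
      fix y
      \<comment> \<open>The factor \<open>exp (- 1 * y)\<close> is isolated for the exponential
        shift with \<open>c = - 1\<close>.\<close>
      have "normal_density 0 \<tau> y * \<phi> y = exp (- a) * (normal_density 0 \<tau> y * exp (- 1 * y)) * normal_density m0 (sqrt n) (a + y)"
        by (simp add: \<phi>_def exp_diff exp_minus field_simps exp_add)
      also have "normal_density m0 (sqrt n) (a + y) = normal_density (m0 - a) (sqrt n) y"
        by (simp add: normal_density_def algebra_simps)
      finally show "normal_density 0 \<tau> y * \<phi> y = exp (- a + \<tau>\<^sup>2 / 2) * (normal_density (- \<tau>\<^sup>2) \<tau> y * normal_density (m0 - a) (sqrt n) y)"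
        unfolding normal_density_mult_exp[OF \<tau>(1)] exp_add by simp
    qed
    also have "\<dots> = exp (- a + \<tau>\<^sup>2 / 2) * normal_density (m0 - a) (sqrt (n + \<tau>\<^sup>2)) (- \<tau>\<^sup>2)"
      using integral_normal_density_mult[of "sqrt n" \<tau> "- \<tau>\<^sup>2" "m0 - a"] n \<tau>(1) by simp
    also have "\<dots> = exp (- a + e\<^sup>2 * t / 2) * normal_density m0 (sqrt (n + e\<^sup>2 * t)) (a - e\<^sup>2 * t)"
      unfolding \<tau>(2) by (simp add: normal_density_def algebra_simps)
    finally show ?thesis .
  qed
  also have "a - e\<^sup>2 * t = ln \<bar>u\<bar> - b * t" by (simp add: a_def algebra_simps)
  finally have "exp ((e\<^sup>2 / 2 - b) * t) * expectation (\<lambda>\<omega>. \<phi> (e * B t \<omega>)) =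
      exp ((e\<^sup>2 / 2 - b) * t + (- a + e\<^sup>2 * t / 2)) * normal_density m0 (sqrt (n + e\<^sup>2 * t)) (ln \<bar>u\<bar> - b * t)"
    by (simp only: exp_add mult.assoc)
  also have "(e\<^sup>2 / 2 - b) * t + (- a + e\<^sup>2 * t / 2) = - ln \<bar>u\<bar>" by (simp add: a_def algebra_simps)
  finally show ?thesis unfolding target p_gbm by simp
qed

theorem theorem4:
  fixes a b c \<alpha> eps q_m eps_m lam_m b_m :: real and m :: nat
    and N :: "'v measure" and U0 :: "'v \<Rightarrow> real"
    and p :: "real \<Rightarrow> real \<Rightarrow> real \<Rightarrow> real"
    and M :: "'w measure" and F :: "real \<Rightarrow> 'w measure"
    and B U_hat :: "real \<Rightarrow> 'w \<Rightarrow> real"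
    and u x :: real
  assumes "\<alpha> \<in> {0<..<2}" and "eps > 0" and "q_m \<ge> 0" and "m \<ge> 1"
    and eps_m: "eps_m = eps * q_m"
    and lam_m: "lam_m = c - (a\<^sup>2 * (real m * pi)\<^sup>2 + b * (real m * pi) powr \<alpha>)"
    and b_m: "b_m = lam_m - eps_m\<^sup>2 / 2"
    and U0: "log_normal N U0"
    and p: "p = fp_density N U0 b_m eps_m m"
    and ux: "(u, x) \<in> D m"
    and B: "brownian_motion M F B"
    and U_hat: "ito_process M F B U_hat
                  (\<lambda>s \<omega>. (3 * eps_m\<^sup>2 / 2 - b_m) * U_hat s \<omega>) (\<lambda>s \<omega>. eps_m * U_hat s \<omega>)"
    and U_hat_0: "AE \<omega> in M. U_hat 0 \<omega> = u"
  shows "solves_fokker_planck m b_m eps_m p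
           (\<lambda>u x. 1 / (\<bar>u\<bar> * sqrt (2 * pi * nu N U0 eps_m 0)) *
                  exp (- ((ln \<bar>u\<bar> - mu N U0 b_m m 0 x)\<^sup>2 / (2 * nu N U0 eps_m 0))))
         \<and> (\<forall>t>0. p u t x = exp ((eps_m\<^sup>2 / 2 - b_m) * t) *
                    cond_expectation_event M (\<lambda>\<omega>. p (U_hat t \<omega>) 0 x) {\<omega>\<in>space M. U_hat 0 \<omega> = u})"
proof (intro conjI allI impI)
  show "solves_fokker_planck m b_m eps_m p
           (\<lambda>u x. 1 / (\<bar>u\<bar> * sqrt (2 * pi * nu N U0 eps_m 0)) *
                  exp (- ((ln \<bar>u\<bar> - mu N U0 b_m m 0 x)\<^sup>2 / (2 * nu N U0 eps_m 0))))"
    using fp_density_solves_fokker_planck[OF U0, of m b_m eps_m] unfolding p fp_density_def .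
next
  fix t :: real assume t: "0 < t"
  interpret brownian M F B by unfold_locales (rule B)
  let ?\<alpha> = "3 * eps_m\<^sup>2 / 2 - b_m"
  have Um: "U_hat s \<in> borel_measurable M" if "0 \<le> s" for s
    using U_hat that by (auto simp: ito_process_def adapted_def intro: measurable_F_M)
  have "uniform_measure M {\<omega>\<in>space M. U_hat 0 \<omega> = u} = M"
  proof (rule uniform_measure_prob_1)
    show "{\<omega>\<in>space M. U_hat 0 \<omega> = u} \<in> events" using Um[of 0] by measurable
    show "AE \<omega> in M. \<omega> \<in> {\<omega>\<in>space M. U_hat 0 \<omega> = u}" using U_hat_0 by simp
  qed
  \<comment> \<open>The expectation involves the single time \<open>t\<close>, so almost sure
    equality at that time is enough.\<close>
  moreover have "expectation (\<lambda>\<omega>. p (U_hat t \<omega>) 0 x) = expectation (\<lambda>\<omega>. p (gbm u ?\<alpha> eps_m t \<omega>) 0 x)"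
  proof (rule integral_cong_AE)
    have pm: "(\<lambda>v. p v 0 x) \<in> borel_measurable borel" unfolding p by (rule fp_density_measurable)
    show "(\<lambda>\<omega>. p (U_hat t \<omega>) 0 x) \<in> borel_measurable M"
      using measurable_compose[OF Um pm] t by simp
    show "(\<lambda>\<omega>. p (gbm u ?\<alpha> eps_m t \<omega>) 0 x) \<in> borel_measurable M"
      using measurable_compose[OF measurable_F_M[OF gbm_measurable_F] pm] t by simp
    show "AE \<omega> in M. p (U_hat t \<omega>) 0 x = p (gbm u ?\<alpha> eps_m t \<omega>) 0 x"
      using ito_process_linear_eq_gbm[OF U_hat U_hat_0 less_imp_le[OF t]] by eventually_elim simp
  qed
  ultimately show "p u t x = exp ((eps_m\<^sup>2 / 2 - b_m) * t) *
      cond_expectation_event M (\<lambda>\<omega>. p (U_hat t \<omega>) 0 x) {\<omega>\<in>space M. U_hat 0 \<omega> = u}"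
    using expectation_fp_density_gbm[OF U0 D_imp_nonzero[OF ux] t, of b_m eps_m m x]
    unfolding cond_expectation_event_def p by simp
qed

end
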